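(* Let $\lambda\in\mathbb N^n$ be a partition with at most $n$ parts. (a) It holds that $s_\lambda(x_1,x_2,\dots,x_n)=\kappa_{(\lambda_n,\dots,\lambda_2,\lambda_1)}$. (b) If $\lambda$ is symmetric with $\mu:=\mathrm{half}_<(\lambda)$ and $\nu:=\mathrm{half}_\le(\lambda)$, then $$P_\mu(x_1,x_2,\dots,x_n)=\kappa^{\mathsf P}_{(\lambda_n,\dots,\lambda_2,\lambda_1)}\quad\text{and}\quad Q_\nu(x_1,x_2,\dots,x_n)=\kappa^{\mathsf Q}_{(\lambda_n,\dots,\lambda_2,\lambda_1)}.$$
   Context: Let $\mathbb N=\{0,1,2,\dots\}$, $\mathbb P=\{1,2,3,\dots\}$. $S_\infty$ is the group of permutations of $\mathbb P$ generated by $s_i=(i\;\,i+1)$; it acts on $\mathbb Z[x_1,x_2,\dots]$ by permuting variables. Define $\pi_i f=(x_if-x_{i+1}s_if)/(x_i-x_{i+1})$; these satisfy the braid relations, so $\pi_w=\pi_{i_1}\cdots\pi_{i_l}$ is well-defined for any reduced word $i_1\cdots i_l$ of $w\in S_\infty$. A weak composition is a sequence $\alpha=(\alpha_1,\alpha_2,\dots)$ of nonnegative integers with finite sum; $\mathbb N^n$ is identified with the weak compositions having $\alpha_i=0$ for $i>n$ (append zeros). Put $x^\alpha=\prod_i x_i^{\alpha_i}$. A partition is a weakly decreasing weak composition. $S_\infty$ acts by $w\alpha=(\alpha_{w^{-1}(1)},\alpha_{w^{-1}(2)},\dots)$. Let $\lambda(\alpha)$ be the partition sorting $\alpha$ and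 $u(\alpha)$ the minimal-length $u\in S_\infty$ with $\alpha=u\lambda(\alpha)$. The key polynomial is $\kappa_\alpha=\pi_{u(\alpha)}x^{\lambda(\alpha)}$. $\mathsf D_\mu=\{(i,j)\in\mathbb P\times\mathbb P:1\le j\le\mu_i\}$. A partition is strict if its nonzero parts are distinct. For $w\in S_\infty$ and strict $\mu$: $\kappa^{\mathsf P}_{w,\mu}=\pi_w\prod_{(i,j)\in\mathsf D_\mu}(x_i+x_{i+j})$ and $\kappa^{\mathsf Q}_{w,\mu}=\pi_w\prod_{(i,j)\in\mathsf D_\mu}(x_i+x_{i+j-1})$. A partition $\lambda$ is symmetric if $\lambda=\lambda^{\mathsf T}$ (transpose); a weak composition $\alpha$ is symmetric if $\lambda(\alpha)$ is. For a symmetric partition $\lambda$, $\mathrm{half}_<(\lambda)$ and $\mathrm{half}_\le(\lambda)$ are the strict partitions with nonzero parts $\{\lambda_i-i:i\in\mathbb P\}\cap\mathbb P$ and $\{\lambda_i-(i-1):i\in\mathbb P\}\cap\mathbb P$. For a symmetric weak composition $\alpha$: $\kappa^{\mathsf P}_\alpha=\kappa^{\mathsf P}_{u(\alpha),\mathrm{half}_<(\lambda(\alpha))}$ and $\kappa^{\mathsf Q}_\alpha=\kappa^{\mathsf Q}_{u(\alpha),\mathrm{half}_\le(\lambda(\alpha))}$. $s_\lambda$, $P_\mu$, $Q_\mu=2^{\ell(\mu)}P_\mu$ are the Schur function, Schur $P$-function and Schur $Q$-function ($\ell(\mu)$ is the number of nonzero parts); $f(x_1,\dots,x_n)$ means $f$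 with $x_{n+1}=x_{n+2}=\cdots=0$. Explicitly, for strict $\mu$ with $r$ nonzero parts and $n\ge r$, $P_\mu(x_1,\dots,x_n)=\frac1{(n-r)!}\sum_{w\in S_n}w\Big(x^\mu\prod_{i=1}^r\prod_{j=i+1}^n\frac{x_i+x_j}{x_i-x_j}\Big)$. *)

theory Defs
  imports
    "HOL-Library.Poly_Mapping"
    "HOL-Library.FuncSet"
    "HOL-Computational_Algebra.Fraction_Field"
    "HOL-Combinatorics.Permutations"
begin

text \<open>
  All indices are 1-based: variables, parts of compositions and the points moved by permutations are
  indexed by the positive integers. The types provide a further index 0, which is never used:
  compositions vanish at 0, and the permutations considered fix 0.
\<close>


subsection \<open>The polynomial ring\<close>

text \<open>
  Integer polynomials in countably many variables, as finitely supported maps from exponent vectors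
  to coefficients. Multiplication is convolution, and the type is an integral domain.
\<close>

type_synonym mpoly = "(nat \<Rightarrow>\<^sub>0 nat) \<Rightarrow>\<^sub>0 int"

definition X :: "nat \<Rightarrow> mpoly" where
  "X i = Poly_Mapping.single (Poly_Mapping.single i 1) 1"

text \<open>
  The action of a permutation on polynomials: the coefficient of \<open>m\<close> in \<open>permute w f\<close> is that of
  \<open>m \<circ> w\<close> in \<open>f\<close>. This renames \<open>x\<^sub>i\<close> to \<open>x\<^bsub>w(i)\<^esub>\<close>, see \<open>permute_X\<close>.
\<close>

definition permute :: "(nat \<Rightarrow> nat) \<Rightarrow> mpoly \<Rightarrow> mpoly" where
  "permute w f = Poly_Mapping.map_key (Poly_Mapping.map_key w) f"

lemma permute_X:
  assumes "bij w"
  shows "permute w (X i) = X (w i)"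
proof -
  have inj: "inj w" and surj: "surj w"
    using assms by (auto simp: bij_def)
  have inj_key: "inj (Poly_Mapping.map_key w :: (nat \<Rightarrow>\<^sub>0 nat) \<Rightarrow> _)"
  proof (rule injI)
    fix p q :: "nat \<Rightarrow>\<^sub>0 nat"
    assume "Poly_Mapping.map_key w p = Poly_Mapping.map_key w q"
    then have "Poly_Mapping.lookup p (w k) = Poly_Mapping.lookup q (w k)" for k
      using inj by (metis map_key.rep_eq comp_apply)
    then show "p = q"
      using surj by (intro poly_mapping_eqI) (metis surjD)
  qed
  have "Poly_Mapping.single i 1
      = Poly_Mapping.map_key w (Poly_Mapping.single (w i) (1::nat))"
    using inj by (simp add: map_key_single)
  then show ?thesis
    unfolding permute_def X_def using inj_key by (simp add: map_key_single)
qed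


subsection \<open>Words, length and isobaric divided differences\<close>

text \<open>The product of the adjacent transpositions \<open>s\<^sub>i = (i i+1)\<close> along a word.\<close>

definition word_perm :: "nat list \<Rightarrow> nat \<Rightarrow> nat" where
  "word_perm is = foldr (\<lambda>i w. Transposition.transpose i (Suc i) \<circ> w) is id"

text \<open>
  The group generated by the \<open>s\<^sub>i\<close>, \<open>i \<ge> 1\<close>; words suffice since these are involutions.
\<close>

definition S_inf :: "(nat \<Rightarrow> nat) set" where
  "S_inf = {word_perm is | is. set is \<subseteq> {1..}}"

definition perm_length :: "(nat \<Rightarrow> nat) \<Rightarrow> nat" where
  "perm_length w = (LEAST l. \<exists>is. set is \<subseteq> {1..} \<and> word_perm is = w \<and> length is = l)"

definition reduced_word :: "nat list \<Rightarrow> (nat \<Rightarrow> nat) \<Rightarrow> bool" where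
  "reduced_word is w \<longleftrightarrow> set is \<subseteq> {1..} \<and> word_perm is = w \<and> length is = perm_length w"

text \<open>
  The quotient \<open>(x\<^sub>i f - x\<^sub>i\<^sub>+\<^sub>1 s\<^sub>i f) / (x\<^sub>i - x\<^sub>i\<^sub>+\<^sub>1)\<close> is a polynomial, and is the unique solution of the
  equation below because the ring is an integral domain.
\<close>

definition pi_op :: "nat \<Rightarrow> mpoly \<Rightarrow> mpoly" where
  "pi_op i f = (THE g. (X i - X (Suc i)) * g
     = X i * f - X (Suc i) * permute (Transposition.transpose i (Suc i)) f)"

text \<open>By the braid relations the choice of the reduced word is immaterial.\<close>

definition pi_perm :: "(nat \<Rightarrow> nat) \<Rightarrow> mpoly \<Rightarrow> mpoly" where
  "pi_perm w f = foldr pi_op (SOME is. reduced_word is w) f"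


subsection \<open>Compositions and partitions\<close>

definition weak_comp :: "(nat \<Rightarrow> nat) \<Rightarrow> bool" where
  "weak_comp \<alpha> \<longleftrightarrow> \<alpha> 0 = 0 \<and> finite {i. \<alpha> i \<noteq> 0}"

definition is_partition :: "(nat \<Rightarrow> nat) \<Rightarrow> bool" where
  "is_partition \<mu> \<longleftrightarrow> weak_comp \<mu> \<and> (\<forall>i\<ge>1. \<mu> (Suc i) \<le> \<mu> i)"

definition strict_partition :: "(nat \<Rightarrow> nat) \<Rightarrow> bool" where
  "strict_partition \<mu> \<longleftrightarrow> is_partition \<mu> \<and> inj_on \<mu> {i. \<mu> i \<noteq> 0}"

definition num_parts :: "(nat \<Rightarrow> nat) \<Rightarrow> nat" where
  "num_parts \<mu> = card {i. \<mu> i \<noteq> 0}"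

definition x_pow :: "(nat \<Rightarrow> nat) \<Rightarrow> mpoly" where
  "x_pow \<alpha> = (\<Prod>i\<in>{i. \<alpha> i \<noteq> 0}. X i ^ \<alpha> i)"

definition comp_act :: "(nat \<Rightarrow> nat) \<Rightarrow> (nat \<Rightarrow> nat) \<Rightarrow> nat \<Rightarrow> nat" where
  "comp_act w \<alpha> = (\<lambda>i. \<alpha> (inv w i))"

definition sort_comp :: "(nat \<Rightarrow> nat) \<Rightarrow> nat \<Rightarrow> nat" where
  "sort_comp \<alpha> = (THE \<mu>. is_partition \<mu> \<and> (\<exists>w\<in>S_inf. \<alpha> = comp_act w \<mu>))"

definition min_perm :: "(nat \<Rightarrow> nat) \<Rightarrow> nat \<Rightarrow> nat" where
  "min_perm \<alpha> = (ARG_MIN perm_length u. u \<in> S_inf \<and> \<alpha> = comp_act u (sort_comp \<alpha>))"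

definition diagram :: "(nat \<Rightarrow> nat) \<Rightarrow> (nat \<times> nat) set" where
  "diagram \<mu> = {(i, j). 1 \<le> i \<and> 1 \<le> j \<and> j \<le> \<mu> i}"

definition conj_partition :: "(nat \<Rightarrow> nat) \<Rightarrow> nat \<Rightarrow> nat" where
  "conj_partition \<mu> = (\<lambda>j. if j = 0 then 0 else card {i. 1 \<le> i \<and> j \<le> \<mu> i})"

definition symmetric_partition :: "(nat \<Rightarrow> nat) \<Rightarrow> bool" where
  "symmetric_partition \<mu> \<longleftrightarrow> is_partition \<mu> \<and> conj_partition \<mu> = \<mu>"

definition strict_with_parts :: "nat set \<Rightarrow> nat \<Rightarrow> nat" where
  "strict_with_parts A = (THE \<mu>. strict_partition \<mu> \<and> {\<mu> i | i. \<mu> i \<noteq> 0} = A)"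

text \<open>
  Truncated subtraction is harmless here: it only turns negative values into 0, and
  the intersection with the positive integers discards both.
\<close>

definition half_lt :: "(nat \<Rightarrow> nat) \<Rightarrow> nat \<Rightarrow> nat" where
  "half_lt \<mu> = strict_with_parts ({\<mu> i - i | i. 1 \<le> i} \<inter> {1..})"

definition half_le :: "(nat \<Rightarrow> nat) \<Rightarrow> nat \<Rightarrow> nat" where
  "half_le \<mu> = strict_with_parts ({\<mu> i - (i - 1) | i. 1 \<le> i} \<inter> {1..})"

text \<open>The composition \<open>(\<mu>\<^sub>n, \<dots>, \<mu>\<^sub>2, \<mu>\<^sub>1)\<close>.\<close>

definition rev_comp :: "nat \<Rightarrow> (nat \<Rightarrow> nat) \<Rightarrow> nat \<Rightarrow> nat" where
  "rev_comp n \<mu> = (\<lambda>i. if 1 \<le> i \<and> i \<le> n then \<mu> (n + 1 - i) else 0)"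


subsection \<open>Key polynomials and their P- and Q-analogues\<close>

definition key_poly :: "(nat \<Rightarrow> nat) \<Rightarrow> mpoly" where
  "key_poly \<alpha> = pi_perm (min_perm \<alpha>) (x_pow (sort_comp \<alpha>))"

definition key_P_pair :: "(nat \<Rightarrow> nat) \<Rightarrow> (nat \<Rightarrow> nat) \<Rightarrow> mpoly" where
  "key_P_pair w \<mu> = pi_perm w (\<Prod>(i, j)\<in>diagram \<mu>. X i + X (i + j))"

definition key_Q_pair :: "(nat \<Rightarrow> nat) \<Rightarrow> (nat \<Rightarrow> nat) \<Rightarrow> mpoly" where
  "key_Q_pair w \<mu> = pi_perm w (\<Prod>(i, j)\<in>diagram \<mu>. X i + X (i + j - 1))"

text \<open>The following two are only meaningful if \<open>sort_comp \<alpha>\<close> is a symmetric partition.\<close>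

definition key_P :: "(nat \<Rightarrow> nat) \<Rightarrow> mpoly" where
  "key_P \<alpha> = key_P_pair (min_perm \<alpha>) (half_lt (sort_comp \<alpha>))"

definition key_Q :: "(nat \<Rightarrow> nat) \<Rightarrow> mpoly" where
  "key_Q \<alpha> = key_Q_pair (min_perm \<alpha>) (half_le (sort_comp \<alpha>))"


subsection \<open>Schur polynomials and Schur P- and Q-polynomials\<close>

text \<open>
  The Schur function is the generating function of semistandard tableaux with positive integer
  entries. Setting \<open>x\<^sub>i = 0\<close> for \<open>i > n\<close> leaves the tableaux with entries in \<open>{1..n}\<close>.
  Tableaux are extensional functions on the diagram, so that there are finitely many of them.
\<close>

definition ssyt :: "nat \<Rightarrow> (nat \<Rightarrow> nat) \<Rightarrow> (nat \<times> nat \<Rightarrow> nat) set" where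
  "ssyt n \<mu> = {T \<in> diagram \<mu> \<rightarrow>\<^sub>E {1..n}.
     (\<forall>i j. (i, j) \<in> diagram \<mu> \<and> (i, Suc j) \<in> diagram \<mu> \<longrightarrow> T (i, j) \<le> T (i, Suc j)) \<and>
     (\<forall>i j. (i, j) \<in> diagram \<mu> \<and> (Suc i, j) \<in> diagram \<mu> \<longrightarrow> T (i, j) < T (Suc i, j))}"

definition schur_poly :: "nat \<Rightarrow> (nat \<Rightarrow> nat) \<Rightarrow> mpoly" where
  "schur_poly n \<mu> = (\<Sum>T\<in>ssyt n \<mu>. \<Prod>b\<in>diagram \<mu>. X (T b))"

text \<open>
  The Schur P-function of a strict partition \<open>\<mu>\<close> with \<open>r\<close> parts, restricted to \<open>n\<close> variables:
  \[ \frac{1}{(n-r)!} \sum_{w \in S_n} w \Big( x^\mu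
       \prod_{i=1}^{r} \prod_{j=i+1}^{n} \frac{x_i + x_j}{x_i - x_j} \Big) \]
  if \<open>r \<le> n\<close>, and zero otherwise. The sum lives in the fraction field of the polynomial ring, on
  which \<open>w\<close> acts through numerator and denominator, but its value is an integer polynomial.
\<close>

definition schur_P :: "nat \<Rightarrow> (nat \<Rightarrow> nat) \<Rightarrow> mpoly" where
  "schur_P n \<mu> =
    (let r = num_parts \<mu>;
         N = x_pow \<mu> * (\<Prod>i\<in>{1..r}. \<Prod>j\<in>{i+1..n}. X i + X j);
         D = (\<Prod>i\<in>{1..r}. \<Prod>j\<in>{i+1..n}. X i - X j)
     in if r \<le> n
        then THE p. Fract p 1
               = 1 / of_nat (fact (n - r)) * (\<Sum>w | w permutes {1..n}. Fract (permute w N) (permute w D))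
        else 0)"

definition schur_Q :: "nat \<Rightarrow> (nat \<Rightarrow> nat) \<Rightarrow> mpoly" where
  "schur_Q n \<mu> = 2 ^ num_parts \<mu> * schur_P n \<mu>"

end

theory Submission
  imports "HOL-Combinatorics.Multiset_Permutations" "HOL-Computational_Algebra.Polynomial" Defs
begin

text \<open>
  The composition \<open>\<alpha> = (\<lambda>\<^sub>n, \<dots>, \<lambda>\<^sub>1)\<close> is the most anti-dominant rearrangement of \<open>\<lambda>\<close>, and for a
  seed \<open>F\<close> that is invariant under the \<open>s\<^sub>i\<close> fixing \<open>\<lambda>\<close> the operator \<open>\<pi>\<close> of its minimal permutation acts
  like the longest element of \<open>S\<^sub>n\<close>: it sends \<open>F\<close> to the Weyl symmetrization
  \[ W F = \sum_{w \in S_n} w \Big( F \prod_{i<j} \frac{x_i}{x_i - x_j} \Big) . \]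
  Indeed \<open>W \<pi>\<^sub>i = W\<close> for \<open>i < n\<close>, and \<open>W\<close> fixes symmetric polynomials, so it only remains to see that the
  result of applying the word is symmetric. For this the words of minimal permutations are read as
  chains of rearrangements of \<open>\<lambda>\<close> in which every letter creates an inversion; the braid relations show
  that the polynomial obtained depends on the last rearrangement alone (\<open>chain_unique\<close>), and since \<open>\<alpha>\<close>
  is weakly increasing on \<open>{1..n}\<close> every \<open>s\<^sub>i\<close> fixes it (\<open>chain_weak_ascent\<close>). The outcome is
  \<open>pi_min_perm_rev_comp\<close>. The seeds of the P- and Q-versions have the required invariance because they
  are products over the half of a diagram that equals its transpose.

  What is left are identities between rational functions. They are stated for a finite set of distinct
  elements of a field, the values of the variables, so that symmetric rational functions become
  functions of sets and induction removes one element at a time.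

  For part (a), \<open>W x\<^sup>\<lambda>\<close> is a quotient of alternants. Expanding it along the first row and
  discarding an alternant with two equal exponents gives the branching rule of semistandard tableaux
  (\<open>alternant_sum_branching\<close>, \<open>tableau_sum_branching\<close>).

  For part (b), if \<open>\<lambda>\<^sub>1 = n\<close>, then the first row of the half diagram contributes
  \<open>\<Prod>\<^sub>j (x\<^sub>1 + x\<^sub>j)\<close> over all \<open>j > 1\<close>, exactly what the recursion of the Schur P-polynomial along its first
  part requires. If \<open>\<lambda>\<^sub>1 < n\<close>, then \<open>x\<^sub>n\<close> does not occur in the seed and summing over its value
  reduces the claim to stability: the operator \<open>\<pi>\<^sub>1 \<cdots> \<pi>\<^sub>n\<^sub>-\<^sub>1\<close> turns \<open>P\<^sub>\<mu>\<close> in \<open>n - 1\<close> variables into \<open>P\<^sub>\<mu>\<close>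
  in \<open>n\<close> variables as long as \<open>\<mu>\<^sub>1 < n\<close> (\<open>schur_P_sum_stable\<close>). The error term of this reduction
  is the same operator applied to \<open>x\<^sub>n\<close> times the P-polynomial with \<open>\<mu>\<^sub>1\<close> lowered by one. It vanishes:
  either two exponents coincide, or the P-polynomial is a constant, or stability for fewer
  variables writes it as a double sum that is antisymmetric in the two variables adjoined.
\<close>

section \<open>Lagrange interpolation\<close>

lemma sum_swap_distinct:
  fixes h :: "'a \<Rightarrow> 'a \<Rightarrow> 'b::comm_monoid_add"
  assumes "finite S"
  shows "(\<Sum>i\<in>S. \<Sum>k\<in>S - {i}. h i k) = (\<Sum>k\<in>S. \<Sum>i\<in>S - {k}. h i k)"
  using assms by (subst (1 2) sum.Sigma) (auto intro!: sum.reindex_bij_witness[of _ prod.swap prod.swap])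

text \<open>
  All vanishing statements about P-sums and alternants below reduce to this cancellation in pairs.
\<close>

lemma sum_antisymmetric_eq_0:
  fixes h :: "'a \<Rightarrow> 'a \<Rightarrow> 'b::field_char_0"
  assumes "finite S" and "\<And>i k. i \<in> S \<Longrightarrow> k \<in> S \<Longrightarrow> i \<noteq> k \<Longrightarrow> h k i = - h i k"
  shows "(\<Sum>i\<in>S. \<Sum>k\<in>S - {i}. h i k) = 0"
proof -
  have "(\<Sum>i\<in>S. \<Sum>k\<in>S - {i}. h i k) = (\<Sum>i\<in>S. \<Sum>k\<in>S - {i}. h k i)"
    using sum_swap_distinct[OF assms(1)] .
  also have "\<dots> = - (\<Sum>i\<in>S. \<Sum>k\<in>S - {i}. h i k)"
    unfolding sum_negf[symmetric] using assms(2) by (intro sum.cong refl) auto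
  finally show ?thesis by simp
qed

text \<open>
  The difference of the two sides has degree less than \<open>card S\<close> and vanishes on \<open>S\<close>.
\<close>

lemma lagrange_interpolation:
  fixes p :: "'a::field poly"
  assumes "finite S" and "degree p < card S"
  shows "(\<Sum>k\<in>S. smult (poly p k / (\<Prod>b\<in>S - {k}. k - b)) (\<Prod>b\<in>S - {k}. [:- b, 1:])) = p"
    (is "?L = p")
proof (rule ccontr)
  assume "?L \<noteq> p"
  then have nz: "?L - p \<noteq> 0" by simp
  have deg1: "degree (\<Prod>b\<in>S - {k}. [:- b, 1:]) \<le> card S - 1" if "k \<in> S" for k
    using degree_prod_sum_le[of "S - {k}" "\<lambda>b. [:- b, 1:]"] assms(1) that by simp
  have "degree ?L \<le> card S - 1"
    by (rule degree_sum_le[OF assms(1)]) (rule order_trans[OF degree_smult_le deg1])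
  then have deg: "degree (?L - p) < card S"
    using assms(2) by (intro degree_diff_less) auto
  have "poly (?L - p) x = 0" if x: "x \<in> S" for x
  proof -
    have "poly ?L x = (\<Sum>k\<in>S. poly p k / (\<Prod>b\<in>S - {k}. k - b) * (\<Prod>b\<in>S - {k}. x - b))"
      by (simp add: poly_sum poly_prod)
    also have "\<dots> = poly p x / (\<Prod>b\<in>S - {x}. x - b) * (\<Prod>b\<in>S - {x}. x - b)"
      using x assms(1) by (subst sum.remove[of _ x]) (auto intro!: sum.neutral)
    also have "\<dots> = poly p x" using assms(1) by simp
    finally show ?thesis by simp
  qed
  then have "S \<subseteq> {x. poly (?L - p) x = 0}" by auto
  then have "card S \<le> card {x. poly (?L - p) x = 0}"
    by (rule card_mono[OF poly_roots_finite[OF nz]])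
  also have "\<dots> \<le> degree (?L - p)" by (rule card_poly_roots_bound[OF nz])
  finally have "card S \<le> degree (?L - p)" .
  with deg show False by simp
qed

lemma lagrange_at_0:
  fixes p :: "'a::field poly"
  assumes "finite S" and "degree p < card S"
  shows "(\<Sum>k\<in>S. (\<Prod>b\<in>S - {k}. b / (b - k)) * poly p k) = poly p 0"
proof -
  have "poly p 0 = (\<Sum>k\<in>S. poly p k / (\<Prod>b\<in>S - {k}. k - b) * (\<Prod>b\<in>S - {k}. - b))"
    by (subst lagrange_interpolation[OF assms, symmetric]) (simp add: poly_sum poly_prod)
  also have "\<dots> = (\<Sum>k\<in>S. (\<Prod>b\<in>S - {k}. b / (b - k)) * poly p k)"
  proof (intro sum.cong refl)
    fix k
    have "(\<Prod>b\<in>S - {k}. - b) / (\<Prod>b\<in>S - {k}. k - b) = (\<Prod>b\<in>S - {k}. b / (b - k))"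
      unfolding prod_dividef[symmetric] by (intro prod.cong refl) (metis minus_diff_eq minus_divide_divide minus_minus)
    then show "poly p k / (\<Prod>b\<in>S - {k}. k - b) * (\<Prod>b\<in>S - {k}. - b) = (\<Prod>b\<in>S - {k}. b / (b - k)) * poly p k"
      by (metis mult.commute times_divide_eq_left times_divide_eq_right)
  qed
  finally show ?thesis by simp
qed

lemma lagrange_leading_coeff:
  fixes p :: "'a::field poly"
  assumes "finite S" and "degree p < card S"
  shows "(\<Sum>k\<in>S. poly p k / (\<Prod>b\<in>S - {k}. k - b)) = coeff p (card S - 1)"
proof -
  have c: "coeff (\<Prod>b\<in>S - {k}. [:- b, 1:]) (card S - 1) = 1" if "k \<in> S" for k
  proof -
    have "degree (\<Prod>b\<in>S - {k}. [:- b, 1:]) = card S - 1"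
      using assms(1) that by (subst degree_prod_eq_sum_degree) auto
    moreover have "lead_coeff (\<Prod>b\<in>S - {k}. [:- b, 1:]) = 1"
      by (simp add: lead_coeff_prod)
    ultimately show ?thesis by metis
  qed
  have "coeff p (card S - 1) =
      (\<Sum>k\<in>S. poly p k / (\<Prod>b\<in>S - {k}. k - b) * coeff (\<Prod>b\<in>S - {k}. [:- b, 1:]) (card S - 1))"
    by (subst lagrange_interpolation[OF assms, symmetric]) (simp add: coeff_sum)
  also have "\<dots> = (\<Sum>k\<in>S. poly p k / (\<Prod>b\<in>S - {k}. k - b))"
    using c by (intro sum.cong refl) simp
  finally show ?thesis by simp
qed

text \<open>
  The P-sum with the single exponent 0, which is the one degenerate case that survives when a part
  of size 1 is lowered: only its independence of the values in \<open>S\<close> matters later. The monic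
  polynomial \<open>\<Prod>\<^sub>b (t + b)\<close> has degree \<open>card S\<close>, so interpolation at \<open>S\<close> together with the node 0
  recovers its leading coefficient 1; the node 0 supplies the sign.
\<close>

lemma sum_ratio_card_dependent:
  fixes S :: "'a::field_char_0 set"
  assumes "finite S" and "0 \<notin> S"
  shows "2 * (\<Sum>k\<in>S. \<Prod>b\<in>S - {k}. (k + b) / (k - b)) = 1 - (- 1) ^ card S"
proof -
  let ?p = "\<Prod>b\<in>S. [:b, 1:]"
  have deg: "degree ?p = card S"
    using assms(1) by (subst degree_prod_eq_sum_degree) auto
  have lc: "coeff ?p (card S) = 1"
    using deg lead_coeff_prod[of "\<lambda>b. [:b, 1:]" S] by simp
  have eq: "poly ?p k / (\<Prod>b\<in>insert 0 S - {k}. k - b) = 2 * (\<Prod>b\<in>S - {k}. (k + b) / (k - b))"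
    if k: "k \<in> S" for k
  proof -
    have "k \<noteq> 0" using k assms(2) by auto
    have "(\<Prod>b\<in>insert 0 S - {k}. k - b) = k * (\<Prod>b\<in>S - {k}. k - b)"
      using \<open>k \<noteq> 0\<close> assms by (simp add: insert_Diff_if)
    moreover have "poly ?p k = 2 * k * (\<Prod>b\<in>S - {k}. k + b)"
      using prod.remove[OF assms(1) k, of "\<lambda>b. k + b"] by (simp add: poly_prod add.commute)
    ultimately show ?thesis using \<open>k \<noteq> 0\<close> by (simp add: prod_dividef)
  qed
  have p0: "poly ?p 0 / (\<Prod>b\<in>insert 0 S - {0}. 0 - b) = (- 1) ^ card S"
  proof -
    have "(\<Prod>b\<in>S. b) \<noteq> 0" using assms by simp
    moreover have "(\<Prod>b\<in>S. - b) = (- 1) ^ card S * (\<Prod>b\<in>S. b)"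
      by (rule prod_uminus)
    ultimately show ?thesis using assms(2)
      by (simp add: poly_prod power_minus' field_simps flip: power_add mult_2)
  qed
  have "(\<Sum>k\<in>insert 0 S. poly ?p k / (\<Prod>b\<in>insert 0 S - {k}. k - b)) = coeff ?p (card S)"
    using lagrange_leading_coeff[of "insert 0 S" ?p] assms deg by simp
  then have "(- 1) ^ card S + (\<Sum>k\<in>S. 2 * (\<Prod>b\<in>S - {k}. (k + b) / (k - b))) = 1"
    using assms lc p0 eq by simp
  then show ?thesis by (simp add: sum_distrib_left algebra_simps)
qed

section \<open>Schur P-sums and adjoining a variable\<close>

text \<open>
  For a strict partition with the parts in the list, this is the Schur P-polynomial at the values in
  \<open>S\<close>: the values of \<open>x\<^sub>1, x\<^sub>2, \<dots>\<close> are chosen one after the other, and nothing depends on the order of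
  those left over. Lists that are not strictly decreasing occur as intermediate terms.
\<close>

fun schur_P_sum :: "'a::field set \<Rightarrow> nat list \<Rightarrow> 'a" where
  "schur_P_sum S [] = 1"
| "schur_P_sum S (m # ms) =
    (\<Sum>k\<in>S. k ^ m * (\<Prod>b\<in>S - {k}. (k + b) / (k - b)) * schur_P_sum (S - {k}) ms)"

text \<open>
  If \<open>g\<close> gives the values of a symmetric polynomial in \<open>n - 1\<close> variables, this is the value of
  \<open>\<pi>\<^sub>1 \<cdots> \<pi>\<^sub>n\<^sub>-\<^sub>1 g\<close> at the \<open>n\<close> elements of \<open>S\<close>; the summation index is the value taken by \<open>x\<^sub>n\<close>.
\<close>

definition adjoin_sum :: "'a::field set \<Rightarrow> ('a set \<Rightarrow> 'a) \<Rightarrow> 'a" where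
  "adjoin_sum S g = (\<Sum>c\<in>S. (\<Prod>b\<in>S - {c}. b / (b - c)) * g (S - {c}))"

lemma prod_remove_divided:
  fixes f :: "'a \<Rightarrow> 'b::comm_monoid_mult"
  assumes "finite S" and "i \<in> S" and "k \<noteq> i"
  shows "(\<Prod>b\<in>S - {k}. f b) = f i * (\<Prod>b\<in>S - {i} - {k}. f b)"
proof -
  have "S - {i} - {k} = S - {k} - {i}" by auto
  then show ?thesis using prod.remove[of "S - {k}" i f] assms by simp
qed

text \<open>
  Exchanging the values of the first two variables only changes the sign of the factor
  \<open>(x\<^sub>1 + x\<^sub>2) / (x\<^sub>1 - x\<^sub>2)\<close>.
\<close>

lemma schur_P_sum_equal_heads:
  fixes S :: "'a::field_char_0 set"
  assumes "finite S"
  shows "schur_P_sum S (m # m # ms) = 0"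
proof -
  let ?h = "\<lambda>k i. k ^ m * (\<Prod>b\<in>S - {k}. (k + b) / (k - b)) *
    (i ^ m * (\<Prod>b\<in>S - {k} - {i}. (i + b) / (i - b)) * schur_P_sum (S - {k} - {i}) ms)"
  have "?h i k = - ?h k i" if "k \<in> S" "i \<in> S" "k \<noteq> i" for k i
  proof -
    have S: "S - {i} - {k} = S - {k} - {i}" by auto
    have neg: "(i + k) / (i - k) = - ((k + i) / (k - i))"
      by (metis add.commute minus_diff_eq minus_divide_right)
    have k: "(\<Prod>b\<in>S - {k}. (k + b) / (k - b)) = (k + i) / (k - i) * (\<Prod>b\<in>S - {k} - {i}. (k + b) / (k - b))"
      using prod_remove_divided[OF assms, of i k "\<lambda>b. (k + b) / (k - b)"] that unfolding S by simp
    have i: "(\<Prod>b\<in>S - {i}. (i + b) / (i - b)) = - ((k + i) / (k - i)) * (\<Prod>b\<in>S - {k} - {i}. (i + b) / (i - b))"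
      using prod_remove_divided[OF assms, of k i "\<lambda>b. (i + b) / (i - b)"] that unfolding neg by simp
    show ?thesis
      unfolding k i S by (simp only: mult_minus_left mult_minus_right mult_ac)
  qed
  then have "(\<Sum>k\<in>S. \<Sum>i\<in>S - {k}. ?h k i) = 0"
    by (rule sum_antisymmetric_eq_0[OF assms, where h = ?h])
  then show ?thesis by (simp add: sum_distrib_left)
qed

text \<open>
  The two values \<open>c\<close> and \<open>d\<close> adjoined enter symmetrically except for \<open>c d / (d - c)\<close>.
\<close>

lemma adjoin_twice_antisymmetric:
  fixes S :: "'a::field_char_0 set"
  assumes "finite S"
  shows "(\<Sum>c\<in>S. (\<Prod>b\<in>S - {c}. b / (b - c)) * c * adjoin_sum (S - {c}) g) = 0"
proof -
  let ?h = "\<lambda>c d. (\<Prod>b\<in>S - {c}. b / (b - c)) * c *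
    ((\<Prod>b\<in>S - {c} - {d}. b / (b - d)) * g (S - {c} - {d}))"
  have "?h d c = - ?h c d" if "c \<in> S" "d \<in> S" "c \<noteq> d" for c d
  proof -
    have S: "S - {d} - {c} = S - {c} - {d}" by auto
    have neg: "c / (c - d) * d = - (d / (d - c) * c)"
      by (metis minus_diff_eq minus_divide_right mult.commute times_divide_eq_left)
    have c: "(\<Prod>b\<in>S - {c}. b / (b - c)) = d / (d - c) * (\<Prod>b\<in>S - {c} - {d}. b / (b - c))"
      using prod_remove_divided[OF assms, of d c "\<lambda>b. b / (b - c)"] that unfolding S by simp
    have d: "(\<Prod>b\<in>S - {d}. b / (b - d)) * d = - (d / (d - c) * c) * (\<Prod>b\<in>S - {c} - {d}. b / (b - d))"
      using prod_remove_divided[OF assms, of c d "\<lambda>b. b / (b - d)"] that unfolding neg[symmetric] by simp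
    show ?thesis
      unfolding c d S by (simp only: mult_minus_left mult_minus_right mult_ac)
  qed
  then have "(\<Sum>c\<in>S. \<Sum>d\<in>S - {c}. ?h c d) = 0"
    by (rule sum_antisymmetric_eq_0[OF assms, where h = ?h])
  then show ?thesis by (simp add: sum_distrib_left adjoin_sum_def)
qed

lemma adjoin_sum_1:
  fixes S :: "'a::field set"
  assumes "finite S" and "S \<noteq> {}"
  shows "adjoin_sum S (\<lambda>_. 1) = 1"
  using lagrange_at_0[of S 1] assms by (simp add: adjoin_sum_def card_gt_0_iff)

lemma adjoin_variable_eq_0:
  fixes S :: "'a::field set"
  assumes "finite S" and "card S \<ge> 2"
  shows "(\<Sum>c\<in>S. (\<Prod>b\<in>S - {c}. b / (b - c)) * c) = 0"
  using lagrange_at_0[of S "[:0, 1:]"] assms by simp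

text \<open>
  Write both sides as sums over the value \<open>k\<close> of \<open>x\<^sub>1\<close> and the value \<open>c\<close> of the variable adjoined. The
  left-hand side has the factor \<open>(k + c) / (k - c)\<close> where adjoining \<open>c\<close> last only gives \<open>k / (k - c)\<close>.
  The excess \<open>c / (k - c)\<close> equals \<open>c k\<^sup>-\<^sup>1 \<cdot> k / (k - c)\<close>, so it multiplies by \<open>c\<close> and lowers the first
  exponent.
\<close>

lemma schur_P_sum_split:
  fixes S :: "'a::field set"
  assumes "finite S"
    and tail: "\<And>k. k \<in> S \<Longrightarrow> schur_P_sum (S - {k}) ms = adjoin_sum (S - {k}) (\<lambda>T. schur_P_sum T ms)"
  shows "schur_P_sum S (Suc m # ms) = adjoin_sum S (\<lambda>T. schur_P_sum T (Suc m # ms))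
    + (\<Sum>c\<in>S. (\<Prod>b\<in>S - {c}. b / (b - c)) * c * schur_P_sum (S - {c}) (m # ms))"
proof -
  let ?P = "\<lambda>c k. \<Prod>b\<in>S - {c} - {k}. (k + b) / (k - b)"
  let ?B = "\<lambda>c k. \<Prod>b\<in>S - {c} - {k}. b / (b - c)"
  let ?A = "\<lambda>c k. schur_P_sum (S - {c} - {k}) ms"
  have pB: "(\<Prod>b\<in>S - {c}. b / (b - c)) = k / (k - c) * ?B c k" if "k \<in> S - {c}" for c k
    using prod.remove[of "S - {c}" k "\<lambda>b. b / (b - c)"] assms(1) that by simp
  have pP: "(\<Prod>b\<in>S - {k}. (k + b) / (k - b)) = (k + c) / (k - c) * ?P c k" if "c \<in> S - {k}" for c k
    using prod_remove_divided[OF assms(1), of c k "\<lambda>b. (k + b) / (k - b)"] that by auto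
  have comm: "S - {k} - {c} = S - {c} - {k}" for c k by auto
  have "schur_P_sum S (Suc m # ms) =
      (\<Sum>k\<in>S. \<Sum>c\<in>S - {k}. k ^ Suc m * ((k + c) / (k - c) * ?P c k) * (?B c k * ?A c k))"
  proof -
    have "schur_P_sum S (Suc m # ms) = (\<Sum>k\<in>S. \<Sum>c\<in>S - {k}.
        k ^ Suc m * (\<Prod>b\<in>S - {k}. (k + b) / (k - b)) * (?B c k * ?A c k))"
      by (simp add: tail adjoin_sum_def sum_distrib_left comm)
    then show ?thesis
      by (simp only:) (intro sum.cong refl, simp only: pP)
  qed
  also have "\<dots> = (\<Sum>c\<in>S. \<Sum>k\<in>S - {c}. k ^ Suc m * ((k + c) / (k - c) * ?P c k) * (?B c k * ?A c k))"
    by (rule sum_swap_distinct[OF assms(1)])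
  also have "\<dots> = (\<Sum>c\<in>S. \<Sum>k\<in>S - {c}. k / (k - c) * ?B c k * (k ^ Suc m * ?P c k * ?A c k)
      + k / (k - c) * ?B c k * c * (k ^ m * ?P c k * ?A c k))"
  proof (intro sum.cong refl)
    fix c k :: 'a
    have "k ^ Suc m * ((k + c) / (k - c)) = k / (k - c) * k ^ Suc m + k / (k - c) * c * k ^ m"
      by (simp add: divide_inverse algebra_simps)
    then have "k ^ Suc m * ((k + c) / (k - c)) * (?P c k * ?B c k * ?A c k) =
        (k / (k - c) * k ^ Suc m + k / (k - c) * c * k ^ m) * (?P c k * ?B c k * ?A c k)"
      by simp
    then show "k ^ Suc m * ((k + c) / (k - c) * ?P c k) * (?B c k * ?A c k) =
        k / (k - c) * ?B c k * (k ^ Suc m * ?P c k * ?A c k)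
        + k / (k - c) * ?B c k * c * (k ^ m * ?P c k * ?A c k)"
      by (simp only: distrib_right distrib_left mult_ac)
  qed
  also have "\<dots> = (\<Sum>c\<in>S. \<Sum>k\<in>S - {c}.
        (\<Prod>b\<in>S - {c}. b / (b - c)) * (k ^ Suc m * ?P c k * ?A c k)
      + (\<Prod>b\<in>S - {c}. b / (b - c)) * c * (k ^ m * ?P c k * ?A c k))"
    by (intro sum.cong refl) (simp only: pB)
  also have "\<dots> = adjoin_sum S (\<lambda>T. schur_P_sum T (Suc m # ms))
      + (\<Sum>c\<in>S. (\<Prod>b\<in>S - {c}. b / (b - c)) * c * schur_P_sum (S - {c}) (m # ms))"
    by (simp only: sum.distrib adjoin_sum_def schur_P_sum.simps sum_distrib_left)
  finally show ?thesis .
qed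

text \<open>
  The bound on the parts is inherited both by the tail of the list and by the list with its head
  lowered, each with one element fewer in \<open>S\<close>; this is what makes the induction on the cardinality
  work.
\<close>

theorem schur_P_sum_stable:
  fixes S :: "'a::field_char_0 set"
  assumes "finite S" "0 \<notin> S" "sorted_wrt (>) ms" "0 \<notin> set ms" "S \<noteq> {}" "\<forall>m\<in>set ms. m < card S"
  shows "schur_P_sum S ms = adjoin_sum S (\<lambda>T. schur_P_sum T ms)"
  using assms
proof (induction "card S" arbitrary: S ms rule: less_induct)
  case less
  note fin = less.prems(1)
  show ?case
  proof (cases ms)
    case Nil
    then show ?thesis using adjoin_sum_1 less.prems by simp
  next
    case (Cons m0 ms')
    then obtain m where m0: "m0 = Suc m" using less.prems(4) by (cases m0) auto
    have big: "card S \<ge> 2" using less.prems(6) Cons m0 by auto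
    have small: "card (S - {k}) < card S" "S - {k} \<noteq> {}" if "k \<in> S" for k
    proof -
      show "card (S - {k}) < card S" using fin that by (rule card_Diff1_less)
      have "card (S - {k}) \<ge> 1" using that fin big by simp
      then show "S - {k} \<noteq> {}" by (metis card.empty not_one_le_zero)
    qed
    have lt: "n < m0" if "n \<in> set ms'" for n using less.prems(3) Cons that by auto
    have "schur_P_sum S ms = adjoin_sum S (\<lambda>T. schur_P_sum T ms)
        + (\<Sum>c\<in>S. (\<Prod>b\<in>S - {c}. b / (b - c)) * c * schur_P_sum (S - {c}) (m # ms'))"
      unfolding Cons m0
    proof (rule schur_P_sum_split[OF fin], rule less.hyps)
      fix k assume k: "k \<in> S"
      show "\<forall>n\<in>set ms'. n < card (S - {k})"
        using lt less.prems(6) Cons fin k by fastforce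
    qed (use less.prems Cons small in auto)
    also have "(\<Sum>c\<in>S. (\<Prod>b\<in>S - {c}. b / (b - c)) * c * schur_P_sum (S - {c}) (m # ms')) = 0"
    proof -
      \<comment> \<open>Lowering the first part produces equal parts, the part 0, or a strict list again.\<close>
      consider (eq) ms'' where "ms' = m # ms''" | (one) "m = 0" "ms' = []"
        | (strict) "sorted_wrt (>) (m # ms')" "m > 0"
      proof (cases ms')
        case Nil
        then show ?thesis using one strict by (cases "m = 0") auto
      next
        case (Cons m1 ms'')
        have "m1 > 0" using less.prems(4) \<open>ms = m0 # ms'\<close> Cons by (cases m1) auto
        show ?thesis
        proof (cases "m1 = m")
          case False
          then have "m1 < m" using lt[of m1] Cons m0 by auto
          moreover have "\<forall>n\<in>set ms''. n < m1"
            using less.prems(3) \<open>ms = m0 # ms'\<close> Cons by auto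
          ultimately have "\<forall>n\<in>set ms'. n < m" using Cons by auto
          moreover have "sorted_wrt (>) ms'" using less.prems(3) \<open>ms = m0 # ms'\<close> by simp
          ultimately show ?thesis using strict \<open>m1 < m\<close> by simp
        qed (use eq Cons in auto)
      qed
      then show ?thesis
      proof cases
        case eq
        then show ?thesis using fin by (simp add: schur_P_sum_equal_heads del: schur_P_sum.simps)
      next
        case one
        define z :: 'a where "z = (1 - (- 1) ^ (card S - 1)) / 2"
        have "schur_P_sum (S - {c}) (m # ms') = z" if "c \<in> S" for c
          using sum_ratio_card_dependent[of "S - {c}"] one fin less.prems(2) that
          by (simp add: z_def field_simps)
        then have "(\<Sum>c\<in>S. (\<Prod>b\<in>S - {c}. b / (b - c)) * c * schur_P_sum (S - {c}) (m # ms'))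
            = (\<Sum>c\<in>S. (\<Prod>b\<in>S - {c}. b / (b - c)) * c) * z"
          unfolding sum_distrib_right by (intro sum.cong refl) simp
        then show ?thesis using adjoin_variable_eq_0[OF fin big] by simp
      next
        case strict
        have "schur_P_sum (S - {c}) (m # ms') =
            adjoin_sum (S - {c}) (\<lambda>T. schur_P_sum T (m # ms'))" if c: "c \<in> S" for c
        proof (rule less.hyps)
          show "\<forall>n\<in>set (m # ms'). n < card (S - {c})"
            using strict m0 less.prems(6) Cons fin c by fastforce
        qed (use less.prems Cons small strict c in auto)
        then have "(\<Sum>c\<in>S. (\<Prod>b\<in>S - {c}. b / (b - c)) * c * schur_P_sum (S - {c}) (m # ms'))
            = (\<Sum>c\<in>S. (\<Prod>b\<in>S - {c}. b / (b - c)) * c *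
                adjoin_sum (S - {c}) (\<lambda>T. schur_P_sum T (m # ms')))"
          by (intro sum.cong refl) simp
        then show ?thesis using adjoin_twice_antisymmetric[OF fin] by simp
      qed
    qed
    finally show ?thesis by simp
  qed
qed

section \<open>Symmetrized products over half diagrams\<close>

lemma sum_permutations_by_head:
  assumes "finite S" and "S \<noteq> {}"
  shows "(\<Sum>ys\<in>permutations_of_set S. f ys) = (\<Sum>k\<in>S. \<Sum>ys\<in>permutations_of_set (S - {k}). f (k # ys))"
  unfolding permutations_of_set_nonempty[OF assms(2)]
  using assms(1) by (subst sum.UNION_disjoint) (auto simp: sum.reindex)

lemma sum_permutations_by_last:
  assumes "finite S" and "S \<noteq> {}"
  shows "(\<Sum>ys\<in>permutations_of_set S. f ys) = (\<Sum>k\<in>S. \<Sum>ys\<in>permutations_of_set (S - {k}). f (ys @ [k]))"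
proof -
  have r: "(\<Sum>ys\<in>permutations_of_set T. g (rev ys)) = (\<Sum>ys\<in>permutations_of_set T. g ys)"
    for T and g :: "'a list \<Rightarrow> 'b"
    using sum.reindex[of rev "permutations_of_set T" g] by simp
  have "(\<Sum>ys\<in>permutations_of_set S. f ys) = (\<Sum>ys\<in>permutations_of_set S. f (rev ys))"
    by (rule r[symmetric])
  also have "\<dots> = (\<Sum>k\<in>S. \<Sum>ys\<in>permutations_of_set (S - {k}). f (rev ys @ [k]))"
    by (simp add: sum_permutations_by_head[OF assms])
  also have "\<dots> = (\<Sum>k\<in>S. \<Sum>ys\<in>permutations_of_set (S - {k}). f (ys @ [k]))"
    by (intro sum.cong refl r)
  finally show ?thesis .
qed

text \<open>
  The product of \<open>y\<^sub>i / (y\<^sub>i - y\<^sub>j)\<close> over \<open>i < j\<close>. Summing a function against it over all orderings of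
  the variables is the action of \<open>\<pi>\<close> for the longest permutation.
\<close>

fun weyl_kernel :: "'a::field list \<Rightarrow> 'a" where
  "weyl_kernel [] = 1"
| "weyl_kernel (y # ys) = (\<Prod>b\<in>set ys. y / (y - b)) * weyl_kernel ys"

lemma weyl_kernel_snoc:
  "distinct (ys @ [c]) \<Longrightarrow> weyl_kernel (ys @ [c]) = (\<Prod>b\<in>set ys. b / (b - c)) * weyl_kernel ys"
  by (induction ys) (auto simp: mult_ac)

text \<open>
  Rows and columns are counted from 0, so that \<open>l i\<close> is the part with number \<open>i + 1\<close>, and a pair
  \<open>i < k\<close> belongs to the diagram iff \<open>k < l i\<close>. The exponent \<open>e\<close> tells the two halves apart: with
  \<open>e = 0\<close> the diagonal is dropped, with \<open>e = 1\<close> a diagonal cell counts as \<open>y\<^sub>i\<close> instead of \<open>2 y\<^sub>i\<close>.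
\<close>

definition half_product :: "nat \<Rightarrow> (nat \<Rightarrow> nat) \<Rightarrow> 'a::field list \<Rightarrow> 'a" where
  "half_product e l ys = (\<Prod>i<length ys. (if i < l i then ys ! i ^ e else 1) * (\<Prod>k\<in>{i<..<l i}. ys ! i + ys ! k))"

text \<open>
  The parts of \<open>half\<^sub><\<close> for \<open>e = 0\<close> and of \<open>half\<^sub>\<le>\<close> for \<open>e = 1\<close>.
\<close>

definition half_parts :: "nat \<Rightarrow> nat \<Rightarrow> (nat \<Rightarrow> nat) \<Rightarrow> nat list" where
  "half_parts e n l = filter (\<lambda>m. m > 0) (map (\<lambda>i. l i + e - Suc i) [0..<n])"

text \<open>
  When the first row has full length, its factors involve all remaining variables symmetrically, and
  deleting the first row and column leaves the diagram with parts \<open>\<lambda>\<^sub>i\<^sub>+\<^sub>1 - 1\<close>.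
\<close>

lemma half_product_Cons:
  assumes "l 0 = Suc (length ys)" "distinct ys"
  shows "half_product e l (y # ys) = y ^ e * (\<Prod>b\<in>set ys. y + b) * half_product e (\<lambda>i. l (Suc i) - 1) ys"
proof -
  have "(\<Prod>k\<in>{0<..<l 0}. y + (y # ys) ! k) = (\<Prod>k<length ys. y + ys ! k)"
    by (rule prod.reindex_bij_witness[of _ Suc "\<lambda>k. k - 1"]) (use assms in auto)
  also have "\<dots> = (\<Prod>b\<in>set ys. y + b)"
    using bij_betw_nth[OF assms(2) refl refl] by (rule prod.reindex_bij_betw)
  finally have 1: "(\<Prod>k\<in>{0<..<l 0}. y + (y # ys) ! k) = (\<Prod>b\<in>set ys. y + b)" .
  have 2: "(\<Prod>k\<in>{Suc i<..<l (Suc i)}. ys ! i + (y # ys) ! k) = (\<Prod>k\<in>{i<..<l (Suc i) - 1}. ys ! i + ys ! k)" for i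
    by (rule prod.reindex_bij_witness[of _ Suc "\<lambda>k. k - 1"]) auto
  show ?thesis
    unfolding half_product_def length_Cons prod.lessThan_Suc_shift nth_Cons_Suc nth_Cons_0 1 2
    using assms(1) by (simp add: less_diff_conv mult_ac)
qed

lemma half_product_snoc:
  assumes "antimono l" "l 0 \<le> length ys"
  shows "half_product e l (ys @ [c]) = half_product e l ys"
proof -
  have le: "l i \<le> length ys" for i using antimonoD[OF assms(1), of 0 i] assms(2) by simp
  have last: "{length ys<..<l (length ys)} = {}" "\<not> length ys < l (length ys)" using le[of "length ys"] by auto
  have "(\<Prod>k\<in>{i<..<l i}. (ys @ [c]) ! i + (ys @ [c]) ! k) = (\<Prod>k\<in>{i<..<l i}. ys ! i + ys ! k)" if "i < length ys" for i
    using le[of i] that by (intro prod.cong refl) (auto simp: nth_append)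
  then have "(\<Prod>i<length ys. (if i < l i then (ys @ [c]) ! i ^ e else 1) *
      (\<Prod>k\<in>{i<..<l i}. (ys @ [c]) ! i + (ys @ [c]) ! k)) = half_product e l ys"
    unfolding half_product_def by (intro prod.cong refl) (simp add: nth_append_left)
  then show ?thesis
    using last by (simp add: half_product_def)
qed

lemma half_parts_Suc_full:
  assumes "l 0 = Suc n" "e \<le> 1"
  shows "half_parts e (Suc n) l = (if n + e > 0 then [n + e] else []) @ half_parts e n (\<lambda>i. l (Suc i) - 1)"
proof -
  have "map (\<lambda>i. l i + e - Suc i) [0..<Suc n] = (n + e) # map (\<lambda>i. l (Suc i) + e - Suc (Suc i)) [0..<n]"
    using assms by (simp add: upt_conv_Cons map_Suc_upt[symmetric] del: upt_Suc)
  also have "map (\<lambda>i. l (Suc i) + e - Suc (Suc i)) [0..<n] = map (\<lambda>i. l (Suc i) - 1 + e - Suc i) [0..<n]"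
    using assms(2) by (intro map_cong refl) auto
  finally show ?thesis by (simp add: half_parts_def)
qed

lemma half_parts_Suc:
  assumes "antimono l" "l 0 \<le> n" "e \<le> 1"
  shows "half_parts e (Suc n) l = half_parts e n l"
  using antimonoD[OF assms(1), of 0 n] assms by (simp add: half_parts_def)

lemma half_parts_bound:
  assumes "antimono l" "l 0 \<le> n" "e \<le> 1" "m \<in> set (half_parts e k l)"
  shows "m \<le> n"
proof -
  obtain i where "m = l i + e - Suc i" using assms(4) by (auto simp: half_parts_def)
  then show ?thesis using antimonoD[OF assms(1), of 0 i] assms by simp
qed

lemma sorted_half_parts:
  assumes "antimono l"
  shows "sorted_wrt (>) (half_parts e n l)"
proof -
  have "sorted_wrt (\<lambda>a b. b = 0 \<or> b < a) (map (\<lambda>i. l i + e - Suc i) [0..<n])"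
    unfolding sorted_wrt_map
  proof (rule sorted_wrt_mono_rel[OF _ sorted_wrt_upt])
    fix i j :: nat assume "i < j"
    then have "l j \<le> l i" using antimonoD[OF assms, of i j] by simp
    then show "l j + e - Suc j = 0 \<or> l j + e - Suc j < l i + e - Suc i"
      using \<open>i < j\<close> by linarith
  qed
  then have "sorted_wrt (\<lambda>a b. b = 0 \<or> b < a) (half_parts e n l)"
    unfolding half_parts_def by (rule sorted_wrt_filter)
  then show ?thesis
    by (rule sorted_wrt_mono_rel[rotated]) (auto simp: half_parts_def)
qed

text \<open>
  If the first row is full, splitting off the value of \<open>x\<^sub>1\<close> matches the recursion of the P-sum;
  otherwise \<open>x\<^sub>n\<close> occurs only in the kernel, and splitting off its value leads to stability.
  In both cases the shape that remains is decreasing and fits the smaller number of variables.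
\<close>

theorem symmetrized_half_product:
  fixes S :: "'a::field_char_0 set"
  assumes "finite S" "0 \<notin> S" "antimono l" "l 0 \<le> card S" "e \<le> 1"
  shows "(\<Sum>ys\<in>permutations_of_set S. half_product e l ys * weyl_kernel ys) = schur_P_sum S (half_parts e (card S) l)"
  using assms
proof (induction "card S" arbitrary: S l)
  case 0
  then show ?case by (simp add: half_product_def half_parts_def)
next
  case (Suc n)
  have "S \<noteq> {}" using Suc.hyps(2) by auto
  have card: "card (S - {k}) = n" if "k \<in> S" for k using Suc that by simp
  have perm: "set ys = S - {k}" "distinct ys" "length ys = n" if "ys \<in> permutations_of_set (S - {k})" "k \<in> S" for k ys
    using permutations_of_setD[OF that(1)] length_finite_permutations_of_set[OF that(1)] card[OF that(2)] by simp_all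
  show ?case
  proof (cases "l 0 = Suc n")
    case True
    let ?l = "\<lambda>i. l (Suc i) - 1"
    have mono: "antimono ?l"
      by (rule antimonoI) (use antimonoD[OF Suc.prems(3)] in \<open>simp add: diff_le_mono\<close>)
    have l0: "?l 0 \<le> n" using antimonoD[OF Suc.prems(3), of 0 1] True by simp
    have "(\<Sum>ys\<in>permutations_of_set S. half_product e l ys * weyl_kernel ys) =
      (\<Sum>k\<in>S. \<Sum>ys\<in>permutations_of_set (S - {k}).
        (k ^ (n + e) * (\<Prod>b\<in>S - {k}. (k + b) / (k - b))) * (half_product e ?l ys * weyl_kernel ys))"
      unfolding sum_permutations_by_head[OF Suc.prems(1) \<open>S \<noteq> {}\<close>]
    proof (intro sum.cong refl)
      fix k ys assume k: "k \<in> S" and ys: "ys \<in> permutations_of_set (S - {k})"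
      have "(\<Prod>b\<in>S - {k}. k + b) * (\<Prod>b\<in>S - {k}. k / (k - b)) = k ^ n * (\<Prod>b\<in>S - {k}. (k + b) / (k - b))"
        using card[OF k] by (simp add: prod_dividef)
      then show "half_product e l (k # ys) * weyl_kernel (k # ys) =
          k ^ (n + e) * (\<Prod>b\<in>S - {k}. (k + b) / (k - b)) * (half_product e ?l ys * weyl_kernel ys)"
        using half_product_Cons[of l ys e k] perm[OF ys k] True
        by (simp add: power_add mult_ac)
    qed
    also have "\<dots> = (\<Sum>k\<in>S. k ^ (n + e) * (\<Prod>b\<in>S - {k}. (k + b) / (k - b)) *
        schur_P_sum (S - {k}) (half_parts e n ?l))"
      unfolding sum_distrib_left[symmetric]
    proof (intro sum.cong refl arg_cong2[where f = "(*)"])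
      fix k assume "k \<in> S"
      then show "(\<Sum>ys\<in>permutations_of_set (S - {k}). half_product e ?l ys * weyl_kernel ys) =
          schur_P_sum (S - {k}) (half_parts e n ?l)"
        using Suc.hyps(1)[of "S - {k}" ?l] Suc.prems mono l0 card by simp
    qed
    also have "\<dots> = schur_P_sum S (half_parts e (card S) l)"
    \<comment> \<open>A full first row gives no part of the half partition iff it is the single cell dropped for \<open>e = 0\<close>.\<close>
    proof (cases "n + e = 0")
      case True
      then obtain k where "S = {k}" using Suc.hyps(2) by (metis One_nat_def add_is_0 card_1_singletonE)
      then show ?thesis using True \<open>l 0 = Suc n\<close> by (simp add: half_parts_def)
    next
      case False
      then show ?thesis
        using half_parts_Suc_full[of l n e, OF True Suc.prems(5)] Suc.hyps(2) by simp
    qed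
    finally show ?thesis .
  next
    case False
    then have l0: "l 0 \<le> n" using Suc by simp
    have "(\<Sum>ys\<in>permutations_of_set S. half_product e l ys * weyl_kernel ys) =
      (\<Sum>k\<in>S. \<Sum>ys\<in>permutations_of_set (S - {k}).
        (\<Prod>b\<in>S - {k}. b / (b - k)) * (half_product e l ys * weyl_kernel ys))"
      unfolding sum_permutations_by_last[OF Suc.prems(1) \<open>S \<noteq> {}\<close>]
    proof (intro sum.cong refl)
      fix k ys assume k: "k \<in> S" and ys: "ys \<in> permutations_of_set (S - {k})"
      show "half_product e l (ys @ [k]) * weyl_kernel (ys @ [k]) =
          (\<Prod>b\<in>S - {k}. b / (b - k)) * (half_product e l ys * weyl_kernel ys)"
        using half_product_snoc[OF Suc.prems(3), of ys e k] weyl_kernel_snoc[of ys k] perm[OF ys k] l0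
        by simp
    qed
    also have "\<dots> = adjoin_sum S (\<lambda>T. schur_P_sum T (half_parts e n l))"
      unfolding sum_distrib_left[symmetric] adjoin_sum_def
    proof (intro sum.cong refl arg_cong2[where f = "(*)"])
      fix k assume "k \<in> S"
      then show "(\<Sum>ys\<in>permutations_of_set (S - {k}). half_product e l ys * weyl_kernel ys) =
          schur_P_sum (S - {k}) (half_parts e n l)"
        using Suc.hyps(1)[of "S - {k}" l] Suc.prems l0 card by simp
    qed
    also have "\<dots> = schur_P_sum S (half_parts e n l)"
    proof (rule schur_P_sum_stable[symmetric])
      show "\<forall>m\<in>set (half_parts e n l). m < card S"
        using half_parts_bound[OF Suc.prems(3) l0 Suc.prems(5)] Suc.hyps(2) by fastforce
      show "0 \<notin> set (half_parts e n l)" by (simp add: half_parts_def)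
    qed (use Suc.prems \<open>S \<noteq> {}\<close> sorted_half_parts in auto)
    also have "\<dots> = schur_P_sum S (half_parts e (card S) l)"
      using half_parts_Suc[OF Suc.prems(3) l0 Suc.prems(5)] Suc.hyps(2) by simp
    finally show ?thesis .
  qed
qed

text \<open>
  One summand of the explicit formula for \<open>P\<^sub>\<mu>\<close>; the variables beyond the number of parts occur only
  in the denominators and numerators of earlier rows.
\<close>

fun schur_P_term :: "nat list \<Rightarrow> 'a::field list \<Rightarrow> 'a" where
  "schur_P_term (m # ms) (y # ys) = y ^ m * (\<Prod>b\<in>set ys. (y + b) / (y - b)) * schur_P_term ms ys"
| "schur_P_term _ _ = 1"

text \<open>
  The summand does not change when the values left over after the last part are permuted, whence the
  factorial.
\<close>

lemma sum_schur_P_term: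
  fixes S :: "'a::field set"
  assumes "finite S" "length ms \<le> card S"
  shows "(\<Sum>ys\<in>permutations_of_set S. schur_P_term ms ys) = of_nat (fact (card S - length ms)) * schur_P_sum S ms"
  using assms
proof (induction ms arbitrary: S)
  case Nil
  then show ?case by simp
next
  case (Cons m ms)
  then have "S \<noteq> {}" by auto
  have "(\<Sum>ys\<in>permutations_of_set S. schur_P_term (m # ms) ys) =
    (\<Sum>k\<in>S. \<Sum>ys\<in>permutations_of_set (S - {k}). k ^ m * (\<Prod>b\<in>S - {k}. (k + b) / (k - b)) * schur_P_term ms ys)"
    unfolding sum_permutations_by_head[OF Cons.prems(1) \<open>S \<noteq> {}\<close>]
    by (intro sum.cong refl) (simp add: permutations_of_setD)
  also have "\<dots> = (\<Sum>k\<in>S. k ^ m * (\<Prod>b\<in>S - {k}. (k + b) / (k - b)) *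
      (of_nat (fact (card S - length (m # ms))) * schur_P_sum (S - {k}) ms))"
    unfolding sum_distrib_left[symmetric]
  proof (intro sum.cong refl arg_cong2[where f = "(*)"])
    fix k assume "k \<in> S"
    then show "(\<Sum>ys\<in>permutations_of_set (S - {k}). schur_P_term ms ys) =
        of_nat (fact (card S - length (m # ms))) * schur_P_sum (S - {k}) ms"
      using Cons.IH[of "S - {k}"] Cons.prems by simp
  qed
  also have "\<dots> = of_nat (fact (card S - length (m # ms))) * schur_P_sum S (m # ms)"
    by (simp add: sum_distrib_left mult_ac)
  finally show ?case .
qed

section \<open>Alternants and their branching rule\<close>

text \<open>
  The quotient of the alternant with the given exponents by the Vandermonde product, expanded along
  the first row. The exponents contain the shift by \<open>\<rho> = (n - 1, \<dots>, 1, 0)\<close>, so that only natural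
  numbers occur even when an exponent is lowered.
\<close>

fun alternant_sum :: "'a::field set \<Rightarrow> nat list \<Rightarrow> 'a" where
  "alternant_sum S [] = 1"
| "alternant_sum S (a # as) = (\<Sum>k\<in>S. k ^ a * (\<Prod>b\<in>S - {k}. 1 / (k - b)) * alternant_sum (S - {k}) as)"

lemma alternant_sum_equal_heads:
  fixes S :: "'a::field_char_0 set"
  assumes "finite S"
  shows "alternant_sum S (a # a # as) = 0"
proof -
  let ?h = "\<lambda>k i. k ^ a * (\<Prod>b\<in>S - {k}. 1 / (k - b)) *
    (i ^ a * (\<Prod>b\<in>S - {k} - {i}. 1 / (i - b)) * alternant_sum (S - {k} - {i}) as)"
  have "?h i k = - ?h k i" if "k \<in> S" "i \<in> S" "k \<noteq> i" for k i
  proof -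
    have S: "S - {i} - {k} = S - {k} - {i}" by auto
    have neg: "1 / (i - k) = - (1 / (k - i))"
      by (metis minus_diff_eq minus_divide_right)
    have k: "(\<Prod>b\<in>S - {k}. 1 / (k - b)) = 1 / (k - i) * (\<Prod>b\<in>S - {k} - {i}. 1 / (k - b))"
      using prod_remove_divided[OF assms, of i k "\<lambda>b. 1 / (k - b)"] that unfolding S by simp
    have i: "(\<Prod>b\<in>S - {i}. 1 / (i - b)) = - (1 / (k - i)) * (\<Prod>b\<in>S - {k} - {i}. 1 / (i - b))"
      using prod_remove_divided[OF assms, of k i "\<lambda>b. 1 / (i - b)"] that unfolding neg by simp
    show ?thesis
      unfolding k i S by (simp only: mult_minus_left mult_minus_right mult_ac)
  qed
  then have "(\<Sum>k\<in>S. \<Sum>i\<in>S - {k}. ?h k i) = 0"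
    by (rule sum_antisymmetric_eq_0[OF assms, where h = ?h])
  then show ?thesis by (simp add: sum_distrib_left)
qed

text \<open>
  Interlacing of partitions in terms of exponents shifted by \<open>\<rho>\<close>: the condition
  \<open>\<lambda>\<^sub>i\<^sub>+\<^sub>1 \<le> \<nu>\<^sub>i \<le> \<lambda>\<^sub>i\<close> turns into membership in a half-open interval.
\<close>

fun interlacing :: "nat list \<Rightarrow> nat list set" where
  "interlacing (a # a' # as) = (\<lambda>(b, bs). b # bs) ` ({a'..<a} \<times> interlacing (a' # as))"
| "interlacing _ = {[]}"

text \<open>
  The number of cells of the skew shape, again in terms of shifted exponents; the last exponent
  carries no shift and counts in full.
\<close>

fun gap_sum :: "nat list \<Rightarrow> nat list \<Rightarrow> nat" where
  "gap_sum (a # as) (b # bs) = (a - 1 - b) + gap_sum as bs"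
| "gap_sum as _ = sum_list as"

lemma sum_interlacing_Cons:
  "(\<Sum>bs\<in>interlacing (a # a' # as). f bs) = (\<Sum>b\<in>{a'..<a}. \<Sum>bs\<in>interlacing (a' # as). f (b # bs))"
  by (subst sum.cartesian_product) (auto simp: inj_on_def intro!: sum.reindex_cong)

lemma geometric_split:
  fixes k s :: "'a::field"
  assumes "a' \<le> a" "k \<noteq> s"
  shows "(k ^ a - s ^ (a - a') * k ^ a') / (k - s) = (\<Sum>b\<in>{a'..<a}. k ^ b * s ^ (a - 1 - b))"
proof -
  have "k ^ a - s ^ (a - a') * k ^ a' = k ^ a' * (k ^ (a - a') - s ^ (a - a'))"
    using assms(1) by (simp add: algebra_simps flip: power_add)
  also have "\<dots> = (k - s) * (\<Sum>i<a - a'. k ^ a' * (s ^ (a - a' - Suc i) * k ^ i))"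
    by (simp add: power_diff_sumr2 sum_distrib_left mult_ac)
  also have "(\<Sum>i<a - a'. k ^ a' * (s ^ (a - a' - Suc i) * k ^ i)) = (\<Sum>b\<in>{a'..<a}. k ^ b * s ^ (a - 1 - b))"
    by (rule sum.reindex_bij_witness[of _ "\<lambda>b. b - a'" "\<lambda>i. i + a'"])
      (auto simp: power_add mult_ac add.commute)
  finally show ?thesis using assms(2) by simp
qed

text \<open>
  Replacing the first exponent by the second gives zero, so \<open>s\<^bsup>a-a'\<^esup>\<close> times that alternant may be
  subtracted. This removes the summand for \<open>k = s\<close> and makes the factor \<open>1 / (k - s)\<close> cancel against a geometric
  sum, whose terms are the possible first exponents of the smaller alternant.
\<close>

theorem alternant_sum_branching:
  fixes S :: "'a::field_char_0 set"
  assumes "finite S" "s \<in> S" "length as = card S" "sorted_wrt (\<ge>) as"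
  shows "alternant_sum S as = (\<Sum>bs\<in>interlacing as. s ^ gap_sum as bs * alternant_sum (S - {s}) bs)"
  using assms
proof (induction as arbitrary: S rule: interlacing.induct)
  case (1 a a' as S)
  let ?T = "S - {s}"
  let ?I = "interlacing (a' # as)"
  let ?R = "\<lambda>k. (\<Prod>b\<in>S - {k}. 1 / (k - b)) * alternant_sum (S - {k}) (a' # as)"
  have le: "a' \<le> a" using 1 by simp
  have R: "?R k = (\<Sum>bs\<in>?I. 1 / (k - s) * (\<Prod>b\<in>?T - {k}. 1 / (k - b)) *
      (s ^ gap_sum (a' # as) bs * alternant_sum (?T - {k}) bs))" if k: "k \<in> ?T" for k
  proof -
    have "alternant_sum (S - {k}) (a' # as) =
        (\<Sum>bs\<in>?I. s ^ gap_sum (a' # as) bs * alternant_sum (S - {k} - {s}) bs)"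
      using 1 k by (intro "1.IH") auto
    moreover have "(\<Prod>b\<in>S - {k}. 1 / (k - b)) = 1 / (k - s) * (\<Prod>b\<in>?T - {k}. 1 / (k - b))"
      using prod_remove_divided[of S s k "\<lambda>b. 1 / (k - b)"] 1 k by auto
    moreover have "S - {k} - {s} = ?T - {k}" by auto
    ultimately show ?thesis by (simp only: sum_distrib_left)
  qed
  have "alternant_sum S (a # a' # as) = (\<Sum>k\<in>S. k ^ a * ?R k)"
    by (subst alternant_sum.simps) (simp only: mult.assoc)
  moreover have "(\<Sum>k\<in>S. k ^ a' * ?R k) = 0"
    using alternant_sum_equal_heads[OF 1(2), of a' as]
    by (subst (asm) alternant_sum.simps) (simp only: mult.assoc)
  ultimately have "alternant_sum S (a # a' # as) = (\<Sum>k\<in>S. k ^ a * ?R k) - s ^ (a - a') * (\<Sum>k\<in>S. k ^ a' * ?R k)"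
    by simp
  also have "\<dots> = (\<Sum>k\<in>S. (k ^ a - s ^ (a - a') * k ^ a') * ?R k)"
    unfolding left_diff_distrib sum_subtractf by (simp only: sum_distrib_left mult.assoc)
  also have "\<dots> = (\<Sum>k\<in>?T. (k ^ a - s ^ (a - a') * k ^ a') * ?R k)"
    using sum.remove[OF 1(2,3), of "\<lambda>k. (k ^ a - s ^ (a - a') * k ^ a') * ?R k"] le
    by (simp flip: power_add)
  also have "\<dots> = (\<Sum>k\<in>?T. \<Sum>b\<in>{a'..<a}. \<Sum>bs\<in>?I. k ^ b * s ^ (a - 1 - b) *
      ((\<Prod>b\<in>?T - {k}. 1 / (k - b)) * (s ^ gap_sum (a' # as) bs * alternant_sum (?T - {k}) bs)))"
  proof (rule sum.cong[OF refl])
    fix k assume k: "k \<in> ?T"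
    then have ks: "k \<noteq> s" by simp
    have "(k ^ a - s ^ (a - a') * k ^ a') * ?R k = (k ^ a - s ^ (a - a') * k ^ a') / (k - s) *
        (\<Sum>bs\<in>?I. (\<Prod>b\<in>?T - {k}. 1 / (k - b)) * (s ^ gap_sum (a' # as) bs * alternant_sum (?T - {k}) bs))"
      unfolding R[OF k] by (simp add: sum_distrib_left)
    then show "(k ^ a - s ^ (a - a') * k ^ a') * ?R k = (\<Sum>b\<in>{a'..<a}. \<Sum>bs\<in>?I. k ^ b * s ^ (a - 1 - b) *
      ((\<Prod>b\<in>?T - {k}. 1 / (k - b)) * (s ^ gap_sum (a' # as) bs * alternant_sum (?T - {k}) bs)))"
      using k by (simp only: geometric_split[OF le ks] sum_product)
  qed
  also have "\<dots> = (\<Sum>b\<in>{a'..<a}. \<Sum>bs\<in>?I. \<Sum>k\<in>?T. k ^ b * s ^ (a - 1 - b) *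
      ((\<Prod>b\<in>?T - {k}. 1 / (k - b)) * (s ^ gap_sum (a' # as) bs * alternant_sum (?T - {k}) bs)))"
    by (subst sum.swap, rule sum.cong[OF refl], rule sum.swap)
  also have "\<dots> = (\<Sum>b\<in>{a'..<a}. \<Sum>bs\<in>?I. s ^ gap_sum (a # a' # as) (b # bs) * alternant_sum ?T (b # bs))"
    by (intro sum.cong refl) (simp only: gap_sum.simps alternant_sum.simps sum_distrib_left power_add mult_ac)
  also have "\<dots> = (\<Sum>bs\<in>interlacing (a # a' # as). s ^ gap_sum (a # a' # as) bs * alternant_sum ?T bs)"
    by (simp only: sum_interlacing_Cons)
  finally show ?case .
next
  case "2_1"
  then show ?case by auto
next
  case ("2_2" a)
  then have "S = {s}" by (metis One_nat_def card_1_singletonE length_Cons list.size(3) singletonD)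
  then show ?case by simp
qed

lemma symmetrized_monomial:
  fixes S :: "'a::field set"
  assumes "finite S"
  shows "(\<Sum>ys\<in>permutations_of_set S. (\<Prod>i<length ys. ys ! i ^ l i) * weyl_kernel ys) =
    alternant_sum S (map (\<lambda>i. l i + (card S - Suc i)) [0..<card S])"
  using assms
proof (induction "card S" arbitrary: S l)
  case 0
  then show ?case by simp
next
  case (Suc n)
  have "S \<noteq> {}" using Suc.hyps(2) by auto
  have card: "card (S - {k}) = n" if "k \<in> S" for k using Suc that by simp
  have e: "map (\<lambda>i. l i + (card S - Suc i)) [0..<card S] =
      (l 0 + n) # map (\<lambda>i. l (Suc i) + (n - Suc i)) [0..<n]"
    unfolding Suc.hyps(2)[symmetric]
    by (simp add: upt_conv_Cons map_Suc_upt[symmetric] del: upt_Suc)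
  have "(\<Sum>ys\<in>permutations_of_set S. (\<Prod>i<length ys. ys ! i ^ l i) * weyl_kernel ys) =
    (\<Sum>k\<in>S. \<Sum>ys\<in>permutations_of_set (S - {k}). k ^ (l 0 + n) * (\<Prod>b\<in>S - {k}. 1 / (k - b)) *
      ((\<Prod>i<length ys. ys ! i ^ l (Suc i)) * weyl_kernel ys))"
    unfolding sum_permutations_by_head[OF Suc.prems \<open>S \<noteq> {}\<close>]
  proof (intro sum.cong refl)
    fix k ys assume k: "k \<in> S" and ys: "ys \<in> permutations_of_set (S - {k})"
    have "(\<Prod>b\<in>S - {k}. k / (k - b)) = k ^ n * (\<Prod>b\<in>S - {k}. 1 / (k - b))"
      using card[OF k] by (simp add: prod_dividef)
    then show "(\<Prod>i<length (k # ys). (k # ys) ! i ^ l i) * weyl_kernel (k # ys) =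
        k ^ (l 0 + n) * (\<Prod>b\<in>S - {k}. 1 / (k - b)) * ((\<Prod>i<length ys. ys ! i ^ l (Suc i)) * weyl_kernel ys)"
      using permutations_of_setD(1)[OF ys]
      by (simp add: prod.lessThan_Suc_shift power_add mult_ac del: prod.lessThan_Suc)
  qed
  also have "\<dots> = (\<Sum>k\<in>S. k ^ (l 0 + n) * (\<Prod>b\<in>S - {k}. 1 / (k - b)) *
      alternant_sum (S - {k}) (map (\<lambda>i. l (Suc i) + (n - Suc i)) [0..<n]))"
    unfolding sum_distrib_left[symmetric]
  proof (intro sum.cong refl arg_cong2[where f = "(*)"])
    fix k assume k: "k \<in> S"
    show "(\<Sum>ys\<in>permutations_of_set (S - {k}). (\<Prod>i<length ys. ys ! i ^ l (Suc i)) * weyl_kernel ys) =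
        alternant_sum (S - {k}) (map (\<lambda>i. l (Suc i) + (n - Suc i)) [0..<n])"
      using Suc.hyps(1)[of "S - {k}" "\<lambda>i. l (Suc i)"] Suc.prems unfolding card[OF k] by simp
  qed
  finally show ?case unfolding e by simp
qed

section \<open>Evaluation of polynomials and isobaric divided differences\<close>

text \<open>
  Antisymmetric sums vanish only if 2 can be cancelled.
\<close>

instance fract :: ("{idom, ring_char_0}") field_char_0
proof
  show "inj (of_nat :: nat \<Rightarrow> 'a fract)"
    by (rule injI) (simp add: of_nat_fract eq_fract)
qed

abbreviation monom_value :: "(nat \<Rightarrow> 'a::comm_ring_1) \<Rightarrow> (nat \<Rightarrow>\<^sub>0 nat) \<Rightarrow> 'a" where
  "monom_value v m \<equiv> (\<Prod>i\<in>Poly_Mapping.keys m. v i ^ Poly_Mapping.lookup m i)"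

text \<open>
  Permuting the variables of a polynomial amounts to permuting the point at which it is evaluated, so at the
  level of values permutations act by composition also on rational functions.
\<close>

definition eval_mpoly :: "(nat \<Rightarrow> 'a::comm_ring_1) \<Rightarrow> mpoly \<Rightarrow> 'a" where
  "eval_mpoly v f = (\<Sum>m\<in>Poly_Mapping.keys f. of_int (Poly_Mapping.lookup f m) * monom_value v m)"

lemma monom_value_superset:
  assumes "finite A" "Poly_Mapping.keys m \<subseteq> A"
  shows "monom_value v m = (\<Prod>i\<in>A. v i ^ Poly_Mapping.lookup m i)"
  using assms by (intro prod.mono_neutral_left) (auto simp: in_keys_iff)

lemma monom_value_add: "monom_value v (m + m') = monom_value v m * monom_value v m'"
proof -
  let ?A = "Poly_Mapping.keys m \<union> Poly_Mapping.keys m'"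
  have "Poly_Mapping.keys (m + m') \<subseteq> ?A" by (rule keys_add)
  then show ?thesis
    by (subst (1 2 3) monom_value_superset[of ?A]) (auto simp: lookup_add power_add prod.distrib)
qed

lemma eval_mpoly_superset:
  assumes "finite A" "Poly_Mapping.keys f \<subseteq> A"
  shows "eval_mpoly v f = (\<Sum>m\<in>A. of_int (Poly_Mapping.lookup f m) * monom_value v m)"
  unfolding eval_mpoly_def using assms by (intro sum.mono_neutral_left) (auto simp: in_keys_iff)

lemma eval_mpoly_add: "eval_mpoly v (f + g) = eval_mpoly v f + eval_mpoly v g"
proof -
  let ?A = "Poly_Mapping.keys f \<union> Poly_Mapping.keys g"
  have "Poly_Mapping.keys (f + g) \<subseteq> ?A" by (rule keys_add)
  then show ?thesis
    by (simp add: eval_mpoly_superset[of ?A] lookup_add distrib_right sum.distrib)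
qed

lemma eval_mpoly_0 [simp]: "eval_mpoly v 0 = 0"
  by (simp add: eval_mpoly_def)

lemma eval_mpoly_sum: "eval_mpoly v (\<Sum>a\<in>A. f a) = (\<Sum>a\<in>A. eval_mpoly v (f a))"
  by (induction A rule: infinite_finite_induct) (simp_all add: eval_mpoly_add)

lemma eval_mpoly_single: "eval_mpoly v (Poly_Mapping.single m c) = of_int c * monom_value v m"
  by (cases "c = 0") (simp_all add: eval_mpoly_def)

lemma sum_single_keys: "(\<Sum>m\<in>Poly_Mapping.keys f. Poly_Mapping.single m (Poly_Mapping.lookup f m)) = f"
  by (rule poly_mapping_eqI) (simp add: lookup_sum lookup_single when_def in_keys_iff)

lemma eval_mpoly_mult: "eval_mpoly v (f * g) = eval_mpoly v f * eval_mpoly v g"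
proof -
  have "f * g = (\<Sum>m\<in>Poly_Mapping.keys f. \<Sum>m'\<in>Poly_Mapping.keys g.
      Poly_Mapping.single (m + m') (Poly_Mapping.lookup f m * Poly_Mapping.lookup g m'))"
    by (subst sum_single_keys[of f, symmetric], subst sum_single_keys[of g, symmetric])
      (simp add: sum_product mult_single)
  then show ?thesis
    by (simp add: eval_mpoly_sum eval_mpoly_single monom_value_add)
      (simp add: eval_mpoly_def sum_product mult_ac)
qed

lemma eval_mpoly_1 [simp]: "eval_mpoly v 1 = 1"
  using eval_mpoly_single[of v 0 1] by simp

lemma eval_mpoly_of_int [simp]: "eval_mpoly v (of_int c) = of_int c"
  using eval_mpoly_single[of v 0 c] by (simp flip: single_of_int)

lemma eval_mpoly_uminus: "eval_mpoly v (- f) = - eval_mpoly v f"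
  using eval_mpoly_add[of v f "- f"] by (simp add: eq_neg_iff_add_eq_0 add.commute)

lemma eval_mpoly_diff: "eval_mpoly v (f - g) = eval_mpoly v f - eval_mpoly v g"
  using eval_mpoly_add[of v f "- g"] by (simp add: eval_mpoly_uminus)

lemma eval_mpoly_X [simp]: "eval_mpoly v (X i) = v i"
  unfolding X_def by (simp add: eval_mpoly_single)

lemma eval_mpoly_power: "eval_mpoly v (f ^ k) = eval_mpoly v f ^ k"
  by (induction k) (simp_all add: eval_mpoly_mult)

lemma eval_mpoly_prod: "eval_mpoly v (\<Prod>a\<in>A. f a) = (\<Prod>a\<in>A. eval_mpoly v (f a))"
  by (induction A rule: infinite_finite_induct) (simp_all add: eval_mpoly_mult)

lemmas eval_mpoly_simps =
  eval_mpoly_add eval_mpoly_diff eval_mpoly_mult eval_mpoly_power eval_mpoly_prod eval_mpoly_sum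

lemma X_power: "X i ^ k = Poly_Mapping.single (Poly_Mapping.single i k) 1"
  by (induction k) (simp_all add: X_def mult_single single_add[symmetric])

lemma eval_mpoly_at_X: "eval_mpoly X f = f"
proof -
  have prod: "(\<Prod>i\<in>A. Poly_Mapping.single (g i) 1) = (Poly_Mapping.single (\<Sum>i\<in>A. g i) 1 :: mpoly)"
    if "finite A" for A and g :: "nat \<Rightarrow> nat \<Rightarrow>\<^sub>0 nat"
    using that by (induction A) (simp_all add: mult_single)
  have "of_int c * monom_value X m = Poly_Mapping.single m c" for c m
    by (simp add: X_power prod sum_single_keys single_of_int[symmetric] mult_single del: single_of_int)
  then show ?thesis
    unfolding eval_mpoly_def by (simp add: sum_single_keys)
qed

text \<open>
  Evaluation at the variables themselves is the identity and writes every polynomial in terms of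
  constants and variables.
\<close>

lemma mpoly_induct [case_names const var add mult]:
  assumes "\<And>c. P (of_int c)" "\<And>i. P (X i)"
    and "\<And>f g. P f \<Longrightarrow> P g \<Longrightarrow> P (f + g)" and "\<And>f g. P f \<Longrightarrow> P g \<Longrightarrow> P (f * g)"
  shows "P f"
proof -
  have 1: "P 1" using assms(1)[of 1] by simp
  have 0: "P 0" using assms(1)[of 0] by simp
  have pow: "P (f ^ k)" if "P f" for f k
    using that by (induction k) (auto intro: assms 1)
  have prod: "P (\<Prod>i\<in>A. g i)" if "\<And>i. P (g i)" for A and g :: "nat \<Rightarrow> mpoly"
    using that by (induction A rule: infinite_finite_induct) (auto intro: assms 1)
  have sum: "P (\<Sum>i\<in>A. g i)" if "\<And>i. P (g i)" for A and g :: "(nat \<Rightarrow>\<^sub>0 nat) \<Rightarrow> mpoly"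
    using that by (induction A rule: infinite_finite_induct) (auto intro: assms 0)
  have "P (eval_mpoly X f)"
    unfolding eval_mpoly_def by (intro sum prod pow assms)
  then show ?thesis by (simp only: eval_mpoly_at_X)
qed

text \<open>
  The embedding into the fraction field is evaluation at the generic point.
\<close>

lemma Fract_eq_eval: "Fract f 1 = eval_mpoly (\<lambda>i. Fract (X i) 1) f"
proof (induction f rule: mpoly_induct)
  case (const c)
  have "Fract (of_int c) 1 = (of_int c :: mpoly fract)"
  proof (cases c rule: int_diff_cases)
    case (diff m n)
    then show ?thesis
      using diff_fract[of 1 1 "of_nat m :: mpoly" "of_nat n"] by (simp add: Fract_of_nat_eq)
  qed
  then show ?case by simp
next
  case (add f g)
  then show ?case by (simp add: eval_mpoly_add flip: add.IH)
next
  case (mult f g)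
  then show ?case by (simp add: eval_mpoly_mult flip: mult.IH)
qed simp

lemma X_inject [simp]: "X i = X j \<longleftrightarrow> i = j"
proof
  assume "X i = X j"
  then have "eval_mpoly (\<lambda>k. int k) (X i) = eval_mpoly (\<lambda>k. int k) (X j)" by simp
  then show "i = j" by simp
qed simp

lemma inj_generic_point: "inj (\<lambda>i. Fract (X i) 1)"
  by (rule injI) (simp add: eq_fract)

text \<open>
  The generic point is injective and determines the polynomial; injectivity is all that is needed to
  divide by differences of variables.
\<close>

lemma mpoly_eqI:
  assumes "\<And>v :: nat \<Rightarrow> mpoly fract. inj v \<Longrightarrow> eval_mpoly v f = eval_mpoly v g"
  shows "f = g"
  using assms[OF inj_generic_point] unfolding Fract_eq_eval[symmetric] by (simp add: eq_fract)

lemma inj_map_key: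
  assumes "bij w"
  shows "inj (Poly_Mapping.map_key w :: (nat \<Rightarrow>\<^sub>0 nat) \<Rightarrow> _)"
proof (rule injI)
  fix p q :: "nat \<Rightarrow>\<^sub>0 nat"
  assume eq: "Poly_Mapping.map_key w p = Poly_Mapping.map_key w q"
  show "p = q"
  proof (rule poly_mapping_eqI)
    fix k
    have "Poly_Mapping.lookup p (w (inv w k)) = Poly_Mapping.lookup q (w (inv w k))"
      using eq bij_is_inj[OF assms] by (metis map_key.rep_eq comp_apply)
    then show "Poly_Mapping.lookup p k = Poly_Mapping.lookup q k"
      using assms by (simp add: bij_is_surj surj_f_inv_f)
  qed
qed

lemma eval_mpoly_permute:
  assumes "bij w"
  shows "eval_mpoly v (permute w f) = eval_mpoly (v \<circ> w) f"
proof -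
  note inj = bij_is_inj[OF assms] and inj_key = inj_map_key[OF assms]
  have add: "permute w (f + g) = permute w f + permute w g" for f g
    unfolding permute_def by (rule map_key_plus[OF inj_key])
  have "permute w (0 :: mpoly) = 0"
    unfolding permute_def by (rule map_key_zero[OF inj_key])
  then have sum: "permute w (\<Sum>a\<in>A. g a) = (\<Sum>a\<in>A. permute w (g a))" for A and g :: "(nat \<Rightarrow>\<^sub>0 nat) \<Rightarrow> mpoly"
    by (induction A rule: infinite_finite_induct) (simp_all add: add)
  have single: "eval_mpoly v (permute w (Poly_Mapping.single m c)) =
      eval_mpoly (v \<circ> w) (Poly_Mapping.single m c)" for m c
  proof -
    define k where "k = Poly_Mapping.map_key (inv w) m"
    have inj': "inj (inv w)" using assms by (simp add: bij_imp_bij_inv bij_is_inj)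
    have m: "m = Poly_Mapping.map_key w k"
      unfolding k_def using inj inj' assms
      by (intro poly_mapping_eqI) (simp add: map_key.rep_eq)
    have keys: "Poly_Mapping.keys k = w ` Poly_Mapping.keys m"
      unfolding m using inj assms by (auto simp: keys_map_key bij_is_surj)
    have "permute w (Poly_Mapping.single m c) = Poly_Mapping.single k c"
      unfolding permute_def m by (rule map_key_single[OF inj_key])
    moreover have "monom_value v k = monom_value (v \<circ> w) m"
      unfolding keys using inj by (subst prod.reindex) (auto simp: inj_on_def m map_key.rep_eq)
    ultimately show ?thesis by (simp add: eval_mpoly_single)
  qed
  show ?thesis
    by (subst (1 2) sum_single_keys[of f, symmetric]) (simp add: sum eval_mpoly_sum single)
qed

lemma permute_mult: "bij w \<Longrightarrow> permute w (f * g) = permute w f * permute w g"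
  by (rule mpoly_eqI) (simp add: eval_mpoly_permute eval_mpoly_mult)

lemma permute_add: "bij w \<Longrightarrow> permute w (f + g) = permute w f + permute w g"
  by (rule mpoly_eqI) (simp add: eval_mpoly_permute eval_mpoly_add)

lemma permute_of_int: "bij w \<Longrightarrow> permute w (of_int c) = of_int c"
  by (rule mpoly_eqI) (simp add: eval_mpoly_permute)

lemma permute_permute: "bij w \<Longrightarrow> bij w' \<Longrightarrow> permute w (permute w' f) = permute (w \<circ> w') f"
  by (rule mpoly_eqI) (simp add: eval_mpoly_permute bij_comp comp_assoc)

abbreviation adj_swap :: "nat \<Rightarrow> nat \<Rightarrow> nat" where
  "adj_swap i \<equiv> Transposition.transpose i (Suc i)"

abbreviation swap_invariant :: "nat \<Rightarrow> mpoly \<Rightarrow> bool" where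
  "swap_invariant i f \<equiv> permute (adj_swap i) f = f"

text \<open>
  The divisibility holds for constants and variables and is inherited by sums and products.
\<close>

lemma X_diff_dvd_diff_permute: "X i - X j dvd f - permute (Transposition.transpose i j) f"
proof (induction f rule: mpoly_induct)
  case (const c)
  show ?case by (simp add: permute_of_int)
next
  case (var k)
  have "X i - X j dvd X j - X i" by (metis dvd_minus_iff dvd_refl minus_diff_eq)
  then show ?case by (simp add: permute_X) (auto simp: Transposition.transpose_def)
next
  case (add f g)
  have "f + g - permute (Transposition.transpose i j) (f + g) =
      (f - permute (Transposition.transpose i j) f) + (g - permute (Transposition.transpose i j) g)"
    by (simp add: permute_add)
  with add show ?case by (metis dvd_add)
next
  case (mult f g)
  have "f * g - permute (Transposition.transpose i j) (f * g) =
      (f - permute (Transposition.transpose i j) f) * g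
      + permute (Transposition.transpose i j) f * (g - permute (Transposition.transpose i j) g)"
    by (simp add: permute_mult algebra_simps)
  with mult show ?case by (metis dvd_add dvd_mult dvd_mult2)
qed

text \<open>
  The numerator is \<open>(x\<^sub>i - x\<^sub>i\<^sub>+\<^sub>1) f + x\<^sub>i\<^sub>+\<^sub>1 (f - s\<^sub>i f)\<close>, hence divisible, and quotients are unique in an
  integral domain.
\<close>

lemma pi_op_eq: "(X i - X (Suc i)) * pi_op i f = X i * f - X (Suc i) * permute (adj_swap i) f"
proof -
  have "X i * f - X (Suc i) * permute (adj_swap i) f =
      (X i - X (Suc i)) * f + X (Suc i) * (f - permute (adj_swap i) f)"
    by (simp add: algebra_simps)
  then have "X i - X (Suc i) dvd X i * f - X (Suc i) * permute (adj_swap i) f"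
    using X_diff_dvd_diff_permute[of i "Suc i" f] by (metis dvd_add dvd_mult dvd_triv_left)
  then obtain g where g: "(X i - X (Suc i)) * g = X i * f - X (Suc i) * permute (adj_swap i) f"
    by (metis dvd_def)
  show ?thesis
    unfolding pi_op_def
  proof (rule theI[of _ g])
    fix h assume "(X i - X (Suc i)) * h = X i * f - X (Suc i) * permute (adj_swap i) f"
    then have "(X i - X (Suc i)) * h = (X i - X (Suc i)) * g" using g by simp
    then show "h = g" by simp
  qed (rule g)
qed

lemma eval_mpoly_pi_op:
  fixes v :: "nat \<Rightarrow> 'a::field"
  assumes "inj v"
  shows "eval_mpoly v (pi_op i f) =
    (v i * eval_mpoly v f - v (Suc i) * eval_mpoly (v \<circ> adj_swap i) f) / (v i - v (Suc i))"
proof -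
  have "v i - v (Suc i) \<noteq> 0" using assms by (simp add: inj_eq)
  moreover have "(v i - v (Suc i)) * eval_mpoly v (pi_op i f) =
      v i * eval_mpoly v f - v (Suc i) * eval_mpoly (v \<circ> adj_swap i) f"
    using arg_cong[OF pi_op_eq[of i f], of "eval_mpoly v"]
    by (simp add: eval_mpoly_simps eval_mpoly_permute)
  ultimately show ?thesis by (simp add: field_simps)
qed

lemma inj_comp_adj_swap: "inj v \<Longrightarrow> inj (v \<circ> adj_swap i)"
  by (simp add: inj_compose bij_is_inj)

lemma pi_op_swap_invariant: "swap_invariant i (pi_op i f)"
proof (rule mpoly_eqI)
  fix v :: "nat \<Rightarrow> mpoly fract" assume v: "inj v"
  have "v i - v (Suc i) \<noteq> 0" "v (Suc i) - v i \<noteq> 0" using v by (simp_all add: inj_eq)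
  then show "eval_mpoly v (permute (adj_swap i) (pi_op i f)) = eval_mpoly v (pi_op i f)"
    by (simp add: eval_mpoly_permute eval_mpoly_pi_op[OF v] eval_mpoly_pi_op[OF inj_comp_adj_swap[OF v]]
        comp_assoc divide_simps) (simp add: algebra_simps)
qed

lemma pi_op_of_swap_invariant: "swap_invariant i f \<Longrightarrow> pi_op i f = f"
proof (rule mpoly_eqI)
  fix v :: "nat \<Rightarrow> mpoly fract" assume v: "inj v" and f: "swap_invariant i f"
  have "v i - v (Suc i) \<noteq> 0" using v by (simp add: inj_eq)
  moreover have "eval_mpoly (v \<circ> adj_swap i) f = eval_mpoly v f"
    using f by (metis eval_mpoly_permute bij_swap_iff bij_id transpose_comp_involutory bij_transpose)
  ultimately show "eval_mpoly v (pi_op i f) = eval_mpoly v f"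
    by (simp add: eval_mpoly_pi_op[OF v] flip: left_diff_distrib)
qed

lemma pi_op_commute:
  assumes "Suc i < j"
  shows "pi_op i (pi_op j f) = pi_op j (pi_op i f)"
proof (rule mpoly_eqI)
  fix v :: "nat \<Rightarrow> mpoly fract" assume v: "inj v"
  have nz: "v i - v (Suc i) \<noteq> 0" "v j - v (Suc j) \<noteq> 0" using v by (simp_all add: inj_eq)
  have comm: "v \<circ> adj_swap i \<circ> adj_swap j = v \<circ> adj_swap j \<circ> adj_swap i"
    using assms by (auto simp: fun_eq_iff Transposition.transpose_def)
  have val: "(v \<circ> adj_swap i) j = v j" "(v \<circ> adj_swap i) (Suc j) = v (Suc j)"
    "(v \<circ> adj_swap j) i = v i" "(v \<circ> adj_swap j) (Suc i) = v (Suc i)"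
    using assms by (simp_all add: Transposition.transpose_def)
  note inj = inj_comp_adj_swap[OF v]
  show "eval_mpoly v (pi_op i (pi_op j f)) = eval_mpoly v (pi_op j (pi_op i f))"
    unfolding eval_mpoly_pi_op[OF v] eval_mpoly_pi_op[OF inj] val comm
    using nz by (simp add: divide_simps) (simp add: algebra_simps)
qed

text \<open>
  Expanding both sides at a point gives the same combination of the values of \<open>f\<close> at the six
  rearrangements of three coordinates.
\<close>

lemma pi_op_braid: "pi_op i (pi_op (Suc i) (pi_op i f)) = pi_op (Suc i) (pi_op i (pi_op (Suc i) f))"
proof (rule mpoly_eqI)
  fix v :: "nat \<Rightarrow> mpoly fract" assume v: "inj v"
  let ?s = "adj_swap i" and ?t = "adj_swap (Suc i)"
  define a b c where "a = v i" and "b = v (Suc i)" and "c = v (Suc (Suc i))"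
  have nz: "a - b \<noteq> 0" "a - c \<noteq> 0" "b - c \<noteq> 0" "b - a \<noteq> 0" "c - a \<noteq> 0" "c - b \<noteq> 0"
    using v by (simp_all add: inj_eq a_def b_def c_def)
  have val: "v i = a" "v (Suc i) = b" "v (Suc (Suc i)) = c"
    "(v \<circ> ?s) i = b" "(v \<circ> ?s) (Suc i) = a" "(v \<circ> ?s) (Suc (Suc i)) = c"
    "(v \<circ> ?t) i = a" "(v \<circ> ?t) (Suc i) = c" "(v \<circ> ?t) (Suc (Suc i)) = b"
    "(v \<circ> ?s \<circ> ?t) i = b" "(v \<circ> ?s \<circ> ?t) (Suc i) = c" "(v \<circ> ?s \<circ> ?t) (Suc (Suc i)) = a"
    "(v \<circ> ?t \<circ> ?s) i = c" "(v \<circ> ?t \<circ> ?s) (Suc i) = a" "(v \<circ> ?t \<circ> ?s) (Suc (Suc i)) = b"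
    by (simp_all add: a_def b_def c_def Transposition.transpose_def)
  have ss: "v \<circ> ?s \<circ> ?s = v" "v \<circ> ?t \<circ> ?t = v" by (simp_all add: comp_assoc)
  have tst: "v \<circ> ?t \<circ> ?s \<circ> ?t = v \<circ> ?s \<circ> ?t \<circ> ?s"
    by (auto simp: fun_eq_iff Transposition.transpose_def)
  note inj1 = inj_comp_adj_swap[OF v] note inj2 = inj_comp_adj_swap[OF inj1]
  show "eval_mpoly v (pi_op i (pi_op (Suc i) (pi_op i f))) =
      eval_mpoly v (pi_op (Suc i) (pi_op i (pi_op (Suc i) f)))"
    unfolding eval_mpoly_pi_op[OF v] eval_mpoly_pi_op[OF inj1] eval_mpoly_pi_op[OF inj2] val ss tst
    using nz by (simp add: divide_simps) (simp add: algebra_simps)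
qed

lemma swap_invariant_pi_op_commute:
  assumes "Suc i < j \<or> Suc j < i" "swap_invariant j f"
  shows "swap_invariant j (pi_op i f)"
  using assms pi_op_commute pi_op_of_swap_invariant pi_op_swap_invariant by metis

section \<open>Compositions and inversions\<close>

text \<open>
  For a partition these are the parts of the conjugate, with \<open>c\<close> counted from 0 because the infinitely
  many zero entries have to be left out. They are unchanged by rearranging and determine a partition.
\<close>

definition level_count :: "(nat \<Rightarrow> nat) \<Rightarrow> nat \<Rightarrow> nat" where
  "level_count \<alpha> c = card {i. Suc c \<le> \<alpha> i}"

lemma weak_comp_finite: "weak_comp \<alpha> \<Longrightarrow> finite {i. Suc c \<le> \<alpha> i}"
  unfolding weak_comp_def by (auto elim!: rev_finite_subset)

lemma partition_antimono:
  assumes "is_partition \<mu>" "1 \<le> i" "i \<le> j"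
  shows "\<mu> j \<le> \<mu> i"
  using assms(3)
proof (induction j rule: dec_induct)
  case (step k)
  then have "\<mu> (Suc k) \<le> \<mu> k" using assms(1,2) by (simp add: is_partition_def)
  with step.IH show ?case by simp
qed simp

text \<open>
  The entries reaching a positive level form an initial segment.
\<close>

lemma partition_ge_iff:
  assumes "is_partition \<mu>"
  shows "Suc c \<le> \<mu> i \<longleftrightarrow> 1 \<le> i \<and> i \<le> level_count \<mu> c"
proof -
  let ?A = "{i. Suc c \<le> \<mu> i}"
  have wc: "weak_comp \<mu>" using assms by (simp add: is_partition_def)
  have pos: "1 \<le> i" if "i \<in> ?A" for i
    using that wc by (cases i) (auto simp: weak_comp_def)
  have down: "{1..i} \<subseteq> ?A" if "i \<in> ?A" for i
    using partition_antimono[OF assms] that by (auto intro: order_trans)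
  have fin: "finite ?A" using wc by (rule weak_comp_finite)
  have "?A = {1..card ?A}"
  proof (cases "?A = {}")
    case False
    have "?A = {1..Max ?A}"
      using down[OF Max_in[OF fin False]] Max_ge[OF fin] pos by auto
    then show ?thesis by (metis card_atLeastAtMost diff_Suc_1)
  qed (simp only: card.empty, simp)
  then show ?thesis unfolding level_count_def by (metis atLeastAtMost_iff mem_Collect_eq)
qed

lemma partition_eqI:
  assumes "is_partition \<mu>" "is_partition \<nu>" "level_count \<mu> = level_count \<nu>"
  shows "\<mu> = \<nu>"
proof
  fix i
  have "Suc c \<le> \<mu> i \<longleftrightarrow> Suc c \<le> \<nu> i" for c
    unfolding partition_ge_iff[OF assms(1)] partition_ge_iff[OF assms(2)] assms(3) ..
  then show "\<mu> i = \<nu> i" by (metis Suc_le_eq linorder_neqE_nat less_irrefl)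
qed

lemma level_count_bij: "bij w \<Longrightarrow> level_count (\<alpha> \<circ> w) = level_count \<alpha>"
  unfolding level_count_def
  by (rule ext, rule bij_betw_same_card[of w]) (auto simp: bij_betw_def inj_on_def bij_def image_iff surj_def)

lemma weak_comp_swap:
  assumes "weak_comp \<alpha>" "1 \<le> i"
  shows "weak_comp (\<alpha> \<circ> adj_swap i)"
proof -
  have "{j. (\<alpha> \<circ> adj_swap i) j \<noteq> 0} = adj_swap i ` {j. \<alpha> j \<noteq> 0}"
    by (auto simp: image_iff) (metis transpose_involutory)
  then show ?thesis using assms by (auto simp: weak_comp_def Transposition.transpose_def)
qed

definition inversions :: "(nat \<Rightarrow> nat) \<Rightarrow> (nat \<times> nat) set" where
  "inversions \<alpha> = {(i, j). 1 \<le> i \<and> i < j \<and> \<alpha> i < \<alpha> j}"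

lemma finite_inversions:
  assumes "weak_comp \<alpha>"
  shows "finite (inversions \<alpha>)"
proof (rule finite_subset)
  let ?A = "{j. \<alpha> j \<noteq> 0}"
  show "inversions \<alpha> \<subseteq> (SIGMA j:?A. {..<j})\<inverse>" unfolding inversions_def by auto
  show "finite ((SIGMA j:?A. {..<j})\<inverse>)" using assms by (simp add: weak_comp_def)
qed

text \<open>
  Exchanging positions \<open>i\<close> and \<open>i + 1\<close> preserves the order of every other pair of positions, so the
  inversions correspond, except for the new one at \<open>(i, i + 1)\<close>.
\<close>

lemma card_inversions_descent:
  assumes "weak_comp \<alpha>" "1 \<le> i" "\<alpha> (Suc i) < \<alpha> i"
  shows "card (inversions (\<alpha> \<circ> adj_swap i)) = Suc (card (inversions \<alpha>))"
proof -
  let ?s = "adj_swap i"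
  let ?m = "map_prod ?s ?s"
  have less: "?s p < ?s q" if "p < q" "(p, q) \<noteq> (i, Suc i)" for p q
    using that by (auto simp: Transposition.transpose_def)
  have pos: "1 \<le> ?s p" if "1 \<le> p" for p
    using that assms(2) by (auto simp: Transposition.transpose_def)
  have "inversions (\<alpha> \<circ> ?s) = insert (i, Suc i) (?m ` inversions \<alpha>)"
  proof (rule set_eqI, clarify)
    fix p q
    have "(p, q) \<in> ?m ` inversions \<alpha> \<longleftrightarrow> (?s p, ?s q) \<in> inversions \<alpha>"
    proof
      assume "(p, q) \<in> ?m ` inversions \<alpha>"
      then obtain a b where "(a, b) \<in> inversions \<alpha>" "p = ?s a" "q = ?s b" by auto
      then show "(?s p, ?s q) \<in> inversions \<alpha>" by simp
    next
      assume "(?s p, ?s q) \<in> inversions \<alpha>"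
      then have "?m (?s p, ?s q) \<in> ?m ` inversions \<alpha>" by (rule imageI)
      then show "(p, q) \<in> ?m ` inversions \<alpha>" by simp
    qed
    also have "\<dots> \<longleftrightarrow> (p, q) \<in> inversions (\<alpha> \<circ> ?s) \<and> (p, q) \<noteq> (i, Suc i)"
    proof
      assume "(?s p, ?s q) \<in> inversions \<alpha>"
      then have *: "1 \<le> ?s p" "?s p < ?s q" "\<alpha> (?s p) < \<alpha> (?s q)" by (auto simp: inversions_def)
      then have "(?s p, ?s q) \<noteq> (i, Suc i)" using assms(3) by auto
      then have "p < q" using less[of "?s p" "?s q"] * by simp
      then show "(p, q) \<in> inversions (\<alpha> \<circ> ?s) \<and> (p, q) \<noteq> (i, Suc i)"
        using * pos[of "?s p"] assms(3) by (auto simp: inversions_def)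
    next
      assume "(p, q) \<in> inversions (\<alpha> \<circ> ?s) \<and> (p, q) \<noteq> (i, Suc i)"
      then show "(?s p, ?s q) \<in> inversions \<alpha>"
        using less[of p q] pos[of p] by (auto simp: inversions_def)
    qed
    finally show "(p, q) \<in> inversions (\<alpha> \<circ> ?s) \<longleftrightarrow> (p, q) \<in> insert (i, Suc i) (?m ` inversions \<alpha>)"
      using assms by (auto simp: inversions_def)
  qed
  moreover have "(i, Suc i) \<notin> ?m ` inversions \<alpha>"
    using assms(3) by (auto simp: inversions_def Transposition.transpose_def split: if_splits)
  moreover have "card (?m ` inversions \<alpha>) = card (inversions \<alpha>)"
    by (rule card_image, rule inj_on_subset[OF prod.inj_map]) (simp_all add: bij_is_inj)
  ultimately show ?thesis using finite_inversions[OF assms(1)] by simp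
qed

lemma swap_swap [simp]: "\<alpha> \<circ> adj_swap i \<circ> adj_swap i = \<alpha>"
  by (simp add: comp_assoc)

lemma card_inversions_ascent:
  assumes "weak_comp \<alpha>" "1 \<le> i" "\<alpha> i < \<alpha> (Suc i)"
  shows "card (inversions \<alpha>) = Suc (card (inversions (\<alpha> \<circ> adj_swap i)))"
  using card_inversions_descent[OF weak_comp_swap[OF assms(1,2)] assms(2)] assms(3) by simp

lemma inversions_partition:
  assumes "is_partition \<mu>"
  shows "inversions \<mu> = {}"
proof -
  have "\<not> \<mu> i < \<mu> j" if "1 \<le> i" "i < j" for i j
    using partition_antimono[OF assms that(1), of j] that(2) by simp
  then show ?thesis by (auto simp: inversions_def)
qed

lemma not_partition_ascent:
  assumes "weak_comp \<alpha>" "\<not> is_partition \<alpha>"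
  obtains i where "1 \<le> i" "\<alpha> i < \<alpha> (Suc i)"
  using assms by (auto simp: is_partition_def not_le)

section \<open>Words and minimal permutations\<close>

lemma word_perm_Cons: "word_perm (i # is) = adj_swap i \<circ> word_perm is"
  by (simp add: word_perm_def)

lemma bij_word_perm: "bij (word_perm is)"
proof (induction "is")
  case Nil
  show ?case using bij_id by (simp add: word_perm_def id_def)
next
  case (Cons i "is")
  then show ?case unfolding word_perm_Cons by (rule bij_comp) simp
qed

lemma comp_act_Cons: "comp_act (word_perm (i # is)) \<mu> = comp_act (word_perm is) \<mu> \<circ> adj_swap i"
proof -
  have "inv (adj_swap i \<circ> word_perm is) = inv (word_perm is) \<circ> adj_swap i"
    using o_inv_distrib[OF bij_transpose bij_word_perm, of i "Suc i" "is"] by simp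
  then show ?thesis unfolding comp_act_def word_perm_Cons by auto
qed

lemma comp_act_Nil: "comp_act (word_perm []) \<mu> = \<mu>"
  by (simp add: comp_act_def word_perm_def)

lemma level_count_comp_act: "bij w \<Longrightarrow> level_count (comp_act w \<mu>) = level_count \<mu>"
  using level_count_bij[of "inv w" \<mu>] by (simp add: comp_act_def comp_def bij_imp_bij_inv)

lemma S_inf_bij: "w \<in> S_inf \<Longrightarrow> bij w"
  by (auto simp: S_inf_def bij_word_perm)

text \<open>
  Bubble sort: each step at an ascent removes one inversion.
\<close>

lemma sorting_word:
  assumes "weak_comp \<alpha>"
  shows "\<exists>is \<mu>. set is \<subseteq> {1..} \<and> length is = card (inversions \<alpha>) \<and> is_partition \<mu> \<and>
    \<alpha> = comp_act (word_perm is) \<mu>"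
  using assms
proof (induction "card (inversions \<alpha>)" arbitrary: \<alpha> rule: less_induct)
  case less
  show ?case
  proof (cases "is_partition \<alpha>")
    case True
    then show ?thesis
      by (intro exI[of _ "[]"] exI[of _ \<alpha>]) (simp add: comp_act_Nil inversions_partition)
  next
    case False
    with less.prems obtain i where i: "1 \<le> i" "\<alpha> i < \<alpha> (Suc i)" by (rule not_partition_ascent)
    note card = card_inversions_ascent[OF less.prems i]
    obtain "is" \<mu> where "set is \<subseteq> {1..}" "length is = card (inversions (\<alpha> \<circ> adj_swap i))"
      "is_partition \<mu>" "\<alpha> \<circ> adj_swap i = comp_act (word_perm is) \<mu>"
      using less.hyps[OF _ weak_comp_swap[OF less.prems i(1)]] card by auto
    moreover from this(4) have "\<alpha> = comp_act (word_perm (i # is)) \<mu>"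
      unfolding comp_act_Cons by (metis swap_swap)
    ultimately show ?thesis
      using i card by (intro exI[of _ "i # is"] exI[of _ \<mu>]) simp
  qed
qed

lemma sort_comp_eq:
  assumes "weak_comp \<alpha>" "is_partition \<mu>" "level_count \<alpha> = level_count \<mu>"
  shows "sort_comp \<alpha> = \<mu>"
proof -
  have u: "\<nu> = \<mu>" if "is_partition \<nu>" "w \<in> S_inf" "\<alpha> = comp_act w \<nu>" for \<nu> w
    using partition_eqI[OF that(1) assms(2)] level_count_comp_act[OF S_inf_bij[OF that(2)], of \<nu>] that(3) assms(3) by simp
  obtain "is" \<nu> where *: "set is \<subseteq> {1..}" "is_partition \<nu>" "\<alpha> = comp_act (word_perm is) \<nu>"
    using sorting_word[OF assms(1)] by blast
  have w: "word_perm is \<in> S_inf" using *(1) unfolding S_inf_def by blast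
  show ?thesis
    unfolding sort_comp_def
  proof (rule the_equality)
    show "is_partition \<mu> \<and> (\<exists>w\<in>S_inf. \<alpha> = comp_act w \<mu>)"
      using assms(2) w *(3) unfolding u[OF *(2) w *(3)] by blast
  qed (use u in blast)
qed

lemma perm_length_le: "set is \<subseteq> {1..} \<Longrightarrow> perm_length (word_perm is) \<le> length is"
  unfolding perm_length_def by (rule Least_le) blast

lemma reduced_word_exists:
  assumes "w \<in> S_inf"
  shows "\<exists>is. reduced_word is w"
proof -
  let ?Q = "\<lambda>l. \<exists>is. set is \<subseteq> {1..} \<and> word_perm is = w \<and> length is = l"
  have "\<exists>l. ?Q l" using assms unfolding S_inf_def by blast
  then have "?Q (perm_length w)" unfolding perm_length_def by (rule LeastI_ex)
  then show ?thesis unfolding reduced_word_def by blast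
qed

text \<open>
  The sorting word bounds the length of the minimal permutation by the number of inversions. The
  converse bound, in \<open>demazure_chain_of_word\<close>, holds because a letter adds at most one inversion.
\<close>

lemma min_perm_reduced_word:
  assumes "weak_comp \<alpha>"
  obtains "is" where "pi_perm (min_perm \<alpha>) = foldr pi_op is" "set is \<subseteq> {1..}"
    "\<alpha> = comp_act (word_perm is) (sort_comp \<alpha>)" "length is \<le> card (inversions \<alpha>)"
proof -
  obtain js \<mu> where js: "set js \<subseteq> {1..}" "length js = card (inversions \<alpha>)" "is_partition \<mu>"
    "\<alpha> = comp_act (word_perm js) \<mu>" using sorting_word[OF assms] by blast
  have \<mu>: "sort_comp \<alpha> = \<mu>"
    using js(4) level_count_comp_act[OF bij_word_perm, of js \<mu>] by (intro sort_comp_eq[OF assms js(3)]) simp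
  let ?P = "\<lambda>u. u \<in> S_inf \<and> \<alpha> = comp_act u (sort_comp \<alpha>)"
  have P: "?P (word_perm js)" using js(1,4) unfolding \<mu> S_inf_def by blast
  have "?P (min_perm \<alpha>) \<and> (\<forall>u. ?P u \<longrightarrow> perm_length (min_perm \<alpha>) \<le> perm_length u)"
    unfolding min_perm_def by (rule arg_min_nat_lemma[of ?P, OF P])
  then have min: "min_perm \<alpha> \<in> S_inf" "comp_act (min_perm \<alpha>) (sort_comp \<alpha>) = \<alpha>"
    and le: "perm_length (min_perm \<alpha>) \<le> perm_length (word_perm js)"
    using P by simp_all
  define ks where "ks = (SOME is. reduced_word is (min_perm \<alpha>))"
  have "reduced_word ks (min_perm \<alpha>)"
    unfolding ks_def using reduced_word_exists[OF min(1)] by (rule someI_ex)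
  then have ks: "set ks \<subseteq> {1..}" "word_perm ks = min_perm \<alpha>" "length ks = perm_length (min_perm \<alpha>)"
    unfolding reduced_word_def by simp_all
  show ?thesis
  proof (rule that)
    show "pi_perm (min_perm \<alpha>) = foldr pi_op ks"
      by (rule ext) (simp only: pi_perm_def ks_def)
    show "\<alpha> = comp_act (word_perm ks) (sort_comp \<alpha>)" using ks(2) min(2) by simp
    show "length ks \<le> card (inversions \<alpha>)"
      using le perm_length_le[OF js(1)] js(2) ks(3) by simp
  qed (rule ks(1))
qed

section \<open>Uniqueness of Demazure chains\<close>

text \<open>
  The relation links a rearrangement of \<open>\<mu>\<close> to the polynomials obtained from \<open>F\<close> along paths on which
  every letter creates an inversion. Working with rearrangements instead of permutations
  makes the condition for lengthening a word visible as \<open>\<alpha>\<^sub>i\<^sub>+\<^sub>1 < \<alpha>\<^sub>i\<close> and takes care of repeated parts.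
\<close>

inductive demazure_chain :: "(nat \<Rightarrow> nat) \<Rightarrow> mpoly \<Rightarrow> (nat \<Rightarrow> nat) \<Rightarrow> mpoly \<Rightarrow> bool"
  for \<mu> :: "nat \<Rightarrow> nat" and F :: mpoly where
  base: "demazure_chain \<mu> F \<mu> F"
| step: "demazure_chain \<mu> F \<alpha> f \<Longrightarrow> 1 \<le> i \<Longrightarrow> \<alpha> (Suc i) < \<alpha> i \<Longrightarrow>
    demazure_chain \<mu> F (\<alpha> \<circ> adj_swap i) (pi_op i f)"

text \<open>
  Each letter creates at most one inversion, so a word as short as the final number of inversions
  has to create one in every step.
\<close>

lemma demazure_chain_of_word:
  assumes "is_partition \<mu>" "set is \<subseteq> {1..}"
  defines "\<alpha> \<equiv> comp_act (word_perm is) \<mu>"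
  shows "weak_comp \<alpha> \<and> card (inversions \<alpha>) \<le> length is \<and>
    (length is \<le> card (inversions \<alpha>) \<longrightarrow> demazure_chain \<mu> F \<alpha> (foldr pi_op is F))"
  using assms(2) unfolding \<alpha>_def
proof (induction "is")
  case Nil
  then show ?case using assms(1)
    by (auto simp: comp_act_Nil inversions_partition is_partition_def intro: demazure_chain.base)
next
  case (Cons i "is")
  let ?\<beta> = "comp_act (word_perm is) \<mu>"
  have wc: "weak_comp ?\<beta>" and le: "card (inversions ?\<beta>) \<le> length is" and i: "1 \<le> i"
    and chain: "length is \<le> card (inversions ?\<beta>) \<Longrightarrow> demazure_chain \<mu> F ?\<beta> (foldr pi_op is F)"
    using Cons by auto
  consider "?\<beta> (Suc i) < ?\<beta> i" | "?\<beta> i < ?\<beta> (Suc i)" | "?\<beta> i = ?\<beta> (Suc i)" by linarith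
  then show ?case
  proof cases
    case 1
    have card: "card (inversions (?\<beta> \<circ> adj_swap i)) = Suc (card (inversions ?\<beta>))"
      using wc i 1 by (rule card_inversions_descent)
    have "demazure_chain \<mu> F (?\<beta> \<circ> adj_swap i) (pi_op i (foldr pi_op is F))"
      if "length is \<le> card (inversions ?\<beta>)"
      using chain[OF that] i 1 by (rule demazure_chain.step)
    moreover have fold: "foldr pi_op (i # is) F = pi_op i (foldr pi_op is F)" by simp
    ultimately show ?thesis
      using le weak_comp_swap[OF wc i] unfolding comp_act_Cons card length_Cons Suc_le_mono fold by blast
  next
    case 2
    have "card (inversions ?\<beta>) = Suc (card (inversions (?\<beta> \<circ> adj_swap i)))"
      using wc i 2 by (rule card_inversions_ascent)
    then show ?thesis
      unfolding comp_act_Cons length_Cons using le weak_comp_swap[OF wc i] by linarith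
  next
    case 3
    then have "?\<beta> \<circ> adj_swap i = ?\<beta>" by (auto simp: fun_eq_iff Transposition.transpose_def)
    then show ?thesis using le wc by (simp add: comp_act_Cons)
  qed
qed

context
  fixes \<mu> :: "nat \<Rightarrow> nat" and F :: mpoly
  assumes \<mu>: "is_partition \<mu>"
    and F: "\<And>i. 1 \<le> i \<Longrightarrow> \<mu> i = \<mu> (Suc i) \<Longrightarrow> swap_invariant i F"
begin

abbreviation "rearranged \<alpha> \<equiv> weak_comp \<alpha> \<and> level_count \<alpha> = level_count \<mu>"
abbreviation "chain \<equiv> demazure_chain \<mu> F"

lemma rearranged_swap: "rearranged \<alpha> \<Longrightarrow> 1 \<le> i \<Longrightarrow> rearranged (\<alpha> \<circ> adj_swap i)"
  using weak_comp_swap[of \<alpha> i] level_count_bij[of "adj_swap i" \<alpha>] by simp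

lemma chain_rearranged: "chain \<alpha> f \<Longrightarrow> rearranged \<alpha>"
proof (induction rule: demazure_chain.induct)
  case base
  then show ?case using \<mu> by (simp add: is_partition_def)
next
  case (step \<alpha> f i)
  show ?case using step.IH step.hyps(2) by (rule rearranged_swap)
qed

lemma chain_step_ascent:
  assumes "chain (\<alpha> \<circ> adj_swap i) f" "1 \<le> i" "\<alpha> i < \<alpha> (Suc i)"
  shows "chain \<alpha> (pi_op i f)"
  using demazure_chain.step[OF assms(1,2)] assms(3) by simp

lemma chain_cases:
  assumes "chain \<alpha> f"
  obtains "\<alpha> = \<mu>" "f = F"
  | i g where "1 \<le> i" "\<alpha> i < \<alpha> (Suc i)" "chain (\<alpha> \<circ> adj_swap i) g" "f = pi_op i g"
  using assms by (cases rule: demazure_chain.cases) auto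

lemma chain_exists: "rearranged \<alpha> \<Longrightarrow> \<exists>f. chain \<alpha> f"
proof (induction "card (inversions \<alpha>)" arbitrary: \<alpha> rule: less_induct)
  case less
  show ?case
  proof (cases "is_partition \<alpha>")
    case True
    then have "\<alpha> = \<mu>" using partition_eqI \<mu> less.prems by blast
    then show ?thesis using demazure_chain.base by blast
  next
    case False
    then obtain i where i: "1 \<le> i" "\<alpha> i < \<alpha> (Suc i)" using less.prems not_partition_ascent by blast
    then obtain f where "chain (\<alpha> \<circ> adj_swap i) f"
      using less.hyps[OF _ rearranged_swap[OF less.prems i(1)]] card_inversions_ascent[of \<alpha> i] less.prems by auto
    then show ?thesis using chain_step_ascent i by blast
  qed
qed

lemma no_ascent: "1 \<le> i \<Longrightarrow> \<mu> (Suc i) \<le> \<mu> i"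
  using \<mu> by (simp add: is_partition_def)

text \<open>
  Two last steps \<open>i\<close> and \<open>j\<close> have a common ancestor: \<open>s\<^sub>i s\<^sub>j \<alpha>\<close> if they are far apart, and \<open>\<alpha>\<close> with three
  increasing neighbours reversed if they are adjacent. The commutation and braid relations compare the
  two paths.
\<close>

lemma chain_diamond:
  assumes "rearranged \<alpha>" "1 \<le> i" "i < j" "\<alpha> i < \<alpha> (Suc i)" "\<alpha> j < \<alpha> (Suc j)"
  shows "\<exists>g h. chain (\<alpha> \<circ> adj_swap i) g \<and> chain (\<alpha> \<circ> adj_swap j) h \<and> pi_op i g = pi_op j h"
proof (cases "j = Suc i")
  case False
  then have far: "Suc i < j" using assms(3) by simp
  have comm: "\<alpha> \<circ> adj_swap j \<circ> adj_swap i = \<alpha> \<circ> adj_swap i \<circ> adj_swap j"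
    using far by (auto simp: fun_eq_iff Transposition.transpose_def)
  have "1 \<le> j" using far by simp
  obtain f where f: "chain (\<alpha> \<circ> adj_swap i \<circ> adj_swap j) f"
    using chain_exists[OF rearranged_swap[OF rearranged_swap[OF assms(1,2)] \<open>1 \<le> j\<close>]] by blast
  have "chain (\<alpha> \<circ> adj_swap i) (pi_op j f)"
    using chain_step_ascent[OF f \<open>1 \<le> j\<close>] assms far by (simp add: Transposition.transpose_def)
  moreover have "chain (\<alpha> \<circ> adj_swap j) (pi_op i f)"
    using chain_step_ascent[OF f[folded comm] assms(2)] assms far by (simp add: Transposition.transpose_def)
  ultimately show ?thesis using pi_op_commute[OF far] by blast
next
  case True
  have j: "1 \<le> Suc i" by simp
  let ?s = "adj_swap i" and ?t = "adj_swap (Suc i)"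
  have braid: "\<alpha> \<circ> ?t \<circ> ?s \<circ> ?t = \<alpha> \<circ> ?s \<circ> ?t \<circ> ?s"
    by (auto simp: fun_eq_iff Transposition.transpose_def)
  obtain f where f: "chain (\<alpha> \<circ> ?s \<circ> ?t \<circ> ?s) f"
    using chain_exists[OF rearranged_swap[OF rearranged_swap[OF rearranged_swap[OF assms(1,2)] j] assms(2)]] by blast
  have vals: "1 \<le> i" "\<alpha> i < \<alpha> (Suc i)" "\<alpha> (Suc i) < \<alpha> (Suc (Suc i))"
    using assms True by simp_all
  have g1: "chain (\<alpha> \<circ> ?s \<circ> ?t) (pi_op i f)"
    by (rule chain_step_ascent[OF f]) (use vals in \<open>simp_all add: Transposition.transpose_def\<close>)
  have g: "chain (\<alpha> \<circ> ?s) (pi_op (Suc i) (pi_op i f))"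
    by (rule chain_step_ascent[OF g1]) (use vals in \<open>simp_all add: Transposition.transpose_def\<close>)
  have h1: "chain (\<alpha> \<circ> ?t \<circ> ?s) (pi_op (Suc i) f)"
    by (rule chain_step_ascent[OF f[folded braid]]) (use vals in \<open>simp_all add: Transposition.transpose_def\<close>)
  have h: "chain (\<alpha> \<circ> ?t) (pi_op i (pi_op (Suc i) f))"
    by (rule chain_step_ascent[OF h1]) (use vals in \<open>simp_all add: Transposition.transpose_def\<close>)
  show ?thesis unfolding True using g h pi_op_braid by blast
qed

text \<open>
  Matsumoto's argument: by induction on inversions the two predecessors may be replaced by those of
  the diamond.
\<close>

lemma chain_unique: "chain \<alpha> f \<Longrightarrow> chain \<alpha> g \<Longrightarrow> f = g"
proof (induction "card (inversions \<alpha>)" arbitrary: \<alpha> f g rule: less_induct)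
  case less
  have re: "rearranged \<alpha>" using less.prems(1) by (rule chain_rearranged)
  from less.prems(1) show ?case
  proof (cases rule: chain_cases)
    case 1
    note base = 1
    from less.prems(2) show ?thesis
    proof (cases rule: chain_cases)
      case (2 i g')
      then show ?thesis using no_ascent[of i] base(1) by simp
    qed (simp add: base)
  next
    case (2 i f')
    note i = 2
    from less.prems(2) show ?thesis
    proof (cases rule: chain_cases)
      case 1
      then show ?thesis using no_ascent[of i] i by simp
    next
      case (2 j g')
      have smaller: "card (inversions (\<alpha> \<circ> adj_swap k)) < card (inversions \<alpha>)"
        if "1 \<le> k" "\<alpha> k < \<alpha> (Suc k)" for k
        using card_inversions_ascent[of \<alpha> k] re that by simp
      have "\<exists>a b. chain (\<alpha> \<circ> adj_swap i) a \<and> chain (\<alpha> \<circ> adj_swap j) b \<and> pi_op i a = pi_op j b"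
      proof (cases i j rule: linorder_cases)
        case less
        then show ?thesis using chain_diamond[OF re i(1) less i(2) 2(2)] by blast
      next
        case equal
        then show ?thesis using i by blast
      next
        case greater
        obtain a b where "chain (\<alpha> \<circ> adj_swap j) a" "chain (\<alpha> \<circ> adj_swap i) b" "pi_op j a = pi_op i b"
          using chain_diamond[OF re 2(1) greater 2(2) i(2)] by blast
        then show ?thesis by (intro exI[of _ b] exI[of _ a] conjI) simp_all
      qed
      then obtain a b where ab: "chain (\<alpha> \<circ> adj_swap i) a" "chain (\<alpha> \<circ> adj_swap j) b" "pi_op i a = pi_op j b"
        by blast
      have "f' = a" by (rule less.hyps[OF smaller[OF i(1,2)] i(3) ab(1)])
      moreover have "g' = b" by (rule less.hyps[OF smaller[OF 2(1,2)] 2(3) ab(2)])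
      ultimately show ?thesis using ab(3) i(4) 2(4) by simp
    qed
  qed
qed

text \<open>
  The invariance of the seed propagates: \<open>s\<^sub>i\<close> commutes with a distant last letter \<open>j\<close>, and for an adjacent
  one the equal entries sat at \<open>j, j + 1\<close> two steps earlier, so that the braid relation brings \<open>\<pi>\<^sub>i\<close> to the
  front.
\<close>

lemma chain_equal_parts:
  "chain \<alpha> f \<Longrightarrow> 1 \<le> i \<Longrightarrow> \<alpha> i = \<alpha> (Suc i) \<Longrightarrow> swap_invariant i f"
proof (induction "card (inversions \<alpha>)" arbitrary: \<alpha> f i rule: less_induct)
  case less
  have re: "rearranged \<alpha>" using less.prems(1) by (rule chain_rearranged)
  from less.prems(1) show ?case
  proof (cases rule: chain_cases)
    case 1
    then show ?thesis using F less.prems by simp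
  next
    case (2 j h)
    let ?s = "adj_swap i" and ?t = "adj_swap j"
    have re': "rearranged (\<alpha> \<circ> ?t)" using re 2(1) by (rule rearranged_swap)
    have less1: "card (inversions (\<alpha> \<circ> ?t)) < card (inversions \<alpha>)"
      using card_inversions_ascent[of \<alpha> j] re 2 by simp
    have "i \<noteq> j" using 2 less.prems by auto
    show ?thesis
    proof (cases "j = Suc i \<or> i = Suc j")
      case False
      then have far: "Suc i < j \<or> Suc j < i" using \<open>i \<noteq> j\<close> by auto
      then have "swap_invariant i h"
      proof (intro less.hyps[OF less1 2(3) less.prems(2)])
        show "(\<alpha> \<circ> ?t) i = (\<alpha> \<circ> ?t) (Suc i)"
          using far less.prems(3) by (auto simp: Transposition.transpose_def)
      qed
      moreover have "Suc j < i \<or> Suc i < j" using far by blast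
      ultimately show ?thesis
        unfolding 2(4) by (intro swap_invariant_pi_op_commute)
    next
      case True
      have asc: "(\<alpha> \<circ> ?t) i < (\<alpha> \<circ> ?t) (Suc i)"
        using True
      proof (elim disjE)
        assume j: "j = Suc i"
        show ?thesis using 2(2) less.prems(3) unfolding j by (simp add: Transposition.transpose_def)
      next
        assume i: "i = Suc j"
        show ?thesis using 2(2) less.prems(3) unfolding i by (simp add: Transposition.transpose_def)
      qed
      obtain h' where h': "chain (\<alpha> \<circ> ?t \<circ> ?s) h'"
        using chain_exists[OF rearranged_swap[OF re' less.prems(2)]] by blast
      have h: "h = pi_op i h'"
        using chain_unique[OF 2(3) chain_step_ascent[OF h' less.prems(2) asc]] .
      have "card (inversions (\<alpha> \<circ> ?t \<circ> ?s)) < card (inversions \<alpha>)"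
        using card_inversions_ascent[of "\<alpha> \<circ> ?t" i] re' asc less.prems less1 by simp
      moreover have "(\<alpha> \<circ> ?t \<circ> ?s) j = (\<alpha> \<circ> ?t \<circ> ?s) (Suc j)"
        using True
      proof (elim disjE)
        assume j: "j = Suc i"
        show ?thesis using less.prems(3) unfolding j by (simp add: Transposition.transpose_def)
      next
        assume i: "i = Suc j"
        show ?thesis using less.prems(3) unfolding i by (simp add: Transposition.transpose_def)
      qed
      ultimately have "swap_invariant j h'"
        by (rule less.hyps[OF _ h' 2(1)])
      then have "f = pi_op j (pi_op i (pi_op j h'))"
        unfolding 2(4) h using pi_op_of_swap_invariant[of j h'] by simp
      also have "\<dots> = pi_op i (pi_op j (pi_op i h'))"
        using True by (elim disjE) (simp_all add: pi_op_braid)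
      finally show ?thesis by (simp only: pi_op_swap_invariant)
    qed
  qed
qed

lemma chain_weak_ascent:
  assumes "chain \<alpha> f" "1 \<le> i" "\<alpha> i \<le> \<alpha> (Suc i)"
  shows "swap_invariant i f"
proof (cases "\<alpha> i = \<alpha> (Suc i)")
  case True
  then show ?thesis using chain_equal_parts assms by blast
next
  case False
  then have asc: "\<alpha> i < \<alpha> (Suc i)" using assms(3) by simp
  obtain g where "chain (\<alpha> \<circ> adj_swap i) g"
    using chain_exists[OF rearranged_swap[OF chain_rearranged[OF assms(1)] assms(2)]] by blast
  then have "f = pi_op i g"
    by (intro chain_unique[OF assms(1)] chain_step_ascent[OF _ assms(2) asc])
  then show ?thesis by (simp only: pi_op_swap_invariant)
qed

end

section \<open>Symmetrization over the symmetric group\<close>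

text \<open>
  The operator of the longest permutation in \<open>S\<^sub>n\<close>, as a function of the point.
\<close>

definition symmetrize :: "nat \<Rightarrow> (nat \<Rightarrow> 'a::field) \<Rightarrow> mpoly \<Rightarrow> 'a" where
  "symmetrize n v f =
    (\<Sum>w | w permutes {1..n}. eval_mpoly (v \<circ> w) f * weyl_kernel (map (v \<circ> w) [1..<Suc n]))"

text \<open>
  Passing from permutations of indices to orderings of the set of values, where the identities of the
  preceding sections apply.
\<close>

lemma sum_permutes_as_lists:
  assumes "inj v"
  shows "(\<Sum>w | w permutes {1..n}. g (map (v \<circ> w) [1..<Suc n])) =
    (\<Sum>ys\<in>permutations_of_set (v ` {1..n}). g ys)"
proof (rule sum.reindex_bij_betw)
  let ?h = "\<lambda>w. map (v \<circ> w) [1..<Suc n]" and ?A = "{w. w permutes {1..n}}"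
  have inj: "inj_on ?h ?A"
  proof (rule inj_onI)
    fix w w' assume w: "w \<in> ?A" "w' \<in> ?A" and eq: "?h w = ?h w'"
    show "w = w'"
    proof
      fix i
      show "w i = w' i"
      proof (cases "i \<in> {1..n}")
        case True
        then have "v (w i) = v (w' i)" using eq unfolding map_eq_conv by auto
        then show ?thesis using assms by (simp add: inj_eq)
      next
        case False
        then show ?thesis using w by (simp add: permutes_not_in)
      qed
    qed
  qed
  have sub: "?h ` ?A \<subseteq> permutations_of_set (v ` {1..n})"
  proof (rule image_subsetI)
    fix w assume "w \<in> ?A"
    then have w: "w permutes {1..n}" by simp
    have "set [1..<Suc n] = {1..n}" by auto
    then have "set (?h w) = v ` {1..n}"
      using permutes_image[OF w] by (metis image_comp list.set_map)
    moreover have "inj (v \<circ> w)" using assms permutes_inj[OF w] by (rule inj_compose)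
    then have "distinct (?h w)" by (simp add: distinct_map inj_on_subset[OF _ subset_UNIV] del: upt_Suc)
    ultimately show "?h w \<in> permutations_of_set (v ` {1..n})" by (rule permutations_of_setI)
  qed
  have "card (?h ` ?A) = fact n"
    using card_image[OF inj] card_permutations[of "{1..n}" n] by simp
  also have "\<dots> = card (permutations_of_set (v ` {1..n}))"
    using assms by (simp add: card_image inj_on_subset[OF _ subset_UNIV])
  finally have "?h ` ?A = permutations_of_set (v ` {1..n})"
    by (intro card_subset_eq sub) simp_all
  then show "bij_betw ?h ?A (permutations_of_set (v ` {1..n}))"
    using inj by (simp add: bij_betw_def)
qed

lemma symmetrize_as_lists:
  assumes "inj v" "\<And>u. eval_mpoly (v \<circ> u) f = g (map (v \<circ> u) [1..<Suc n])"
  shows "symmetrize n v f = (\<Sum>ys\<in>permutations_of_set (v ` {1..n}). g ys * weyl_kernel ys)"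
  unfolding symmetrize_def assms(2) by (rule sum_permutes_as_lists[OF assms(1)])

lemma weyl_kernel_swap:
  assumes "distinct (xs @ a # b # ys)"
  shows "\<exists>K. weyl_kernel (xs @ a # b # ys) = a / (a - b) * K \<and> weyl_kernel (xs @ b # a # ys) = b / (b - a) * K"
  using assms
proof (induction xs)
  case Nil
  show ?case
    using Nil by (intro exI[of _ "(\<Prod>c\<in>set ys. a / (a - c)) * (\<Prod>c\<in>set ys. b / (b - c)) * weyl_kernel ys"])
      (simp add: mult_ac)
next
  case (Cons x xs)
  then obtain K where K: "weyl_kernel (xs @ a # b # ys) = a / (a - b) * K" "weyl_kernel (xs @ b # a # ys) = b / (b - a) * K"
    by auto
  have "set (xs @ b # a # ys) = set (xs @ a # b # ys)" by auto
  then show ?case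
    by (intro exI[of _ "(\<Prod>c\<in>set (xs @ a # b # ys). x / (x - c)) * K"])
      (simp only: append_Cons weyl_kernel.simps K mult_ac)
qed

text \<open>
  The values of \<open>f\<close> at \<open>v \<circ> w\<close> come from the summands for \<open>w\<close> and \<open>w s\<^sub>i\<close>. After reindexing, their
  coefficients add up to the kernel at \<open>w\<close>, as the kernels at \<open>w\<close> and \<open>w s\<^sub>i\<close> differ only in the factor
  of the pair \<open>(i, i + 1)\<close>.
\<close>

lemma symmetrize_pi_op:
  fixes v :: "nat \<Rightarrow> 'a::field"
  assumes "inj v" "1 \<le> i" "i < n"
  shows "symmetrize n v (pi_op i f) = symmetrize n v f"
proof -
  let ?s = "adj_swap i" and ?A = "{w. w permutes {1..n}}"
  define g where "g w = eval_mpoly (v \<circ> w) f" for w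
  define K where "K w = weyl_kernel (map (v \<circ> w) [1..<Suc n])" for w
  define a b where "a w = v (w i)" and "b w = v (w (Suc i))" for w
  have s: "?s permutes {1..n}" using assms by (intro permutes_swap_id) auto
  have swapped: "a (w \<circ> ?s) = b w" "b (w \<circ> ?s) = a w" "g (w \<circ> ?s \<circ> ?s) = g w" for w
    by (simp_all add: a_def b_def g_def comp_assoc)
  have ne: "a w - b w \<noteq> 0" if "w \<in> ?A" for w
    using that assms(1) permutes_inj[of w "{1..n}"] by (simp add: a_def b_def inj_eq)
  have kernel: "a w / (a w - b w) * K w - a w / (b w - a w) * K (w \<circ> ?s) = K w" if w: "w \<in> ?A" for w
  proof -
    have split: "[1..<Suc n] = [1..<i] @ i # Suc i # [Suc (Suc i)..<Suc n]"
    proof -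
      have "[1..<Suc n] = [1..<i] @ [i..<Suc n]" using upt_add_eq_append[of 1 i "Suc n - i"] assms by (simp del: upt_Suc)
      also have "[i..<Suc n] = i # Suc i # [Suc (Suc i)..<Suc n]"
        using assms by (simp add: upt_conv_Cons del: upt_Suc)
      finally show ?thesis .
    qed
    let ?xs = "map (v \<circ> w) [1..<i]" and ?ys = "map (v \<circ> w) [Suc (Suc i)..<Suc n]"
    have 1: "map (v \<circ> w) [1..<Suc n] = ?xs @ a w # b w # ?ys"
      unfolding split by (simp add: a_def b_def del: upt_Suc)
    have 2: "map (v \<circ> (w \<circ> ?s)) [1..<Suc n] = ?xs @ b w # a w # ?ys"
      unfolding split by (auto simp: a_def b_def Transposition.transpose_def simp del: upt_Suc)
    have "inj (v \<circ> w)" using assms(1) permutes_inj[of w "{1..n}"] w by (simp add: inj_compose)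
    then have "distinct (map (v \<circ> w) [1..<Suc n])"
      by (simp add: distinct_map inj_on_subset[OF _ subset_UNIV] del: upt_Suc)
    then have "distinct (?xs @ a w # b w # ?ys)" unfolding 1 .
    from weyl_kernel_swap[OF this] obtain k where
      k: "K w = a w / (a w - b w) * k" "K (w \<circ> ?s) = b w / (b w - a w) * k"
      unfolding K_def 1 2 by blast
    have "a w - b w \<noteq> 0" "b w - a w \<noteq> 0" using ne[OF w] by simp_all
    then show ?thesis unfolding k by (simp add: divide_simps) (simp add: algebra_simps)
  qed
  have "symmetrize n v (pi_op i f) = (\<Sum>w\<in>?A. (a w * g w - b w * g (w \<circ> ?s)) / (a w - b w) * K w)"
    unfolding symmetrize_def
  proof (intro sum.cong refl)
    fix w assume "w \<in> ?A"
    then have "inj (v \<circ> w)" using assms(1) permutes_inj[of w "{1..n}"] by (simp add: inj_compose)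
    then show "eval_mpoly (v \<circ> w) (pi_op i f) * weyl_kernel (map (v \<circ> w) [1..<Suc n]) =
        (a w * g w - b w * g (w \<circ> ?s)) / (a w - b w) * K w"
      by (simp add: eval_mpoly_pi_op a_def b_def g_def K_def comp_assoc)
  qed
  also have "\<dots> = (\<Sum>w\<in>?A. a w / (a w - b w) * K w * g w) - (\<Sum>w\<in>?A. b w / (a w - b w) * K w * g (w \<circ> ?s))"
    unfolding sum_subtractf[symmetric]
    by (intro sum.cong refl) (simp add: diff_divide_distrib algebra_simps)
  also have "(\<Sum>w\<in>?A. b w / (a w - b w) * K w * g (w \<circ> ?s)) =
      (\<Sum>w\<in>?A. a w / (b w - a w) * K (w \<circ> ?s) * g w)"
    by (subst sum_permutations_compose_right[OF s]) (simp only: swapped)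
  also have "(\<Sum>w\<in>?A. a w / (a w - b w) * K w * g w) - (\<Sum>w\<in>?A. a w / (b w - a w) * K (w \<circ> ?s) * g w) =
      (\<Sum>w\<in>?A. (a w / (a w - b w) * K w - a w / (b w - a w) * K (w \<circ> ?s)) * g w)"
    by (simp only: sum_subtractf left_diff_distrib)
  also have "\<dots> = (\<Sum>w\<in>?A. K w * g w)"
    by (intro sum.cong refl) (simp only: kernel)
  also have "\<dots> = symmetrize n v f"
    by (simp only: symmetrize_def g_def K_def mult.commute)
  finally show ?thesis .
qed

lemma permute_id: "permute id f = f"
  by (rule mpoly_eqI) (simp add: eval_mpoly_permute)

lemma adjacent_invariant_imp_symmetric:
  assumes inv: "\<And>i. 1 \<le> i \<Longrightarrow> i < n \<Longrightarrow> swap_invariant i f" and "w permutes {1..n}"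
  shows "permute w f = f"
proof -
  have transp: "permute (Transposition.transpose a b) f = f" if "1 \<le> a" "Suc a \<le> b" "b \<le> n" for a b
    using that(2,3)
  proof (induction b rule: dec_induct)
    case base
    then show ?case using inv that(1) by simp
  next
    case (step b)
    have eq: "Transposition.transpose a (Suc b) = adj_swap b \<circ> (Transposition.transpose a b \<circ> adj_swap b)"
      using step.hyps by (auto simp: fun_eq_iff Transposition.transpose_def)
    have "permute (Transposition.transpose a (Suc b)) f =
        permute (adj_swap b) (permute (Transposition.transpose a b) (permute (adj_swap b) f))"
      unfolding eq by (simp only: permute_permute bij_transpose bij_comp)
    moreover have "swap_invariant b f" using inv step that(1) by simp
    ultimately show ?case using step by simp
  qed
  show ?thesis
    using assms(2) finite_atLeastAtMost
  proof (induction rule: permutes_induct)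
    case (swap a b p)
    have "permute (Transposition.transpose a b) f = f"
      using transp[of a b] transp[of b a] swap.hyps(1-3)
      by (cases a b rule: linorder_cases) (auto simp: transpose_commute)
    moreover have "bij p" using swap.hyps by (simp add: permutes_bij)
    ultimately show ?case using swap.IH by (metis permute_permute bij_transpose)
  qed (rule permute_id)
qed

text \<open>
  A symmetric factor comes out of the sum, and the symmetrization of 1 is the empty P-sum.
\<close>

lemma symmetrize_symmetric:
  fixes v :: "nat \<Rightarrow> 'a::field_char_0"
  assumes "inj v" "\<And>i. v i \<noteq> 0" "\<And>i. 1 \<le> i \<Longrightarrow> i < n \<Longrightarrow> swap_invariant i f"
  shows "symmetrize n v f = eval_mpoly v f"
proof -
  have "symmetrize n v f = (\<Sum>w | w permutes {1..n}. eval_mpoly v f * weyl_kernel (map (v \<circ> w) [1..<Suc n]))"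
    unfolding symmetrize_def
  proof (intro sum.cong refl)
    fix w assume "w \<in> {w. w permutes {1..n}}"
    then have w: "w permutes {1..n}" by simp
    have "eval_mpoly (v \<circ> w) f = eval_mpoly v f"
      using adjacent_invariant_imp_symmetric[OF assms(3) w] eval_mpoly_permute[OF permutes_bij[OF w], of v f] by simp
    then show "eval_mpoly (v \<circ> w) f * weyl_kernel (map (v \<circ> w) [1..<Suc n]) =
        eval_mpoly v f * weyl_kernel (map (v \<circ> w) [1..<Suc n])" by simp
  qed
  also have "\<dots> = eval_mpoly v f * (\<Sum>ys\<in>permutations_of_set (v ` {1..n}). weyl_kernel ys)"
    unfolding sum_distrib_left[symmetric] by (simp only: sum_permutes_as_lists[OF assms(1)])
  also have "(\<Sum>ys\<in>permutations_of_set (v ` {1..n}). weyl_kernel ys) = 1"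
    using symmetrized_half_product[of "v ` {1..n}" "\<lambda>_. 0" 0] assms(2)
    by (auto simp: half_product_def half_parts_def antimono_def image_iff)
  finally show ?thesis by simp
qed

text \<open>
  A letter \<open>i \<ge> n\<close> cannot occur: it would move a nonzero entry beyond position \<open>n\<close>.
\<close>

lemma chain_symmetrize:
  assumes "demazure_chain \<mu> F \<alpha> f" "\<forall>j>n. \<alpha> j = 0" "inj v"
  shows "symmetrize n v f = symmetrize n v F"
  using assms(1,2)
proof (induction rule: demazure_chain.induct)
  case (step \<alpha> f i)
  have i: "i < n"
  proof (rule ccontr)
    assume "\<not> i < n"
    then have "\<alpha> i = 0" using step.prems[rule_format, of "Suc i"] by simp
    then show False using step.hyps by simp
  qed
  have "\<alpha> j = 0" if "n < j" for j
  proof -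
    have "adj_swap i j = j" using i that by (simp add: Transposition.transpose_def)
    then show ?thesis using step.prems that by (metis comp_apply)
  qed
  then show ?case using step.IH symmetrize_pi_op[OF assms(3) step.hyps(2) i] by simp
qed simp

lemma rev_comp_rearranges:
  assumes "is_partition \<mu>" "\<forall>i>n. \<mu> i = 0"
  shows "weak_comp (rev_comp n \<mu>)" "level_count (rev_comp n \<mu>) = level_count \<mu>"
proof -
  show "weak_comp (rev_comp n \<mu>)"
    unfolding weak_comp_def rev_comp_def
    by (auto intro!: finite_subset[of _ "{1..n}"] split: if_splits)
  have "bij_betw (\<lambda>i. n + 1 - i) {i. Suc c \<le> rev_comp n \<mu> i} {i. Suc c \<le> \<mu> i}" for c
  proof (rule bij_betwI[where g = "\<lambda>i. n + 1 - i"])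
    have pos: "1 \<le> i \<and> i \<le> n" if "Suc c \<le> \<mu> i" for i
      using that assms unfolding is_partition_def weak_comp_def
      by (metis One_nat_def Suc_leI not_less_eq_eq le0 linorder_not_le neq0_conv)
    show "(\<lambda>i. n + 1 - i) \<in> {i. Suc c \<le> rev_comp n \<mu> i} \<rightarrow> {i. Suc c \<le> \<mu> i}"
      by (auto simp: rev_comp_def split: if_splits)
    show "(\<lambda>i. n + 1 - i) \<in> {i. Suc c \<le> \<mu> i} \<rightarrow> {i. Suc c \<le> rev_comp n \<mu> i}"
      using pos by (fastforce simp: rev_comp_def)
    show "n + 1 - (n + 1 - i) = i" if "i \<in> {i. Suc c \<le> rev_comp n \<mu> i}" for i
      using that by (auto simp: rev_comp_def split: if_splits)
    show "n + 1 - (n + 1 - i) = i" if "i \<in> {i. Suc c \<le> \<mu> i}" for i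
      using that pos[of i] by simp
  qed
  then show "level_count (rev_comp n \<mu>) = level_count \<mu>"
    unfolding level_count_def by (intro ext bij_betw_same_card)
qed

text \<open>
  The reversed partition has no descents among the first \<open>n\<close> positions, so the polynomial at the end of
  the chain is symmetric in \<open>x\<^sub>1, \<dots>, x\<^sub>n\<close> and equals its own symmetrization, which is that of the seed.
\<close>

theorem pi_min_perm_rev_comp:
  fixes v :: "nat \<Rightarrow> 'a::field_char_0"
  assumes "is_partition \<mu>" "\<forall>i>n. \<mu> i = 0" "\<And>i. 1 \<le> i \<Longrightarrow> \<mu> i = \<mu> (Suc i) \<Longrightarrow> swap_invariant i F"
    and "inj v" "\<And>i. v i \<noteq> 0"
  shows "sort_comp (rev_comp n \<mu>) = \<mu>"
    and "eval_mpoly v (pi_perm (min_perm (rev_comp n \<mu>)) F) = symmetrize n v F"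
proof -
  let ?\<alpha> = "rev_comp n \<mu>"
  note re = rev_comp_rearranges[OF assms(1,2)]
  show sort: "sort_comp ?\<alpha> = \<mu>" by (rule sort_comp_eq[OF re(1) assms(1) re(2)])
  obtain "is" where ks: "pi_perm (min_perm ?\<alpha>) = foldr pi_op is" "set is \<subseteq> {1..}"
    "?\<alpha> = comp_act (word_perm is) \<mu>" "length is \<le> card (inversions ?\<alpha>)"
    using min_perm_reduced_word[OF re(1)] unfolding sort by blast
  have chain: "demazure_chain \<mu> F ?\<alpha> (foldr pi_op is F)"
    using demazure_chain_of_word[OF assms(1) ks(2), of F] ks(4) unfolding ks(3)[symmetric] by blast
  have sym: "swap_invariant i (foldr pi_op is F)" if "1 \<le> i" "i < n" for i
  proof (rule chain_weak_ascent[OF assms(1,3) chain that(1)])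
    have "n + 1 - i = Suc (n - i)" using that by simp
    moreover have "\<mu> (Suc (n - i)) \<le> \<mu> (n - i)"
      using assms(1) that by (simp add: is_partition_def)
    ultimately show "?\<alpha> i \<le> ?\<alpha> (Suc i)" using that by (simp add: rev_comp_def)
  qed
  have "eval_mpoly v (foldr pi_op is F) = symmetrize n v (foldr pi_op is F)"
    using symmetrize_symmetric[OF assms(4,5) sym] by simp
  also have "\<dots> = symmetrize n v F"
    by (rule chain_symmetrize[OF chain _ assms(4)]) (simp add: rev_comp_def)
  finally show "eval_mpoly v (pi_perm (min_perm ?\<alpha>) F) = symmetrize n v F"
    unfolding ks(1) .
qed

section \<open>Halves of symmetric partitions\<close>

text \<open>
  \<open>half\<^sub><\<close> for \<open>e = 0\<close> and \<open>half\<^sub>\<le>\<close> for \<open>e = 1\<close>; position 0 is excluded because \<open>e\<close> would count there.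
\<close>

definition half_partition :: "nat \<Rightarrow> (nat \<Rightarrow> nat) \<Rightarrow> nat \<Rightarrow> nat" where
  "half_partition e \<mu> i = (if i = 0 then 0 else \<mu> i + e - i)"

text \<open>
  The level counts of a strict partition can be read off from the set of its parts.
\<close>

lemma strict_with_parts_eq:
  assumes "strict_partition \<mu>" "{\<mu> i | i. \<mu> i \<noteq> 0} = A"
  shows "strict_with_parts A = \<mu>"
proof -
  have level_count: "level_count \<nu> = (\<lambda>c. card (A \<inter> {Suc c..}))"
    if "strict_partition \<nu>" "{\<nu> i | i. \<nu> i \<noteq> 0} = A" for \<nu>
  proof
    fix c
    have "A \<inter> {Suc c..} = \<nu> ` {i. Suc c \<le> \<nu> i}"
      unfolding that(2)[symmetric] by (auto simp: image_iff)
    moreover have "inj_on \<nu> {i. Suc c \<le> \<nu> i}"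
      by (rule inj_on_subset[of _ "{i. \<nu> i \<noteq> 0}"]) (use that(1) in \<open>auto simp: strict_partition_def\<close>)
    ultimately show "level_count \<nu> c = card (A \<inter> {Suc c..})"
      unfolding level_count_def by (simp add: card_image)
  qed
  show ?thesis
    unfolding strict_with_parts_def
  proof (rule the_equality)
    fix \<nu> assume \<nu>: "strict_partition \<nu> \<and> {\<nu> i |i. \<nu> i \<noteq> 0} = A"
    show "\<nu> = \<mu>"
    proof (rule partition_eqI)
      show "is_partition \<nu>" "is_partition \<mu>"
        using \<nu> assms(1) by (simp_all add: strict_partition_def)
      show "level_count \<nu> = level_count \<mu>"
        using level_count[of \<nu>] level_count[OF assms] \<nu> by simp
    qed
  qed (use assms in simp)
qed

lemma half_partition_decreasing:
  assumes "is_partition \<mu>" "1 \<le> i" "i < j" "half_partition e \<mu> j \<noteq> 0"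
  shows "half_partition e \<mu> j < half_partition e \<mu> i"
  using partition_antimono[OF assms(1,2), of j] assms(2-4) unfolding half_partition_def by simp

lemma strict_half_partition:
  assumes "is_partition \<mu>" "e \<le> 1"
  shows "strict_partition (half_partition e \<mu>)"
proof -
  have "half_partition e \<mu> i \<noteq> 0 \<Longrightarrow> \<mu> i \<noteq> 0 \<or> i \<le> 1" for i
    using assms(2) by (auto simp: half_partition_def split: if_splits)
  then have "{i. half_partition e \<mu> i \<noteq> 0} \<subseteq> {i. \<mu> i \<noteq> 0} \<union> {..1}" by auto
  then have "finite {i. half_partition e \<mu> i \<noteq> 0}"
    by (rule finite_subset) (use assms(1) in \<open>simp add: is_partition_def weak_comp_def\<close>)
  then have wc: "weak_comp (half_partition e \<mu>)"
    by (simp add: weak_comp_def half_partition_def[of e \<mu> 0])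
  have "half_partition e \<mu> (Suc i) \<le> half_partition e \<mu> i" if "1 \<le> i" for i
    using half_partition_decreasing[OF assms(1) that, of "Suc i" e] by (cases "half_partition e \<mu> (Suc i) = 0") simp_all
  then have part: "is_partition (half_partition e \<mu>)"
    using wc by (simp add: is_partition_def)
  have "inj_on (half_partition e \<mu>) {i. half_partition e \<mu> i \<noteq> 0}"
  proof (rule linorder_inj_onI')
    fix i j assume "i \<in> {i. half_partition e \<mu> i \<noteq> 0}" "j \<in> {i. half_partition e \<mu> i \<noteq> 0}" "i < j"
    moreover from this have "1 \<le> i" by (cases i) (auto simp: half_partition_def)
    ultimately show "half_partition e \<mu> i \<noteq> half_partition e \<mu> j"
      using half_partition_decreasing[OF assms(1), of i j e] by simp
  qed
  with part show ?thesis by (simp add: strict_partition_def)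
qed

lemma nonzero_values_eq:
  fixes f g :: "nat \<Rightarrow> nat"
  assumes "f 0 = 0" "\<And>i. 1 \<le> i \<Longrightarrow> f i = g i"
  shows "{f i | i. f i \<noteq> 0} = {g i | i. 1 \<le> i} \<inter> {1..}"
proof (rule set_eqI)
  fix m
  have "(\<exists>i. m = f i \<and> f i \<noteq> 0) \<longleftrightarrow> (\<exists>i. m = g i \<and> 1 \<le> i) \<and> 1 \<le> m"
  proof
    assume "\<exists>i. m = f i \<and> f i \<noteq> 0"
    then obtain i where i: "m = f i" "f i \<noteq> 0" by blast
    then have "1 \<le> i" using assms(1) by (cases i) simp_all
    moreover from this have "m = g i" using i assms(2) by simp
    ultimately show "(\<exists>i. m = g i \<and> 1 \<le> i) \<and> 1 \<le> m" using i by auto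
  next
    assume "(\<exists>i. m = g i \<and> 1 \<le> i) \<and> 1 \<le> m"
    then obtain i where "m = g i" "1 \<le> i" "1 \<le> m" by blast
    then show "\<exists>i. m = f i \<and> f i \<noteq> 0" using assms(2)[of i] by (intro exI[of _ i]) simp
  qed
  then show "m \<in> {f i | i. f i \<noteq> 0} \<longleftrightarrow> m \<in> {g i | i. 1 \<le> i} \<inter> {1..}" by simp
qed

lemma half_lt_eq:
  assumes "is_partition \<mu>"
  shows "half_lt \<mu> = half_partition 0 \<mu>"
  unfolding half_lt_def
  by (rule strict_with_parts_eq[OF strict_half_partition[OF assms] nonzero_values_eq])
    (simp_all add: half_partition_def)

lemma half_le_eq:
  assumes "is_partition \<mu>"
  shows "half_le \<mu> = half_partition 1 \<mu>"
  unfolding half_le_def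
  by (rule strict_with_parts_eq[OF strict_half_partition[OF assms] nonzero_values_eq])
    (simp_all add: half_partition_def)

section \<open>The products over half diagrams\<close>

text \<open>
  The cells above the diagonal for \<open>d = 1\<close>, and those weakly above it for \<open>d = 0\<close>.
\<close>

definition half_pairs :: "nat \<Rightarrow> (nat \<Rightarrow> nat) \<Rightarrow> (nat \<times> nat) set" where
  "half_pairs d \<mu> = {(i, k). 1 \<le> i \<and> i + d \<le> k \<and> k \<le> \<mu> i}"

definition half_poly :: "nat \<Rightarrow> (nat \<Rightarrow> nat) \<Rightarrow> mpoly" where
  "half_poly d \<mu> = (\<Prod>(i, k)\<in>half_pairs d \<mu>. X i + X k)"

lemma half_poly_1: "(\<Prod>(i, j)\<in>diagram (half_partition 0 \<mu>). X i + X (i + j)) = half_poly 1 \<mu>"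
  unfolding half_poly_def
  by (rule prod.reindex_bij_witness[of _ "\<lambda>(i, k). (i, k - i)" "\<lambda>(i, j). (i, i + j)"])
    (auto simp: diagram_def half_pairs_def half_partition_def split: if_splits)

lemma half_poly_0: "(\<Prod>(i, j)\<in>diagram (half_partition 1 \<mu>). X i + X (i + j - 1)) = half_poly 0 \<mu>"
  unfolding half_poly_def
  by (rule prod.reindex_bij_witness[of _ "\<lambda>(i, k). (i, Suc k - i)" "\<lambda>(i, j). (i, i + j - 1)"])
    (auto simp: diagram_def half_pairs_def half_partition_def split: if_splits)

lemma symmetric_partition_transpose:
  assumes "symmetric_partition \<mu>" "1 \<le> i" "1 \<le> k"
  shows "k \<le> \<mu> i \<longleftrightarrow> i \<le> \<mu> k"
proof -
  have part: "is_partition \<mu>" and conj: "conj_partition \<mu> k = \<mu> k"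
    using assms(1) by (simp_all add: symmetric_partition_def)
  obtain c where k: "k = Suc c" using assms(3) by (cases k) auto
  have "{j. 1 \<le> j \<and> k \<le> \<mu> j} = {j. Suc c \<le> \<mu> j}"
    using partition_ge_iff[OF part] k by auto
  then have "\<mu> k = level_count \<mu> c" using conj k by (simp add: conj_partition_def level_count_def)
  then show ?thesis using partition_ge_iff[OF part, of c i] assms(2) k by simp
qed

text \<open>
  If two parts agree, the symmetric diagram is stable under exchanging the two rows together with the
  two columns. This permutes the cells of the half, except that the cell \<open>(p, p + 1)\<close> would be reflected
  in the diagonal; its factor is symmetric, so it is mapped to itself instead.
\<close>

lemma half_poly_swap_invariant:
  assumes "symmetric_partition \<mu>" "d \<le> 1" "1 \<le> p" "\<mu> p = \<mu> (Suc p)"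
  shows "swap_invariant p (half_poly d \<mu>)"
proof (rule mpoly_eqI)
  fix v :: "nat \<Rightarrow> mpoly fract"
  let ?s = "adj_swap p"
  let ?f = "\<lambda>(i, k). if (i, k) = (p, Suc p) then (i, k) else (?s i, ?s k)"
  have row: "\<mu> (?s i) = \<mu> i" for i
    using assms(4) by (simp add: Transposition.transpose_def)
  have pos: "1 \<le> ?s i" if "1 \<le> i" for i
    using that assms(3) by (simp add: Transposition.transpose_def)
  have col: "?s k \<le> \<mu> i \<longleftrightarrow> k \<le> \<mu> i" if "1 \<le> i" "1 \<le> k" for i k
    using symmetric_partition_transpose[OF assms(1)] that pos row by metis
  have order: "?s i + d \<le> ?s k" if "i + d \<le> k" "(i, k) \<noteq> (p, Suc p)" for i k
    using that assms(2) by (auto simp: Transposition.transpose_def)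
  have f_f: "?f (?f q) = q" if "q \<in> half_pairs d \<mu>" for q
  proof (cases q)
    case (Pair i k)
    have "(?s i, ?s k) \<noteq> (p, Suc p)"
    proof
      assume "(?s i, ?s k) = (p, Suc p)"
      then have "?s (?s i) = Suc p" "?s (?s k) = p" by simp_all
      then show False using that unfolding Pair half_pairs_def by simp
    qed
    then show ?thesis unfolding Pair by (cases "(i, k) = (p, Suc p)") auto
  qed
  have f_in: "?f q \<in> half_pairs d \<mu>" if "q \<in> half_pairs d \<mu>" for q
  proof (cases q)
    case (Pair i k)
    have *: "1 \<le> i" "1 \<le> k" "i + d \<le> k" "k \<le> \<mu> i"
      using that unfolding Pair half_pairs_def by simp_all
    show ?thesis
    proof (cases "(i, k) = (p, Suc p)")
      case True
      then show ?thesis using that Pair by simp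
    next
      case False
      have "1 \<le> ?s i" by (rule pos[OF *(1)])
      moreover have "?s i + d \<le> ?s k" by (rule order[OF *(3) False])
      moreover have "?s k \<le> \<mu> (?s i)" unfolding row using col[OF *(1,2)] *(4) by simp
      ultimately show ?thesis using False unfolding Pair half_pairs_def by auto
    qed
  qed
  have "eval_mpoly v (permute ?s (half_poly d \<mu>)) = (\<Prod>(i, k)\<in>half_pairs d \<mu>. v (?s i) + v (?s k))"
    by (simp add: eval_mpoly_permute half_poly_def eval_mpoly_simps split_def)
  also have "\<dots> = (\<Prod>(i, k)\<in>half_pairs d \<mu>. v i + v k)"
  proof (rule prod.reindex_bij_witness[of _ ?f ?f])
    fix q assume "q \<in> half_pairs d \<mu>"
    show "(case ?f q of (i, k) \<Rightarrow> v i + v k) = (case q of (i, k) \<Rightarrow> v (?s i) + v (?s k))"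
      by (cases q) (simp add: add.commute)
  qed (fact f_f f_in)+
  also have "\<dots> = eval_mpoly v (half_poly d \<mu>)"
    by (simp add: half_poly_def eval_mpoly_simps split_def)
  finally show "eval_mpoly v (permute ?s (half_poly d \<mu>)) = eval_mpoly v (half_poly d \<mu>)" .
qed

lemma symmetric_partition_bound:
  assumes "symmetric_partition \<mu>" "\<forall>i>n. \<mu> i = 0" "1 \<le> i"
  shows "\<mu> i \<le> n"
proof (rule ccontr)
  assume "\<not> \<mu> i \<le> n"
  then have "Suc n \<le> \<mu> i" by simp
  then have "i \<le> \<mu> (Suc n)" using symmetric_partition_transpose[OF assms(1,3), of "Suc n"] by simp
  then show False using assms(2,3) by simp
qed

lemma eval_half_poly:
  fixes v :: "nat \<Rightarrow> 'a::field"
  assumes "\<forall>i>n. \<mu> i = 0"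
  shows "eval_mpoly v (half_poly d \<mu>) = (\<Prod>i<n. \<Prod>k\<in>{i + d..<\<mu> (Suc i)}. v (Suc i) + v (Suc k))"
proof -
  have le: "i \<le> n" if "1 \<le> k" "k \<le> \<mu> i" for i k
    using assms that by (metis leI not_one_le_zero order_trans)
  have "eval_mpoly v (half_poly d \<mu>) = (\<Prod>(i, k)\<in>half_pairs d \<mu>. v i + v k)"
    by (simp add: half_poly_def eval_mpoly_simps split_def)
  also have "\<dots> = (\<Prod>(i, k)\<in>(SIGMA i:{..<n}. {i + d..<\<mu> (Suc i)}). v (Suc i) + v (Suc k))"
  proof (rule prod.reindex_bij_witness[of _ "\<lambda>(i, k). (Suc i, Suc k)" "\<lambda>(i, k). (i - 1, k - 1)"])
    fix q assume "q \<in> half_pairs d \<mu>"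
    then obtain i k where q: "q = (i, k)" "1 \<le> i" "i + d \<le> k" "k \<le> \<mu> i"
      by (auto simp: half_pairs_def)
    then have "i \<le> n" using le[of k i] by simp
    then show "(case q of (i, k) \<Rightarrow> (i - 1, k - 1)) \<in> (SIGMA i:{..<n}. {i + d..<\<mu> (Suc i)})"
      using q by auto
  qed (auto simp: half_pairs_def)
  also have "\<dots> = (\<Prod>i<n. \<Prod>k\<in>{i + d..<\<mu> (Suc i)}. v (Suc i) + v (Suc k))"
    by (rule prod.Sigma[symmetric]) simp_all
  finally show ?thesis .
qed

lemma nth_map_upt_1: "i < n \<Longrightarrow> map v [1..<Suc n] ! i = v (Suc i)"
  by (simp add: nth_append del: upt_Suc)

lemma half_product_variables:
  assumes "symmetric_partition \<mu>" "\<forall>i>n. \<mu> i = 0"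
  shows "half_product e (\<lambda>i. \<mu> (Suc i)) (map v [1..<Suc n]) =
    (\<Prod>i<n. (if i < \<mu> (Suc i) then v (Suc i) ^ e else 1) * (\<Prod>k\<in>{i<..<\<mu> (Suc i)}. v (Suc i) + v (Suc k)))"
  unfolding half_product_def
proof (rule prod.cong)
  fix i assume i: "i \<in> {..<n}"
  have "(\<Prod>k\<in>{i<..<\<mu> (Suc i)}. map v [1..<Suc n] ! i + map v [1..<Suc n] ! k) =
      (\<Prod>k\<in>{i<..<\<mu> (Suc i)}. v (Suc i) + v (Suc k))"
  proof (rule prod.cong[OF refl])
    fix k assume "k \<in> {i<..<\<mu> (Suc i)}"
    then have "k < n" using symmetric_partition_bound[OF assms, of "Suc i"] by simp
    then show "map v [1..<Suc n] ! i + map v [1..<Suc n] ! k = v (Suc i) + v (Suc k)"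
      using i by (simp only: nth_map_upt_1 lessThan_iff)
  qed
  then show "(if i < \<mu> (Suc i) then map v [1..<Suc n] ! i ^ e else 1) *
      (\<Prod>k\<in>{i<..<\<mu> (Suc i)}. map v [1..<Suc n] ! i + map v [1..<Suc n] ! k) =
      (if i < \<mu> (Suc i) then v (Suc i) ^ e else 1) * (\<Prod>k\<in>{i<..<\<mu> (Suc i)}. v (Suc i) + v (Suc k))"
    using i by (simp only: nth_map_upt_1 lessThan_iff)
qed simp

section \<open>Schur P-polynomials as P-sums\<close>

lemma schur_P_term_eq:
  assumes "distinct ys" "length ms \<le> length ys"
  shows "schur_P_term ms ys = (\<Prod>i<length ms. ys ! i ^ (ms ! i) *
    (\<Prod>j\<in>{i<..<length ys}. (ys ! i + ys ! j) / (ys ! i - ys ! j)))"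
  using assms
proof (induction ms ys rule: schur_P_term.induct)
  case (1 m ms y ys)
  have "(\<Prod>j\<in>{0<..<length (y # ys)}. (y + (y # ys) ! j) / (y - (y # ys) ! j)) =
      (\<Prod>j<length ys. (y + ys ! j) / (y - ys ! j))"
    by (rule prod.reindex_bij_witness[of _ Suc "\<lambda>j. j - 1"]) auto
  also have "\<dots> = (\<Prod>b\<in>set ys. (y + b) / (y - b))"
    using 1(2) by (intro prod.reindex_bij_betw[OF bij_betw_nth]) auto
  finally have head: "(\<Prod>j\<in>{0<..<length (y # ys)}. (y + (y # ys) ! j) / (y - (y # ys) ! j)) =
      (\<Prod>b\<in>set ys. (y + b) / (y - b))" .
  have tail: "(\<Prod>j\<in>{Suc i<..<length (y # ys)}. (ys ! i + (y # ys) ! j) / (ys ! i - (y # ys) ! j)) =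
      (\<Prod>j\<in>{i<..<length ys}. (ys ! i + ys ! j) / (ys ! i - ys ! j))" for i
    by (rule prod.reindex_bij_witness[of _ Suc "\<lambda>j. j - 1"]) auto
  have "schur_P_term ms ys = (\<Prod>i<length ms. ys ! i ^ (ms ! i) *
    (\<Prod>j\<in>{i<..<length ys}. (ys ! i + ys ! j) / (ys ! i - ys ! j)))"
    using 1 by simp
  then show ?case
    unfolding length_Cons[of m] prod.lessThan_Suc_shift nth_Cons_0 nth_Cons_Suc head tail schur_P_term.simps
    by simp
qed simp_all

lemma num_parts_level_count: "num_parts \<mu> = level_count \<mu> 0"
proof -
  have "{i. \<mu> i \<noteq> 0} = {i. Suc 0 \<le> \<mu> i}" by auto
  then show ?thesis by (simp only: num_parts_def level_count_def)
qed

lemma partition_support: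
  assumes "is_partition \<mu>"
  shows "{i. \<mu> i \<noteq> 0} = {1..num_parts \<mu>}"
proof (rule set_eqI)
  fix i
  show "i \<in> {i. \<mu> i \<noteq> 0} \<longleftrightarrow> i \<in> {1..num_parts \<mu>}"
    using partition_ge_iff[OF assms, of 0 i]
    by (simp only: num_parts_level_count mem_Collect_eq atLeastAtMost_iff neq0_conv Suc_le_eq[of 0])
qed

text \<open>
  The explicit formula is a sum over \<open>S\<^sub>n\<close> of fractions in the generic point. It becomes a sum over
  orderings of the variables, and the factorial cancels.
\<close>

lemma schur_P_eqI:
  assumes "is_partition \<mu>" "num_parts \<mu> \<le> n"
    and "Fract p 1 = schur_P_sum ((\<lambda>i. Fract (X i) 1) ` {1..n}) (map \<mu> [1..<Suc (num_parts \<mu>)])"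
  shows "schur_P n \<mu> = p"
proof -
  define v where "v = (\<lambda>i. Fract (X i) 1)"
  define r where "r = num_parts \<mu>"
  define N where "N = x_pow \<mu> * (\<Prod>i\<in>{1..r}. \<Prod>j\<in>{i+1..n}. X i + X j)"
  define D where "D = (\<Prod>i\<in>{1..r}. \<Prod>j\<in>{i+1..n}. X i - X j)"
  let ?ms = "map \<mu> [1..<Suc r]"
  have inj: "inj v" unfolding v_def by (rule inj_generic_point)
  have summand: "Fract (permute w N) (permute w D) = schur_P_term ?ms (map (v \<circ> w) [1..<Suc n])"
    if w: "w permutes {1..n}" for w
  proof -
    define u where "u = v \<circ> w"
    have "inj u" using inj permutes_inj[OF w] unfolding u_def by (rule inj_compose)
    then have dist: "distinct (map u [1..<Suc n])"
      by (simp add: distinct_map inj_on_subset[OF _ subset_UNIV] del: upt_Suc)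
    have "Fract (permute w N) (permute w D) = Fract (permute w N) 1 / Fract (permute w D) 1"
      by simp
    also have "\<dots> = eval_mpoly u N / eval_mpoly u D"
      by (simp only: Fract_eq_eval[of "permute w N"] Fract_eq_eval[of "permute w D"] v_def[symmetric]
          eval_mpoly_permute[OF permutes_bij[OF w]] u_def)
    also have "\<dots> = (\<Prod>i\<in>{1..r}. u i ^ \<mu> i * (\<Prod>j\<in>{i+1..n}. (u i + u j) / (u i - u j)))"
      unfolding N_def D_def x_pow_def partition_support[OF assms(1)] r_def
      by (simp add: eval_mpoly_simps prod.distrib prod_dividef)
    also have "\<dots> = (\<Prod>i<r. u (Suc i) ^ \<mu> (Suc i) * (\<Prod>j\<in>{Suc i+1..n}. (u (Suc i) + u j) / (u (Suc i) - u j)))"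
      by (rule prod.reindex_bij_witness[of _ Suc "\<lambda>i. i - 1"]) auto
    also have "\<dots> = schur_P_term ?ms (map u [1..<Suc n])"
    proof -
      have "(\<Prod>j\<in>{Suc i+1..n}. (u (Suc i) + u j) / (u (Suc i) - u j)) =
          (\<Prod>j\<in>{i<..<n}. (map u [1..<Suc n] ! i + map u [1..<Suc n] ! j) /
            (map u [1..<Suc n] ! i - map u [1..<Suc n] ! j))" if "i < r" for i
      proof (rule prod.reindex_bij_witness[of _ Suc "\<lambda>j. j - 1"])
        fix j assume "j \<in> {Suc i+1..n}"
        then have "j - 1 < n" "Suc (j - 1) = j" "i < n" by auto
        then show "(map u [1..<Suc n] ! i + map u [1..<Suc n] ! (j - 1)) /
            (map u [1..<Suc n] ! i - map u [1..<Suc n] ! (j - 1)) = (u (Suc i) + u j) / (u (Suc i) - u j)"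
          by (simp only: nth_map_upt_1)
      qed auto
      moreover have "map u [1..<Suc n] ! i ^ (?ms ! i) = u (Suc i) ^ \<mu> (Suc i)" if "i < r" for i
        using that assms(2) nth_map_upt_1[of i n u] nth_map_upt_1[of i r \<mu>] by (simp add: r_def del: upt_Suc)
      ultimately show ?thesis
        using assms(2) unfolding schur_P_term_eq[OF dist, of ?ms]
        by (subst schur_P_term_eq[OF dist]) (simp_all add: r_def del: upt_Suc)
    qed
    finally show ?thesis unfolding u_def .
  qed
  have "(\<Sum>w | w permutes {1..n}. Fract (permute w N) (permute w D)) =
      (\<Sum>w | w permutes {1..n}. schur_P_term ?ms (map (v \<circ> w) [1..<Suc n]))"
    using summand by (intro sum.cong refl) simp
  also have "\<dots> = (\<Sum>ys\<in>permutations_of_set (v ` {1..n}). schur_P_term ?ms ys)"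
    by (rule sum_permutes_as_lists[OF inj])
  also have "\<dots> = of_nat (fact (n - r)) * schur_P_sum (v ` {1..n}) ?ms"
    using sum_schur_P_term[of "v ` {1..n}" ?ms] assms(2) inj
    by (simp add: card_image inj_on_subset[OF _ subset_UNIV] r_def del: upt_Suc)
  also have "\<dots> = of_nat (fact (n - r)) * Fract p 1"
    unfolding assms(3) v_def r_def ..
  finally have sum: "1 / of_nat (fact (n - r)) * (\<Sum>w | w permutes {1..n}. Fract (permute w N) (permute w D)) = Fract p 1"
    by simp
  have "schur_P n \<mu> = (THE q. Fract q 1 = Fract p 1)"
    using assms(2) unfolding schur_P_def Let_def r_def[symmetric] N_def[symmetric] D_def[symmetric] sum by simp
  also have "\<dots> = p" by (rule the_equality) (simp_all add: eq_fract)
  finally show ?thesis .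
qed

lemma half_parts_eq:
  assumes "is_partition (half_partition e \<mu>)" "num_parts (half_partition e \<mu>) \<le> n"
  shows "half_parts e n (\<lambda>i. \<mu> (Suc i)) = map (half_partition e \<mu>) [1..<Suc (num_parts (half_partition e \<mu>))]"
proof -
  let ?\<nu> = "half_partition e \<mu>" and ?r = "num_parts (half_partition e \<mu>)"
  have iff: "0 < ?\<nu> (Suc i) \<longleftrightarrow> i < ?r" for i
  proof -
    have "Suc i \<in> {i. ?\<nu> i \<noteq> 0} \<longleftrightarrow> Suc i \<in> {1..?r}"
      by (simp only: partition_support[OF assms(1)])
    then show ?thesis by (simp add: Suc_le_eq)
  qed
  have split: "[0..<n] = [0..<?r] @ [?r..<n]"
    using upt_add_eq_append[of 0 ?r "n - ?r"] assms(2) by simp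
  have "half_parts e n (\<lambda>i. \<mu> (Suc i)) = filter (\<lambda>m. 0 < m) (map (\<lambda>i. ?\<nu> (Suc i)) [0..<n])"
    by (simp add: half_parts_def half_partition_def)
  also have "\<dots> = map (\<lambda>i. ?\<nu> (Suc i)) (filter (\<lambda>i. i < ?r) [0..<n])"
    by (simp add: filter_map comp_def iff)
  also have "filter (\<lambda>i. i < ?r) [0..<n] = [0..<?r]"
    unfolding split by (simp add: filter_empty_conv)
  also have "map (\<lambda>i. ?\<nu> (Suc i)) [0..<?r] = map ?\<nu> [1..<Suc ?r]"
    by (simp add: map_Suc_upt[symmetric] comp_def del: upt_Suc map_Suc_upt)
  finally show ?thesis .
qed

lemma num_parts_half_le:
  assumes "\<forall>i>n. \<mu> i = 0" "e \<le> 1"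
  shows "num_parts (half_partition e \<mu>) \<le> n"
proof -
  have "{i. half_partition e \<mu> i \<noteq> 0} \<subseteq> {1..n}"
  proof
    fix i assume "i \<in> {i. half_partition e \<mu> i \<noteq> 0}"
    then have nz: "half_partition e \<mu> i \<noteq> 0" by simp
    then have "1 \<le> i" by (cases i) (simp_all add: half_partition_def)
    moreover from this have "\<mu> i \<noteq> 0" using nz assms(2) by (simp add: half_partition_def)
    then have "i \<le> n" using assms(1) by (cases "n < i") simp_all
    ultimately show "i \<in> {1..n}" by simp
  qed
  then have "card {i. half_partition e \<mu> i \<noteq> 0} \<le> card {1..n}"
    by (intro card_mono) simp_all
  then show ?thesis by (simp add: num_parts_def)
qed

section \<open>Branching of semistandard tableaux\<close>

definition tableau_sum :: "nat \<Rightarrow> (nat \<Rightarrow> nat) \<Rightarrow> (nat \<Rightarrow> 'a::field) \<Rightarrow> 'a" where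
  "tableau_sum n \<mu> v = (\<Sum>T\<in>ssyt n \<mu>. \<Prod>b\<in>diagram \<mu>. v (T b))"

lemma eval_schur_poly: "eval_mpoly v (schur_poly n \<mu>) = tableau_sum n \<mu> v"
  by (simp add: schur_poly_def tableau_sum_def eval_mpoly_simps)

definition interlacing_partitions :: "nat \<Rightarrow> (nat \<Rightarrow> nat) \<Rightarrow> (nat \<Rightarrow> nat) set" where
  "interlacing_partitions n \<mu> =
    {\<nu>. \<nu> 0 = 0 \<and> (\<forall>i>n. \<nu> i = 0) \<and> (\<forall>i. 1 \<le> i \<longrightarrow> i \<le> n \<longrightarrow> \<mu> (Suc i) \<le> \<nu> i \<and> \<nu> i \<le> \<mu> i)}"

lemma interlacing_partition:
  assumes "is_partition \<mu>" "\<nu> \<in> interlacing_partitions n \<mu>"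
  shows "is_partition \<nu>" "\<And>i. \<nu> i \<le> \<mu> i"
proof -
  have \<nu>: "\<nu> 0 = 0" "\<And>i. n < i \<Longrightarrow> \<nu> i = 0"
    "\<And>i. 1 \<le> i \<Longrightarrow> i \<le> n \<Longrightarrow> \<mu> (Suc i) \<le> \<nu> i" "\<And>i. 1 \<le> i \<Longrightarrow> i \<le> n \<Longrightarrow> \<nu> i \<le> \<mu> i"
    using assms(2) unfolding interlacing_partitions_def by simp_all
  show le: "\<nu> i \<le> \<mu> i" for i
  proof (cases "1 \<le> i \<and> i \<le> n")
    case False
    then have "i = 0 \<or> n < i" by linarith
    then show ?thesis using \<nu>(1,2) by (elim disjE) simp_all
  qed (use \<nu>(4) in simp)
  have "{i. \<nu> i \<noteq> 0} \<subseteq> {..n}"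
  proof
    fix i assume "i \<in> {i. \<nu> i \<noteq> 0}"
    then show "i \<in> {..n}" using \<nu>(2)[of i] by (cases "n < i") simp_all
  qed
  then have "finite {i. \<nu> i \<noteq> 0}" by (rule finite_subset) simp
  moreover have "\<nu> (Suc i) \<le> \<nu> i" if "1 \<le> i" for i
  proof (cases "i \<le> n")
    case True
    then show ?thesis using \<nu>(3)[OF that] le[of "Suc i"] by simp
  next
    case False
    then show ?thesis using \<nu>(2)[of "Suc i"] by simp
  qed
  ultimately show "is_partition \<nu>" using \<nu>(1) by (simp add: is_partition_def weak_comp_def)
qed

lemma finite_diagram:
  assumes "is_partition \<mu>"
  shows "finite (diagram \<mu>)"
proof -
  have "diagram \<mu> \<subseteq> (SIGMA i:{i. \<mu> i \<noteq> 0}. {..\<mu> i})" by (auto simp: diagram_def)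
  then show ?thesis
    by (rule finite_subset) (use assms in \<open>simp add: is_partition_def weak_comp_def\<close>)
qed

text \<open>
  The entries at most \<open>n\<close> of a tableau fill a diagram whose row lengths are counted here.
\<close>

definition inner_shape :: "nat \<Rightarrow> (nat \<Rightarrow> nat) \<Rightarrow> (nat \<times> nat \<Rightarrow> nat) \<Rightarrow> nat \<Rightarrow> nat" where
  "inner_shape n \<mu> T i = card {j. (i, j) \<in> diagram \<mu> \<and> T (i, j) \<le> n}"

context
  fixes n \<mu> T
  assumes \<mu>: "is_partition \<mu>" and T: "T \<in> ssyt (Suc n) \<mu>"
begin

lemma ssyt_row: "(i, j) \<in> diagram \<mu> \<Longrightarrow> (i, j') \<in> diagram \<mu> \<Longrightarrow> j \<le> j' \<Longrightarrow> T (i, j) \<le> T (i, j')"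
proof (induction j' rule: nat_induct)
  case (Suc k)
  show ?case
  proof (cases "j = Suc k")
    case False
    then have j: "j \<le> k" "1 \<le> j" using Suc.prems by (auto simp: diagram_def)
    then have k: "(i, k) \<in> diagram \<mu>" using Suc.prems by (auto simp: diagram_def)
    have "T (i, j) \<le> T (i, k)" by (rule Suc.IH[OF Suc.prems(1) k j(1)])
    also have "\<dots> \<le> T (i, Suc k)" using T k Suc.prems(2) unfolding ssyt_def by blast
    finally show ?thesis .
  qed simp
qed (simp add: diagram_def)

lemma ssyt_column: "(Suc i, j) \<in> diagram \<mu> \<Longrightarrow> (i, j) \<in> diagram \<mu> \<Longrightarrow> T (i, j) < T (Suc i, j)"
  using T unfolding ssyt_def by blast

lemma diagram_up:
  assumes "(Suc i, j) \<in> diagram \<mu>" "1 \<le> i"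
  shows "(i, j) \<in> diagram \<mu>"
proof -
  have "\<mu> (Suc i) \<le> \<mu> i" using \<mu> assms(2) by (simp add: is_partition_def)
  then show ?thesis using assms by (auto simp: diagram_def)
qed

lemma ssyt_ge_row: "(i, j) \<in> diagram \<mu> \<Longrightarrow> i \<le> T (i, j)"
proof (induction i)
  case (Suc i)
  show ?case
  proof (cases "i = 0")
    case True
    have "T (Suc i, j) \<in> {1..Suc n}" using T Suc.prems unfolding ssyt_def by blast
    then show ?thesis using True by simp
  next
    case False
    then have up: "(i, j) \<in> diagram \<mu>" using diagram_up[OF Suc.prems] by simp
    then have "T (i, j) < T (Suc i, j)" by (rule ssyt_column[OF Suc.prems])
    then show ?thesis using Suc.IH[OF up] by simp
  qed
qed simp

lemma inner_shape_iff:
  assumes "1 \<le> i" "1 \<le> j"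
  shows "j \<le> inner_shape n \<mu> T i \<longleftrightarrow> (i, j) \<in> diagram \<mu> \<and> T (i, j) \<le> n"
proof -
  let ?A = "{j. (i, j) \<in> diagram \<mu> \<and> T (i, j) \<le> n}"
  have fin: "finite ?A" by (rule finite_subset[of _ "{..\<mu> i}"]) (auto simp: diagram_def)
  have "{1..k} \<subseteq> ?A" if "k \<in> ?A" for k
  proof
    fix l assume l: "l \<in> {1..k}"
    then have "(i, l) \<in> diagram \<mu>" using that by (auto simp: diagram_def)
    moreover from this have "T (i, l) \<le> T (i, k)" using that l by (intro ssyt_row) auto
    ultimately show "l \<in> ?A" using that by simp
  qed
  moreover have "?A \<subseteq> {1..Max ?A}" using fin by (auto simp: diagram_def)
  ultimately have "?A = {1..card ?A}"
  proof (cases "?A = {}")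
    case False
    assume sub: "\<And>k. k \<in> ?A \<Longrightarrow> {1..k} \<subseteq> ?A" and up: "?A \<subseteq> {1..Max ?A}"
    have eq: "?A = {1..Max ?A}" using sub[OF Max_in[OF fin False]] up by (rule equalityI[rotated])
    have card: "card ?A = Max ?A"
      using arg_cong[OF eq, of card] unfolding card_atLeastAtMost by linarith
    show ?thesis unfolding card by (rule eq)
  qed (simp only: card.empty, simp)
  then have "j \<in> ?A \<longleftrightarrow> j \<in> {1..card ?A}" by (rule arg_cong)
  then show ?thesis using assms(2) by (simp add: inner_shape_def)
qed

text \<open>
  Column strictness forces the entries of row \<open>i\<close> above a cell of row \<open>i + 1\<close> to be at most \<open>n\<close>, and
  those of row \<open>i\<close> to be at least \<open>i\<close>.
\<close>

lemma inner_shape_interlacing: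
  assumes "\<forall>i>Suc n. \<mu> i = 0"
  shows "inner_shape n \<mu> T \<in> interlacing_partitions n \<mu>"
proof -
  have "inner_shape n \<mu> T 0 = 0" by (simp add: inner_shape_def diagram_def)
  moreover have "inner_shape n \<mu> T i = 0" if "n < i" for i
  proof (rule ccontr)
    assume "inner_shape n \<mu> T i \<noteq> 0"
    then have "(i, 1) \<in> diagram \<mu> \<and> T (i, 1) \<le> n"
      using inner_shape_iff[of i 1] that by simp
    then show False using ssyt_ge_row[of i 1] that by simp
  qed
  moreover have "\<mu> (Suc i) \<le> inner_shape n \<mu> T i" if i: "1 \<le> i" for i
  proof (cases "\<mu> (Suc i) = 0")
    case False
    then have d: "(Suc i, \<mu> (Suc i)) \<in> diagram \<mu>" by (simp add: diagram_def)
    then have up: "(i, \<mu> (Suc i)) \<in> diagram \<mu>" by (rule diagram_up[OF _ i])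
    have "T (i, \<mu> (Suc i)) < T (Suc i, \<mu> (Suc i))" by (rule ssyt_column[OF d up])
    moreover have "T (Suc i, \<mu> (Suc i)) \<in> {1..Suc n}" using T d unfolding ssyt_def by blast
    ultimately have "T (i, \<mu> (Suc i)) \<le> n" by simp
    then show ?thesis using inner_shape_iff[OF i, of "\<mu> (Suc i)"] up False by simp
  qed simp
  moreover have "inner_shape n \<mu> T i \<le> \<mu> i" if i: "1 \<le> i" for i
  proof (cases "inner_shape n \<mu> T i = 0")
    case False
    then show ?thesis using inner_shape_iff[OF i, of "inner_shape n \<mu> T i"] by (simp add: diagram_def)
  qed simp
  ultimately show ?thesis by (simp add: interlacing_partitions_def)
qed

lemma diagram_inner_shape: "diagram (inner_shape n \<mu> T) = {b \<in> diagram \<mu>. T b \<le> n}"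
proof (rule set_eqI)
  fix b :: "nat \<times> nat"
  obtain i j where b: "b = (i, j)" by (rule prod.exhaust)
  show "b \<in> diagram (inner_shape n \<mu> T) \<longleftrightarrow> b \<in> {b \<in> diagram \<mu>. T b \<le> n}"
  proof (cases "1 \<le> i \<and> 1 \<le> j")
    case True
    then show ?thesis using inner_shape_iff[of i j] unfolding b by (simp add: diagram_def)
  next
    case False
    then show ?thesis unfolding b by (auto simp: diagram_def)
  qed
qed

lemma restrict_ssyt:
  assumes "\<forall>i>Suc n. \<mu> i = 0"
  shows "restrict T (diagram (inner_shape n \<mu> T)) \<in> ssyt n (inner_shape n \<mu> T)"
proof -
  have T': "T b \<in> {1..Suc n}" if "b \<in> diagram \<mu>" for b
    using T that unfolding ssyt_def by blast
  have "restrict T (diagram (inner_shape n \<mu> T)) \<in> diagram (inner_shape n \<mu> T) \<rightarrow>\<^sub>E {1..n}"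
  proof (rule restrict_PiE_iff[THEN iffD2], rule ballI)
    fix b assume "b \<in> diagram (inner_shape n \<mu> T)"
    then show "T b \<in> {1..n}" unfolding diagram_inner_shape using T'[of b] by simp
  qed
  then show ?thesis
    unfolding ssyt_def using ssyt_row ssyt_column by (simp add: diagram_inner_shape)
qed

end

text \<open>
  The inverse of restricting a tableau to its entries at most \<open>n\<close>.
\<close>

definition extend_tableau :: "nat \<Rightarrow> (nat \<Rightarrow> nat) \<Rightarrow> (nat \<Rightarrow> nat) \<Rightarrow> (nat \<times> nat \<Rightarrow> nat) \<Rightarrow> nat \<times> nat \<Rightarrow> nat" where
  "extend_tableau n \<mu> \<nu> T b = (if b \<in> diagram \<nu> then T b else if b \<in> diagram \<mu> then Suc n else undefined)"

lemma extend_tableau_ssyt: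
  assumes "is_partition \<mu>" "\<nu> \<in> interlacing_partitions n \<mu>" "\<forall>i>Suc n. \<mu> i = 0" "T \<in> ssyt n \<nu>"
  shows "extend_tableau n \<mu> \<nu> T \<in> ssyt (Suc n) \<mu>"
    and "{b \<in> diagram \<mu>. extend_tableau n \<mu> \<nu> T b \<le> n} = diagram \<nu>"
proof -
  let ?E = "extend_tableau n \<mu> \<nu> T"
  have sub: "diagram \<nu> \<subseteq> diagram \<mu>"
    using interlacing_partition(2)[OF assms(1,2)] by (auto simp: diagram_def intro: order_trans)
  have T: "T b \<in> {1..n}" if "b \<in> diagram \<nu>" for b
    using assms(4) that unfolding ssyt_def by blast
  show "{b \<in> diagram \<mu>. ?E b \<le> n} = diagram \<nu>"
  proof (rule set_eqI)
    fix b
    show "b \<in> {b \<in> diagram \<mu>. ?E b \<le> n} \<longleftrightarrow> b \<in> diagram \<nu>"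
      using sub T[of b] by (cases "b \<in> diagram \<nu>") (auto simp: extend_tableau_def)
  qed
  have "?E \<in> diagram \<mu> \<rightarrow>\<^sub>E {1..Suc n}"
  proof (rule PiE_I)
    fix b assume "b \<in> diagram \<mu>"
    then show "?E b \<in> {1..Suc n}"
      using T[of b] by (cases "b \<in> diagram \<nu>") (simp_all add: extend_tableau_def)
  next
    fix b assume "b \<notin> diagram \<mu>"
    then show "?E b = undefined" using sub by (auto simp: extend_tableau_def)
  qed
  moreover have "?E (i, j) \<le> ?E (i, Suc j)" if "(i, j) \<in> diagram \<mu>" "(i, Suc j) \<in> diagram \<mu>" for i j
  proof (cases "(i, Suc j) \<in> diagram \<nu>")
    case True
    then have "(i, j) \<in> diagram \<nu>" using that by (simp add: diagram_def)
    moreover from this True have "T (i, j) \<le> T (i, Suc j)" using assms(4) unfolding ssyt_def by blast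
    ultimately show ?thesis using True by (simp add: extend_tableau_def)
  next
    case False
    then show ?thesis using that T[of "(i, j)"] by (cases "(i, j) \<in> diagram \<nu>") (simp_all add: extend_tableau_def)
  qed
  moreover have "?E (i, j) < ?E (Suc i, j)" if d: "(i, j) \<in> diagram \<mu>" "(Suc i, j) \<in> diagram \<mu>" for i j
  proof -
    have ij: "1 \<le> i" "1 \<le> j" "j \<le> \<mu> (Suc i)" using d by (simp_all add: diagram_def)
    then have "\<mu> (Suc i) \<noteq> 0" by simp
    then have "i \<le> n" using assms(3) by (cases "Suc n < Suc i") simp_all
    then have "\<mu> (Suc i) \<le> \<nu> i" using assms(2) ij(1) by (simp add: interlacing_partitions_def)
    then have up: "(i, j) \<in> diagram \<nu>" using ij by (simp add: diagram_def)
    show ?thesis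
    proof (cases "(Suc i, j) \<in> diagram \<nu>")
      case True
      moreover from this up have "T (i, j) < T (Suc i, j)" using assms(4) unfolding ssyt_def by blast
      ultimately show ?thesis using up by (simp add: extend_tableau_def)
    next
      case False
      then show ?thesis using T[OF up] up d(2) by (simp add: extend_tableau_def)
    qed
  qed
  ultimately show "?E \<in> ssyt (Suc n) \<mu>" unfolding ssyt_def by simp
qed

lemma diagram_inject:
  assumes "\<mu> 0 = 0" "\<nu> 0 = 0" "diagram \<mu> = diagram \<nu>"
  shows "\<mu> = \<nu>"
proof
  fix i
  have le: "a i \<le> b i" if "diagram a \<subseteq> diagram b" "a 0 = 0" for a b :: "nat \<Rightarrow> nat"
  proof (cases "a i = 0")
    case False
    then have "i \<noteq> 0" using that(2) by (cases i) simp_all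
    then have "(i, a i) \<in> diagram a" using False by (simp add: diagram_def)
    then have "(i, a i) \<in> diagram b" using that(1) by blast
    then show ?thesis by (simp add: diagram_def)
  qed simp
  show "\<mu> i = \<nu> i" using le[of \<mu> \<nu>] le[of \<nu> \<mu>] assms by simp
qed

text \<open>
  A tableau with entries in \<open>{1..n+1}\<close> consists of its entries at most \<open>n\<close>, which form a tableau
  of an interlacing shape, and of a horizontal strip filled with \<open>n + 1\<close>.
\<close>

theorem tableau_sum_branching:
  assumes "is_partition \<mu>" "\<forall>i>Suc n. \<mu> i = 0"
  shows "tableau_sum (Suc n) \<mu> v =
    (\<Sum>\<nu>\<in>interlacing_partitions n \<mu>. v (Suc n) ^ card (diagram \<mu> - diagram \<nu>) * tableau_sum n \<nu> v)"
proof -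
  let ?I = "interlacing_partitions n \<mu>"
  have fin: "finite ?I"
  proof (rule finite_subset)
    show "?I \<subseteq> {\<nu>. \<forall>i. (i \<in> {..n} \<longrightarrow> \<nu> i \<in> {..\<mu> 1}) \<and> (i \<notin> {..n} \<longrightarrow> \<nu> i = 0)}"
    proof (rule subsetI, rule CollectI, intro conjI allI impI)
      fix \<nu> i assume \<nu>: "\<nu> \<in> ?I"
      show "\<nu> i \<in> {..\<mu> 1}" if "i \<in> {..n}"
      proof (cases "i = 0")
        case True
        then show ?thesis using \<nu> by (simp add: interlacing_partitions_def)
      next
        case False
        then show ?thesis
          using interlacing_partition(2)[OF assms(1) \<nu>, of i] partition_antimono[OF assms(1), of 1 i] by simp
      qed
      show "\<nu> i = 0" if "i \<notin> {..n}" using \<nu> that by (simp add: interlacing_partitions_def)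
    qed
    show "finite {\<nu>. \<forall>i. (i \<in> {..n} \<longrightarrow> \<nu> i \<in> {..\<mu> 1}) \<and> (i \<notin> {..n} \<longrightarrow> \<nu> i = 0)}"
      by (rule finite_set_of_finite_funs) simp_all
  qed
  have fin2: "finite (ssyt n \<nu>)" if "\<nu> \<in> ?I" for \<nu>
  proof -
    have "finite (diagram \<nu> \<rightarrow>\<^sub>E {1..n})"
      using finite_diagram[OF interlacing_partition(1)[OF assms(1) that]] by (intro finite_PiE) simp_all
    then show ?thesis by (rule rev_finite_subset) (auto simp: ssyt_def)
  qed
  let ?split = "\<lambda>T. (inner_shape n \<mu> T, restrict T (diagram (inner_shape n \<mu> T)))"
  have "tableau_sum (Suc n) \<mu> v =
    (\<Sum>(\<nu>, T)\<in>(SIGMA \<nu>:?I. ssyt n \<nu>). v (Suc n) ^ card (diagram \<mu> - diagram \<nu>) * (\<Prod>b\<in>diagram \<nu>. v (T b)))"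
    unfolding tableau_sum_def
  proof (rule sum.reindex_bij_witness[of _ "\<lambda>(\<nu>, T). extend_tableau n \<mu> \<nu> T" ?split])
    fix T assume T: "T \<in> ssyt (Suc n) \<mu>"
    let ?\<nu> = "inner_shape n \<mu> T"
    note diag = diagram_inner_shape[OF assms(1) T]
    have ext: "T \<in> diagram \<mu> \<rightarrow>\<^sub>E {1..Suc n}" using T unfolding ssyt_def by blast
    have big: "T b = Suc n" if "b \<in> diagram \<mu> - diagram ?\<nu>" for b
    proof -
      have "T b \<in> {1..Suc n}" using ext that by blast
      moreover have "\<not> T b \<le> n" using that unfolding diag by blast
      ultimately show ?thesis by simp
    qed
    show "(case ?split T of (\<nu>, T') \<Rightarrow> extend_tableau n \<mu> \<nu> T') = T"
    proof
      fix b
      consider "b \<in> diagram ?\<nu>" | "b \<in> diagram \<mu> - diagram ?\<nu>" | "b \<notin> diagram \<mu>" "b \<notin> diagram ?\<nu>"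
        unfolding diag by blast
      then show "(case ?split T of (\<nu>, T') \<Rightarrow> extend_tableau n \<mu> \<nu> T') b = T b"
      proof cases
        case 2
        then show ?thesis using big by (simp add: extend_tableau_def)
      next
        case 3
        then show ?thesis using PiE_arb[OF ext] by (simp add: extend_tableau_def)
      qed (simp add: extend_tableau_def)
    qed
    show "?split T \<in> (SIGMA \<nu>:?I. ssyt n \<nu>)"
      using inner_shape_interlacing[OF assms(1) T assms(2)] restrict_ssyt[OF assms(1) T assms(2)] by simp
    have "(\<Prod>b\<in>diagram \<mu>. v (T b)) = (\<Prod>b\<in>diagram \<mu> - diagram ?\<nu>. v (T b)) * (\<Prod>b\<in>diagram ?\<nu>. v (T b))"
      by (rule prod.subset_diff[OF _ finite_diagram[OF assms(1)]]) (unfold diag, blast)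
    also have "(\<Prod>b\<in>diagram \<mu> - diagram ?\<nu>. v (T b)) = (\<Prod>b\<in>diagram \<mu> - diagram ?\<nu>. v (Suc n))"
      by (rule prod.cong[OF refl]) (simp only: big)
    finally show "(case ?split T of (\<nu>, T') \<Rightarrow>
        v (Suc n) ^ card (diagram \<mu> - diagram \<nu>) * (\<Prod>b\<in>diagram \<nu>. v (T' b))) = (\<Prod>b\<in>diagram \<mu>. v (T b))"
      by simp
  next
    fix p assume "p \<in> (SIGMA \<nu>:?I. ssyt n \<nu>)"
    then obtain \<nu> T where p: "p = (\<nu>, T)" "\<nu> \<in> ?I" "T \<in> ssyt n \<nu>" by blast
    let ?E = "extend_tableau n \<mu> \<nu> T"
    note E = extend_tableau_ssyt[OF assms(1) p(2) assms(2) p(3)]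
    show "(case p of (\<nu>, T) \<Rightarrow> extend_tableau n \<mu> \<nu> T) \<in> ssyt (Suc n) \<mu>"
      using E(1) p(1) by simp
    have diag: "diagram (inner_shape n \<mu> ?E) = diagram \<nu>"
      unfolding diagram_inner_shape[OF assms(1) E(1)] by (rule E(2))
    have "\<nu> 0 = 0" using p(2) by (simp add: interlacing_partitions_def)
    then have shape: "inner_shape n \<mu> ?E = \<nu>"
      by (intro diagram_inject diag) (simp_all add: inner_shape_def diagram_def)
    have "restrict ?E (diagram \<nu>) = T"
    proof (rule extensionalityI[of _ "diagram \<nu>"])
      show "T \<in> extensional (diagram \<nu>)" using p(3) unfolding ssyt_def PiE_def by blast
    qed (simp_all add: extend_tableau_def)
    then show "?split (case p of (\<nu>, T) \<Rightarrow> extend_tableau n \<mu> \<nu> T) = p"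
      unfolding p(1) by (simp add: shape)
  qed
  also have "\<dots> = (\<Sum>\<nu>\<in>?I. \<Sum>T\<in>ssyt n \<nu>. v (Suc n) ^ card (diagram \<mu> - diagram \<nu>) * (\<Prod>b\<in>diagram \<nu>. v (T b)))"
    by (rule sum.Sigma[symmetric]) (use fin fin2 in blast)+
  finally show ?thesis by (simp only: tableau_sum_def sum_distrib_left)
qed

section \<open>Schur polynomials as alternants\<close>

lemma interlacing_iff:
  assumes "as \<noteq> []"
  shows "bs \<in> interlacing as \<longleftrightarrow>
    length as = Suc (length bs) \<and> (\<forall>i<length bs. as ! Suc i \<le> bs ! i \<and> bs ! i < as ! i)"
  using assms
proof (induction as arbitrary: bs rule: interlacing.induct)
  case (1 a a' as)
  show ?case
  proof (cases bs)
    case Nil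
    then show ?thesis by auto
  next
    case (Cons b bs')
    have "bs \<in> interlacing (a # a' # as) \<longleftrightarrow> a' \<le> b \<and> b < a \<and> bs' \<in> interlacing (a' # as)"
      unfolding Cons by auto
    also have "\<dots> \<longleftrightarrow> a' \<le> b \<and> b < a \<and> length (a' # as) = Suc (length bs') \<and>
        (\<forall>i<length bs'. (a' # as) ! Suc i \<le> bs' ! i \<and> bs' ! i < (a' # as) ! i)"
      using "1.IH"[of bs'] by simp
    finally show ?thesis unfolding Cons by (auto simp: All_less_Suc2)
  qed
qed auto

lemma gap_sum_eq:
  "length as = Suc (length bs) \<Longrightarrow>
    gap_sum as bs = (\<Sum>i<length bs. as ! i - 1 - bs ! i) + as ! length bs"
proof (induction as bs rule: gap_sum.induct)
  case (1 a as b bs)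
  then show ?case by (simp add: sum.lessThan_Suc_shift del: sum.lessThan_Suc)
next
  case ("2_2" as)
  then show ?case by (cases as) simp_all
qed simp

text \<open>
  The exponents \<open>\<lambda> + \<rho>\<close> of the numerator alternant.
\<close>

definition shifted_parts :: "nat \<Rightarrow> (nat \<Rightarrow> nat) \<Rightarrow> nat list" where
  "shifted_parts n \<mu> = map (\<lambda>i. \<mu> (Suc i) + (n - Suc i)) [0..<n]"

lemma shifted_parts_nth: "i < n \<Longrightarrow> shifted_parts n \<mu> ! i = \<mu> (Suc i) + (n - Suc i)"
  by (simp add: shifted_parts_def)

lemma length_shifted_parts: "length (shifted_parts n \<mu>) = n"
  by (simp add: shifted_parts_def)

lemma card_skew_diagram:
  assumes "\<nu> \<in> interlacing_partitions n \<mu>" "\<mu> 0 = 0" "\<forall>i>Suc n. \<mu> i = 0"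
  shows "card (diagram \<mu> - diagram \<nu>) = gap_sum (shifted_parts (Suc n) \<mu>) (shifted_parts n \<nu>)"
proof -
  have "diagram \<mu> - diagram \<nu> = (SIGMA i:{1..Suc n}. {\<nu> i<..\<mu> i})"
  proof (rule set_eqI)
    fix b :: "nat \<times> nat"
    obtain i j where b: "b = (i, j)" by (rule prod.exhaust)
    have "1 \<le> i \<and> 1 \<le> j \<and> j \<le> \<mu> i \<and> \<not> j \<le> \<nu> i \<longleftrightarrow> 1 \<le> i \<and> i \<le> Suc n \<and> \<nu> i < j \<and> j \<le> \<mu> i"
      using assms(3) by (cases "Suc n < i") auto
    then show "b \<in> diagram \<mu> - diagram \<nu> \<longleftrightarrow> b \<in> (SIGMA i:{1..Suc n}. {\<nu> i<..\<mu> i})"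
      unfolding b by (auto simp: diagram_def)
  qed
  then have "card (diagram \<mu> - diagram \<nu>) = (\<Sum>i\<in>{1..Suc n}. \<mu> i - \<nu> i)" by simp
  also have "\<dots> = (\<Sum>i<n. \<mu> (Suc i) - \<nu> (Suc i)) + (\<mu> (Suc n) - \<nu> (Suc n))"
    by (simp add: sum.atLeast1_atMost_eq)
  also have "\<nu> (Suc n) = 0" using assms(1) by (simp add: interlacing_partitions_def)
  also have "(\<Sum>i<n. \<mu> (Suc i) - \<nu> (Suc i)) =
      (\<Sum>i<n. shifted_parts (Suc n) \<mu> ! i - 1 - shifted_parts n \<nu> ! i)"
  proof (rule sum.cong[OF refl])
    fix i assume "i \<in> {..<n}"
    then have "i < n" "i < Suc n" by simp_all
    then show "\<mu> (Suc i) - \<nu> (Suc i) = shifted_parts (Suc n) \<mu> ! i - 1 - shifted_parts n \<nu> ! i"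
      unfolding shifted_parts_nth[OF \<open>i < n\<close>] shifted_parts_nth[OF \<open>i < Suc n\<close>] by linarith
  qed
  also have "\<mu> (Suc n) - 0 = shifted_parts (Suc n) \<mu> ! n"
    by (simp add: shifted_parts_nth[of n "Suc n"])
  finally show ?thesis
    by (simp only: gap_sum_eq length_shifted_parts)
qed

lemma sum_interlacing_partitions:
  assumes "is_partition \<mu>"
  shows "(\<Sum>\<nu>\<in>interlacing_partitions n \<mu>. f (shifted_parts n \<nu>)) =
    (\<Sum>bs\<in>interlacing (shifted_parts (Suc n) \<mu>). f bs)"
proof -
  define unshift where "unshift = (\<lambda>bs i. if 1 \<le> i \<and> i \<le> n then bs ! (i - 1) - (n - i) else 0 :: nat)"
  let ?as = "shifted_parts (Suc n) \<mu>"
  have ne: "?as \<noteq> []" by (simp add: shifted_parts_def)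
  have as: "?as ! i = \<mu> (Suc i) + (n - i)" if "i \<le> n" for i
    using shifted_parts_nth[of i "Suc n" \<mu>] that by simp
  have mem: "bs \<in> interlacing ?as \<longleftrightarrow> length bs = n \<and>
      (\<forall>i<n. \<mu> (Suc (Suc i)) + (n - Suc i) \<le> bs ! i \<and> bs ! i \<le> \<mu> (Suc i) + (n - Suc i))" for bs
  proof -
    have "(\<mu> (Suc (Suc i)) + (n - Suc i) \<le> bs ! i \<and> bs ! i \<le> \<mu> (Suc i) + (n - Suc i)) \<longleftrightarrow>
        (?as ! Suc i \<le> bs ! i \<and> bs ! i < ?as ! i)" if "i < n" for i
      using that as[of i] as[of "Suc i"] by linarith
    then show ?thesis
      unfolding interlacing_iff[OF ne] length_shifted_parts by auto
  qed
  show ?thesis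
  proof (rule sum.reindex_bij_witness[of _ unshift "shifted_parts n"])
    fix \<nu> assume \<nu>: "\<nu> \<in> interlacing_partitions n \<mu>"
    show "unshift (shifted_parts n \<nu>) = \<nu>"
    proof
      fix i
      show "unshift (shifted_parts n \<nu>) i = \<nu> i"
      proof (cases "1 \<le> i \<and> i \<le> n")
        case True
        then have "i - 1 < n" "Suc (i - 1) = i" by linarith+
        then show ?thesis using True by (simp add: unshift_def shifted_parts_nth)
      next
        case False
        then have "i = 0 \<or> n < i" by linarith
        then show ?thesis using \<nu> by (elim disjE) (simp_all add: unshift_def interlacing_partitions_def)
      qed
    qed
    have \<nu>': "\<mu> (Suc (Suc i)) \<le> \<nu> (Suc i)" "\<nu> (Suc i) \<le> \<mu> (Suc i)" if "i < n" for i
      using \<nu> that by (simp_all add: interlacing_partitions_def)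
    show "shifted_parts n \<nu> \<in> interlacing ?as"
      unfolding mem
    proof (intro conjI allI impI length_shifted_parts)
      fix i assume i: "i < n"
      show "\<mu> (Suc (Suc i)) + (n - Suc i) \<le> shifted_parts n \<nu> ! i"
        "shifted_parts n \<nu> ! i \<le> \<mu> (Suc i) + (n - Suc i)"
        unfolding shifted_parts_nth[OF i] by (rule add_right_mono[OF \<nu>'(1)[OF i]] add_right_mono[OF \<nu>'(2)[OF i]])+
    qed
  next
    fix bs assume "bs \<in> interlacing ?as"
    then have bs: "length bs = n" "\<And>i. i < n \<Longrightarrow> \<mu> (Suc (Suc i)) + (n - Suc i) \<le> bs ! i"
      "\<And>i. i < n \<Longrightarrow> bs ! i \<le> \<mu> (Suc i) + (n - Suc i)"
      unfolding mem by simp_all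
    show "shifted_parts n (unshift bs) = bs"
    proof (rule nth_equalityI)
      fix i assume "i < length (shifted_parts n (unshift bs))"
      then have "i < n" by (simp add: length_shifted_parts)
      then show "shifted_parts n (unshift bs) ! i = bs ! i"
        using bs(2)[of i] by (simp add: shifted_parts_nth unshift_def)
    qed (simp add: length_shifted_parts bs(1))
    show "unshift bs \<in> interlacing_partitions n \<mu>"
    proof -
      have "\<mu> (Suc i) \<le> unshift bs i \<and> unshift bs i \<le> \<mu> i" if "1 \<le> i" "i \<le> n" for i
      proof -
        have "i - 1 < n" "Suc (i - 1) = i" using that by linarith+
        then have "\<mu> (Suc i) + (n - i) \<le> bs ! (i - 1)" "bs ! (i - 1) \<le> \<mu> i + (n - i)"
          using bs(2)[of "i - 1"] bs(3)[of "i - 1"] by (simp_all only: simp_thms)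
        moreover have "unshift bs i = bs ! (i - 1) - (n - i)"
          using that by (simp only: unshift_def simp_thms if_True)
        ultimately show ?thesis by linarith
      qed
      then show ?thesis unfolding interlacing_partitions_def by (simp add: unshift_def)
    qed
  qed simp
qed

text \<open>
  Both sides satisfy the same branching rule.
\<close>

theorem tableau_sum_eq_alternant_sum:
  fixes v :: "nat \<Rightarrow> 'a::field_char_0"
  assumes "is_partition \<mu>" "\<forall>i>n. \<mu> i = 0" "inj v"
  shows "tableau_sum n \<mu> v = alternant_sum (v ` {1..n}) (shifted_parts n \<mu>)"
  using assms(1,2)
proof (induction n arbitrary: \<mu>)
  case 0
  have "\<mu> i = 0" for i
    using 0 by (cases i) (simp_all add: is_partition_def weak_comp_def)
  then have "diagram \<mu> = {}" by (auto simp: diagram_def)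
  then show ?case by (simp add: tableau_sum_def ssyt_def shifted_parts_def)
next
  case (Suc n)
  let ?s = "v (Suc n)" and ?S = "v ` {1..Suc n}" and ?as = "shifted_parts (Suc n) \<mu>"
  have S: "?S - {?s} = v ` {1..n}"
  proof -
    have "{1..Suc n} = insert (Suc n) {1..n}" by auto
    moreover have "?s \<notin> v ` {1..n}" using assms(3) by (auto simp: inj_eq)
    ultimately show ?thesis by simp
  qed
  have sorted: "sorted_wrt (\<ge>) ?as"
    unfolding shifted_parts_def sorted_wrt_map
  proof (rule sorted_wrt_mono_rel[OF _ sorted_wrt_upt])
    fix i j :: nat assume "i < j"
    then show "\<mu> (Suc j) + (Suc n - Suc j) \<le> \<mu> (Suc i) + (Suc n - Suc i)"
      using partition_antimono[OF Suc.prems(1), of "Suc i" "Suc j"] by simp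
  qed
  have card: "length ?as = card ?S"
    using assms(3) by (simp add: length_shifted_parts card_image inj_on_subset[OF _ subset_UNIV])
  have "tableau_sum (Suc n) \<mu> v =
      (\<Sum>\<nu>\<in>interlacing_partitions n \<mu>. ?s ^ card (diagram \<mu> - diagram \<nu>) * tableau_sum n \<nu> v)"
    by (rule tableau_sum_branching[OF Suc.prems])
  also have "\<dots> = (\<Sum>\<nu>\<in>interlacing_partitions n \<mu>.
      ?s ^ gap_sum ?as (shifted_parts n \<nu>) * alternant_sum (v ` {1..n}) (shifted_parts n \<nu>))"
  proof (rule sum.cong[OF refl])
    fix \<nu> assume \<nu>: "\<nu> \<in> interlacing_partitions n \<mu>"
    have "\<mu> 0 = 0" using Suc.prems(1) by (simp add: is_partition_def weak_comp_def)
    moreover have "\<forall>i>n. \<nu> i = 0" using \<nu> by (simp add: interlacing_partitions_def)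
    ultimately show "?s ^ card (diagram \<mu> - diagram \<nu>) * tableau_sum n \<nu> v =
        ?s ^ gap_sum ?as (shifted_parts n \<nu>) * alternant_sum (v ` {1..n}) (shifted_parts n \<nu>)"
      using card_skew_diagram[OF \<nu> _ Suc.prems(2)] Suc.IH[OF interlacing_partition(1)[OF Suc.prems(1) \<nu>]] by simp
  qed
  also have "\<dots> = (\<Sum>bs\<in>interlacing ?as. ?s ^ gap_sum ?as bs * alternant_sum (v ` {1..n}) bs)"
    by (rule sum_interlacing_partitions[OF Suc.prems(1)])
  also have "\<dots> = alternant_sum ?S ?as"
    using alternant_sum_branching[of ?S ?s ?as] card sorted unfolding S by simp
  finally show ?case .
qed

section \<open>Key polynomials of reversed partitions\<close>

lemma eval_x_pow:
  assumes "\<forall>i>n. \<mu> i = 0" "\<mu> 0 = 0"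
  shows "eval_mpoly u (x_pow \<mu>) = (\<Prod>i<length (map u [1..<Suc n]). map u [1..<Suc n] ! i ^ \<mu> (Suc i))"
proof -
  have sub: "{i. \<mu> i \<noteq> 0} \<subseteq> {1..n}"
  proof
    fix i assume i: "i \<in> {i. \<mu> i \<noteq> 0}"
    then have "i \<noteq> 0" using assms(2) by (cases i) simp_all
    moreover have "\<not> n < i" using i assms(1) by auto
    ultimately show "i \<in> {1..n}" by simp
  qed
  have "eval_mpoly u (x_pow \<mu>) = (\<Prod>i\<in>{i. \<mu> i \<noteq> 0}. u i ^ \<mu> i)"
    by (simp add: x_pow_def eval_mpoly_simps)
  also have "\<dots> = (\<Prod>i\<in>{1..n}. u i ^ \<mu> i)"
    by (rule prod.mono_neutral_left[OF _ sub]) simp_all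
  also have "\<dots> = (\<Prod>i<n. u (Suc i) ^ \<mu> (Suc i))"
    by (simp add: prod.atLeast1_atMost_eq)
  also have "\<dots> = (\<Prod>i<n. map u [1..<Suc n] ! i ^ \<mu> (Suc i))"
    by (rule prod.cong[OF refl]) (simp only: nth_map_upt_1 lessThan_iff)
  finally show ?thesis by (simp del: upt_Suc)
qed

lemma x_pow_swap_invariant:
  assumes "\<mu> i = \<mu> (Suc i)"
  shows "swap_invariant i (x_pow \<mu>)"
proof (rule mpoly_eqI)
  fix v :: "nat \<Rightarrow> mpoly fract"
  have row: "\<mu> (adj_swap i j) = \<mu> j" for j
    using assms by (simp add: Transposition.transpose_def)
  have "eval_mpoly v (permute (adj_swap i) (x_pow \<mu>)) = (\<Prod>j\<in>{j. \<mu> j \<noteq> 0}. v (adj_swap i j) ^ \<mu> j)"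
    by (simp add: eval_mpoly_permute x_pow_def eval_mpoly_simps)
  also have "\<dots> = (\<Prod>j\<in>{j. \<mu> j \<noteq> 0}. v j ^ \<mu> j)"
    by (rule prod.reindex_bij_witness[of _ "adj_swap i" "adj_swap i"]) (simp_all add: row)
  also have "\<dots> = eval_mpoly v (x_pow \<mu>)"
    by (simp add: x_pow_def eval_mpoly_simps)
  finally show "eval_mpoly v (permute (adj_swap i) (x_pow \<mu>)) = eval_mpoly v (x_pow \<mu>)" .
qed

lemma X_nonzero: "Fract (X i) 1 \<noteq> 0"
proof
  assume "Fract (X i) 1 = 0"
  then have "X i = 0" by (simp add: Zero_fract_def eq_fract)
  then have "eval_mpoly (\<lambda>_. 1 :: int) (X i) = 0" by simp
  then show False by simp
qed

text \<open>
  The products over the two halves with the factor 2 of every diagonal cell removed. This treats both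
  cases alike, and for \<open>e = 1\<close> it provides the polynomial whose multiple by a power of 2 is \<open>Q\<^sub>\<nu>\<close>.
\<close>

definition half_seed :: "nat \<Rightarrow> (nat \<Rightarrow> nat) \<Rightarrow> mpoly" where
  "half_seed e \<mu> = (\<Prod>i\<in>{i. i \<noteq> 0 \<and> i \<le> \<mu> i}. X i ^ e) * half_poly 1 \<mu>"

lemma half_poly_1_eq_seed: "half_poly 1 \<mu> = half_seed 0 \<mu>"
  by (simp add: half_seed_def)

lemma half_poly_0_eq_seed:
  assumes "is_partition \<mu>"
  shows "half_poly 0 \<mu> = 2 ^ num_parts (half_partition 1 \<mu>) * half_seed 1 \<mu>"
proof -
  let ?I = "{i. i \<noteq> 0 \<and> i \<le> \<mu> i}"
  have supp: "finite {i. \<mu> i \<noteq> 0}" using assms by (simp add: is_partition_def weak_comp_def)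
  have fin: "finite ?I" by (rule finite_subset[OF _ supp]) auto
  have "half_pairs 1 \<mu> \<subseteq> (SIGMA i:{i. \<mu> i \<noteq> 0}. {..\<mu> i})" by (auto simp: half_pairs_def)
  then have fin1: "finite (half_pairs 1 \<mu>)" by (rule finite_subset) (rule finite_SigmaI[OF supp finite_atMost])
  have split: "half_pairs 0 \<mu> = (\<lambda>i. (i, i)) ` ?I \<union> half_pairs 1 \<mu>"
  proof (rule set_eqI)
    fix q :: "nat \<times> nat"
    obtain i k where q: "q = (i, k)" by (rule prod.exhaust)
    have "1 \<le> i \<and> i \<le> k \<and> k \<le> \<mu> i \<longleftrightarrow> (k = i \<and> i \<noteq> 0 \<and> i \<le> \<mu> i) \<or> (1 \<le> i \<and> i + 1 \<le> k \<and> k \<le> \<mu> i)"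
      by linarith
    then show "q \<in> half_pairs 0 \<mu> \<longleftrightarrow> q \<in> (\<lambda>i. (i, i)) ` ?I \<union> half_pairs 1 \<mu>"
      unfolding q half_pairs_def by (simp add: image_iff) blast
  qed
  have "half_poly 0 \<mu> = (\<Prod>(i, k)\<in>(\<lambda>i. (i, i)) ` ?I. X i + X k) * half_poly 1 \<mu>"
    unfolding half_poly_def split
    by (rule prod.union_disjoint) (use fin fin1 in \<open>auto simp: half_pairs_def\<close>)
  also have "(\<Prod>(i, k)\<in>(\<lambda>i. (i, i)) ` ?I. X i + X k) = (\<Prod>i\<in>?I. 2 * X i)"
  proof (rule prod.reindex_cong[of "\<lambda>i. (i, i)"])
    show "inj_on (\<lambda>i. (i, i)) ?I" by (rule inj_onI) simp
  qed (simp_all only: prod.case mult_2)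
  also have "\<dots> = 2 ^ card ?I * (\<Prod>i\<in>?I. X i)"
    by (simp only: prod.distrib prod_constant)
  also have "card ?I = num_parts (half_partition 1 \<mu>)"
  proof -
    have "half_partition 1 \<mu> i \<noteq> 0 \<longleftrightarrow> i \<noteq> 0 \<and> i \<le> \<mu> i" for i
      by (simp add: half_partition_def less_Suc_eq_le)
    then show ?thesis by (simp only: num_parts_def)
  qed
  finally show ?thesis by (simp only: half_seed_def mult.assoc power_one_right)
qed

text \<open>
  For \<open>e = 1\<close> the invariance is inherited from the product over the whole half by cancelling the power
  of 2.
\<close>

lemma half_seed_swap_invariant:
  assumes "symmetric_partition \<mu>" "e \<le> 1" "1 \<le> i" "\<mu> i = \<mu> (Suc i)"
  shows "swap_invariant i (half_seed e \<mu>)"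
proof (cases "e = 0")
  case True
  then show ?thesis
    using half_poly_swap_invariant[of \<mu> 1 i] assms unfolding half_poly_1_eq_seed by simp
next
  case False
  let ?c = "2 ^ num_parts (half_partition 1 \<mu>) :: mpoly" and ?s = "adj_swap i"
  have part: "is_partition \<mu>" using assms(1) by (simp add: symmetric_partition_def)
  have e: "e = 1" using False assms(2) by simp
  have "permute ?s ?c = ?c"
    by (rule mpoly_eqI) (simp add: eval_mpoly_permute eval_mpoly_power eval_mpoly_of_int[of _ 2, simplified])
  then have "?c * permute ?s (half_seed 1 \<mu>) = permute ?s (?c * half_seed 1 \<mu>)"
    by (simp add: permute_mult)
  also have "\<dots> = ?c * half_seed 1 \<mu>"
    unfolding half_poly_0_eq_seed[OF part, symmetric]
    by (rule half_poly_swap_invariant[OF assms(1) _ assms(3,4)]) simp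
  finally show ?thesis unfolding e by simp
qed

lemma eval_half_seed:
  assumes "symmetric_partition \<mu>" "\<forall>i>n. \<mu> i = 0"
  shows "eval_mpoly u (half_seed e \<mu>) = half_product e (\<lambda>i. \<mu> (Suc i)) (map u [1..<Suc n])"
proof -
  let ?I = "{i. i \<noteq> 0 \<and> i \<le> \<mu> i}"
  have le: "i \<le> n" if "i \<in> ?I" for i
  proof (rule ccontr)
    assume "\<not> i \<le> n"
    then have "\<mu> i = 0" using assms(2) by simp
    then show False using that by auto
  qed
  have "(\<Prod>i<n. if i < \<mu> (Suc i) then u (Suc i) ^ e else 1) = (\<Prod>i\<in>{i\<in>{..<n}. i < \<mu> (Suc i)}. u (Suc i) ^ e)"
    by (rule prod.inter_filter[symmetric]) simp
  also have "\<dots> = (\<Prod>i\<in>?I. u i ^ e)"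
  proof (rule prod.reindex_bij_witness[of _ "\<lambda>i. i - 1" Suc])
    fix i assume i: "i \<in> ?I"
    then show "i - 1 \<in> {i \<in> {..<n}. i < \<mu> (Suc i)}" "Suc (i - 1) = i" using le[OF i] by auto
  qed auto
  also have "\<dots> = eval_mpoly u (\<Prod>i\<in>?I. X i ^ e)" by (simp add: eval_mpoly_simps)
  finally have "eval_mpoly u (half_seed e \<mu>) =
      (\<Prod>i<n. if i < \<mu> (Suc i) then u (Suc i) ^ e else 1) * eval_mpoly u (half_poly 1 \<mu>)"
    by (simp only: half_seed_def eval_mpoly_mult)
  also have "eval_mpoly u (half_poly 1 \<mu>) = (\<Prod>i<n. \<Prod>k\<in>{i<..<\<mu> (Suc i)}. u (Suc i) + u (Suc k))"
    unfolding eval_half_poly[OF assms(2)]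
    by (intro prod.cong refl) (simp add: atLeastSucLessThan_greaterThanLessThan)
  finally show ?thesis
    by (simp only: half_product_variables[OF assms] prod.distrib)
qed

text \<open>
  Symmetry of the partition enters through the invariance of the seed and through \<open>\<lambda>\<^sub>1 \<le> n\<close>, which bounds the
  columns by the number of variables.
\<close>

lemma schur_P_half_partition:
  assumes sym: "symmetric_partition \<mu>" and bound: "\<forall>i>n. \<mu> i = 0" and e: "e \<le> 1"
  shows "schur_P n (half_partition e \<mu>) = pi_perm (min_perm (rev_comp n \<mu>)) (half_seed e \<mu>)"
proof -
  let ?\<nu> = "half_partition e \<mu>" and ?l = "\<lambda>i. \<mu> (Suc i)"
  define v where "v = (\<lambda>i. Fract (X i) 1)"
  let ?S = "v ` {1..n}"
  have v: "inj v" "\<And>i. v i \<noteq> 0"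
    unfolding v_def by (rule inj_generic_point X_nonzero)+
  have part: "is_partition \<mu>" using sym by (simp add: symmetric_partition_def)
  have card: "card ?S = n"
    using v(1) by (simp add: card_image inj_on_subset[OF _ subset_UNIV])
  have strict: "is_partition ?\<nu>"
    using strict_half_partition[OF part e] by (simp add: strict_partition_def)
  note le = num_parts_half_le[OF bound e]
  have anti: "antimono ?l"
  proof (rule antimonoI)
    fix i j :: nat assume "i \<le> j"
    then show "\<mu> (Suc j) \<le> \<mu> (Suc i)" using partition_antimono[OF part, of "Suc i" "Suc j"] by simp
  qed
  have "Fract (pi_perm (min_perm (rev_comp n \<mu>)) (half_seed e \<mu>)) 1 = symmetrize n v (half_seed e \<mu>)"
    unfolding Fract_eq_eval[of "pi_perm _ _"] v_def[symmetric]
    by (rule pi_min_perm_rev_comp(2)[OF part bound half_seed_swap_invariant[OF sym e] v])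
  also have "\<dots> = (\<Sum>ys\<in>permutations_of_set ?S. half_product e ?l ys * weyl_kernel ys)"
    by (rule symmetrize_as_lists[OF v(1) eval_half_seed[OF sym bound]])
  also have "\<dots> = schur_P_sum ?S (half_parts e (card ?S) ?l)"
  proof (rule symmetrized_half_product[OF _ _ anti _ e])
    show "0 \<notin> ?S" using v(2) by (metis imageE)
    show "\<mu> (Suc 0) \<le> card ?S" unfolding card using symmetric_partition_bound[OF sym bound, of "Suc 0"] by simp
  qed simp
  also have "half_parts e (card ?S) ?l = map ?\<nu> [1..<Suc (num_parts ?\<nu>)]"
    unfolding card by (rule half_parts_eq[OF strict le])
  finally show ?thesis unfolding v_def by (rule schur_P_eqI[OF strict le])
qed

lemma symmetrize_const_mult:
  assumes "\<And>u. eval_mpoly u c = k"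
  shows "symmetrize n v (c * f) = k * symmetrize n v f"
  by (simp add: symmetrize_def eval_mpoly_mult assms sum_distrib_left mult.assoc)

theorem theorem2p38:
  fixes n :: nat and lam :: "nat \<Rightarrow> nat"
  assumes "is_partition lam" and "\<forall>i>n. lam i = 0"
  shows "schur_poly n lam = key_poly (rev_comp n lam) \<and>
    (symmetric_partition lam \<longrightarrow>
       schur_P n (half_lt lam) = key_P (rev_comp n lam) \<and>
       schur_Q n (half_le lam) = key_Q (rev_comp n lam))"
proof (intro conjI impI)
  define v where "v = (\<lambda>i. Fract (X i) 1)"
  have v: "inj v" "\<And>i. v i \<noteq> 0"
    unfolding v_def by (rule inj_generic_point X_nonzero)+
  have eval: "Fract f 1 = eval_mpoly v f" for f
    unfolding v_def by (rule Fract_eq_eval)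
  have FractD: "f = g" if "Fract f 1 = Fract g 1" for f g :: mpoly
    using that by (simp add: eq_fract)
  have card: "card (v ` {1..n}) = n"
    using v(1) by (simp add: card_image inj_on_subset[OF _ subset_UNIV])
  note key = pi_min_perm_rev_comp[OF assms _ v]
  have lam0: "lam 0 = 0" using assms(1) by (simp add: is_partition_def weak_comp_def)
  show "schur_poly n lam = key_poly (rev_comp n lam)"
  proof (rule FractD)
    have inv: "swap_invariant i (x_pow lam)" if "1 \<le> i" "lam i = lam (Suc i)" for i
      by (rule x_pow_swap_invariant[OF that(2)])
    have "Fract (schur_poly n lam) 1 = alternant_sum (v ` {1..n}) (shifted_parts n lam)"
      unfolding eval eval_schur_poly by (rule tableau_sum_eq_alternant_sum[OF assms v(1)])
    also have "\<dots> = (\<Sum>ys\<in>permutations_of_set (v ` {1..n}). (\<Prod>i<length ys. ys ! i ^ lam (Suc i)) * weyl_kernel ys)"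
      using symmetrized_monomial[of "v ` {1..n}" "\<lambda>i. lam (Suc i)"] unfolding card shifted_parts_def by simp
    also have "\<dots> = symmetrize n v (x_pow lam)"
      by (rule symmetrize_as_lists[OF v(1) eval_x_pow[OF assms(2) lam0], symmetric])
    also have "\<dots> = Fract (key_poly (rev_comp n lam)) 1"
      by (simp only: eval key_poly_def key(1)[OF inv] key(2)[OF inv])
    finally show "Fract (schur_poly n lam) 1 = Fract (key_poly (rev_comp n lam)) 1" .
  qed
  assume sym: "symmetric_partition lam"
  show "schur_P n (half_lt lam) = key_P (rev_comp n lam)"
  proof -
    have inv: "swap_invariant i (half_seed 0 lam)" if "1 \<le> i" "lam i = lam (Suc i)" for i
      by (rule half_seed_swap_invariant[OF sym _ that]) simp
    show ?thesis
      by (simp only: key_P_def key_P_pair_def key(1)[OF inv] half_lt_eq[OF assms(1)] half_poly_1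
          half_poly_1_eq_seed schur_P_half_partition[OF sym assms(2) zero_le])
  qed
  show "schur_Q n (half_le lam) = key_Q (rev_comp n lam)"
  proof (rule FractD)
    let ?c = "2 ^ num_parts (half_partition 1 lam) :: mpoly" and ?u = "min_perm (rev_comp n lam)"
    have inv0: "swap_invariant i (half_poly 0 lam)" if "1 \<le> i" "lam i = lam (Suc i)" for i
      by (rule half_poly_swap_invariant[OF sym _ that]) simp
    have inv1: "swap_invariant i (half_seed 1 lam)" if "1 \<le> i" "lam i = lam (Suc i)" for i
      by (rule half_seed_swap_invariant[OF sym _ that]) simp
    have c: "eval_mpoly w ?c = 2 ^ num_parts (half_partition 1 lam)" for w :: "nat \<Rightarrow> mpoly fract"
      using eval_mpoly_of_int[of w 2] by (simp add: eval_mpoly_power)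
    have "Fract (schur_Q n (half_le lam)) 1 = eval_mpoly v (?c * pi_perm ?u (half_seed 1 lam))"
      by (simp only: eval schur_Q_def half_le_eq[OF assms(1)] schur_P_half_partition[OF sym assms(2) order_refl])
    also have "\<dots> = symmetrize n v (?c * half_seed 1 lam)"
      by (simp only: eval_mpoly_mult c key(2)[OF inv1] symmetrize_const_mult[OF c])
    also have "\<dots> = eval_mpoly v (pi_perm ?u (half_poly 0 lam))"
      by (subst key(2)[OF inv0]) (simp_all only: half_poly_0_eq_seed[OF assms(1)])
    also have "\<dots> = Fract (key_Q (rev_comp n lam)) 1"
      by (simp only: eval key_Q_def key_Q_pair_def key(1)[OF inv0] half_le_eq[OF assms(1)] half_poly_0)
    finally show "Fract (schur_Q n (half_le lam)) 1 = Fract (key_Q (rev_comp n lam)) 1" .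
  qed
qed

end
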